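(* Let $\Bbbk$ be a field of characteristic $0$, let $n,s,d_1,\ldots,d_s$ be positive integers, and let $\preceq$ be the lexicographic order on the monomials of $S=\Bbbk[x_1,\ldots,x_n]$ with $x_1\succeq\cdots\succeq x_n$. If $n$, $s$ and the $d_i$ satisfy one of the following conditions, then the initial ideal with respect to $\preceq$ of $V$-generic ideals (that is, the common monomial ideal $\operatorname{in}_{\preceq}(I_{\mathbf{a}})$, $\mathbf{a}\in V$) is a lexsegment ideal: - $n=3$, $s=2$, and $2\le d_1,d_2\le 3$; - $n=3$, $s=3$, and $2\le d_1,d_2,d_3\le 3$; - $n=4$, $s=3$, and $2\le d_1,d_2,d_3\le 3$.
   Context: Parametrization. $S = \Bbbk[x_1,\ldots,x_n] = \bigoplus_{d\ge 0} S_d$ is graded with $\deg x_i = 1$. Let $r_i = \binom{n+d_i-1}{d_i}$ be the number of monomials of degree $d_i$ in $S$, and $N = \sum_{i=1}^s r_i$. A point $\mathbf{a} = (a_{j,k})_{1\le j\le s,\,1\le k\le r_j} \in \mathbb{A}_{\Bbbk}^N = \Bbbk^N$ corresponds to the homogeneous ideal $I_{\mathbf{a}} = (f_1,\ldots,f_s) \subset S$, where $f_j$ is the linear combination, with coefficients $a_{j,1},\ldots,a_{j,r_j}$, of all monomials of degree $d_j$ (in a fixed enumeration). The set $U$. For each $d \ge 0$ let $t_d = \max_{\mathbf{a}} \dim_{\Bbbk} (I_{\mathbf{a}})_d$ (maximum over all $\mathbf{a}\in\mathbb{A}_{\Bbbk}^N$), let $U_d = \{\mathbf{a} : \dim_{\Bbbk}(I_{\mathbf{a}})_d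 = t_d\}$, and let $U = \bigcap_{d\ge 0} U_d$. It is known that $U$ is a Zariski open dense subset of $\mathbb{A}_{\Bbbk}^N$. The set $V$ (depending on $\preceq$). For an ideal $I$, $\operatorname{in}_{\preceq}(I)$ is the ideal spanned over $\Bbbk$ by the initial terms $\operatorname{in}_{\preceq}(f)$, $f \in I$. For each $d$, a standard exterior monomial is an element $m_1\wedge\cdots\wedge m_{t_d}$ of $\bigwedge^{t_d} S_d$ with $m_1 \succ \cdots \succ m_{t_d}$ monomials of degree $d$; these are ordered lexicographically: $m_1\wedge\cdots\wedge m_{t_d} \ge m_1'\wedge\cdots\wedge m_{t_d}'$ iff they are equal or $m_i \succeq m_i'$ for the smallest $i$ with $m_i\ne m_i'$. For $\mathbf{a}\in U_d$, the monomials in $\operatorname{in}_{\preceq}(I_{\mathbf{a}})_d$ form one standard exterior monomial, which spans $\bigwedge^{t_d}\operatorname{in}_{\preceq}(I_{\mathbf{a}})_d$; let $m^{(d)}$ be the largest one obtained as $\mathbf{a}$ ranges over $U_d$. Let $V_d\subset U_d$ be the set of $\mathbf{a} \in U_d$ for which this standard exterior monomial equals $m^{(d)}$, and let $V = \bigcap_{d\ge0} V_d$. It is known that $V \subset U$ is a Zariski open dense subset of $\mathbb{A}_{\Bbbk}^N$; by construction $\operatorname{in}_{\preceq}(I_{\mathbf{a}})$ is the same for all $\mathbf{a}\in V$. The ideals $I_{\mathbf{a}}$ with $\mathbf{a}\in V$ are called $V$-generic ideals. Lexsegment. A monomial ideal $J\subset S$ is a lexsegment ideal if, for all monomials $m\in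 J$, every monomial $m'$ with $\deg(m')=\deg(m)$ and $m\preceq m'$ in the lexicographic order also belongs to $J$. *)

theory Defs
  imports Complex_Main "HOL-Library.Poly_Mapping" "HOL-Library.FuncSet" "HOL.Hull"
begin

(* A monomial is its exponent vector nat =>0 nat, the variable x_i being the index i in {1..n};
   a polynomial is a finitely supported function from monomials to coefficients.
   The library order on nat =>0 nat compares the exponents at the smallest index where they
   differ: it is the lexicographic order, with x_1 > x_2 > ... > x_n. *)

type_synonym mon = "nat \<Rightarrow>\<^sub>0 nat"
type_synonym 'k mpol = "mon \<Rightarrow>\<^sub>0 'k"

definition mdeg :: "mon \<Rightarrow> nat" where
  "mdeg m = (\<Sum>i\<in>Poly_Mapping.keys m. Poly_Mapping.lookup m i)"

definition monomials :: "nat \<Rightarrow> mon set" where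
  "monomials n = {m. Poly_Mapping.keys m \<subseteq> {1..n}}"

definition monomials_deg :: "nat \<Rightarrow> nat \<Rightarrow> mon set" where
  "monomials_deg n e = {m \<in> monomials n. mdeg m = e}"

(* S = k[x_1,...,x_n] and its graded pieces S_e *)
definition polys :: "nat \<Rightarrow> ('k::field) mpol set" where
  "polys n = {p. Poly_Mapping.keys p \<subseteq> monomials n}"

definition polys_deg :: "nat \<Rightarrow> nat \<Rightarrow> ('k::field) mpol set" where
  "polys_deg n e = {p. Poly_Mapping.keys p \<subseteq> monomials_deg n e}"

definition pscale :: "'k::field \<Rightarrow> 'k mpol \<Rightarrow> 'k mpol" where
  "pscale c p = Poly_Mapping.single 0 c * p"

global_interpretation mpol: vector_space "pscale :: 'k::field \<Rightarrow> 'k mpol \<Rightarrow> 'k mpol"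
  by unfold_locales
    (simp_all add: pscale_def algebra_simps single_add mult_single flip: mult.assoc)

definition is_ideal :: "nat \<Rightarrow> ('k::field) mpol set \<Rightarrow> bool" where
  "is_ideal n I \<longleftrightarrow> I \<subseteq> polys n \<and> 0 \<in> I \<and> (\<forall>p\<in>I. \<forall>q\<in>I. p + q \<in> I) \<and>
     (\<forall>r\<in>polys n. \<forall>p\<in>I. r * p \<in> I)"

definition is_monomial_ideal :: "nat \<Rightarrow> ('k::field) mpol set \<Rightarrow> bool" where
  "is_monomial_ideal n J \<longleftrightarrow>
     (\<exists>M \<subseteq> monomials n. J = is_ideal n hull ((\<lambda>m. Poly_Mapping.single m 1) ` M))"

definition lexsegment :: "nat \<Rightarrow> ('k::field) mpol set \<Rightarrow> bool" where
  "lexsegment n J \<longleftrightarrow> is_monomial_ideal n J \<and>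
     (\<forall>m\<in>monomials n. \<forall>m'\<in>monomials n.
        Poly_Mapping.single m 1 \<in> J \<and> mdeg m' = mdeg m \<and> m \<le> m' \<longrightarrow>
        Poly_Mapping.single m' 1 \<in> J)"

definition in_term :: "('k::field) mpol \<Rightarrow> 'k mpol" where
  "in_term f = (let m = Max (Poly_Mapping.keys f)
                in Poly_Mapping.single m (Poly_Mapping.lookup f m))"

definition init_ideal :: "('k::field) mpol set \<Rightarrow> 'k mpol set" where
  "init_ideal I = mpol.span (in_term ` (I - {0}))"

(* The affine space k^N: the coefficients of f_j are indexed directly by the monomials
   of degree d_j rather than by positions in an enumeration of them. *)
definition coeff_space :: "nat \<Rightarrow> nat \<Rightarrow> (nat \<Rightarrow> nat) \<Rightarrow> (nat \<times> mon \<Rightarrow> 'k::field) set" where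
  "coeff_space n s d = (SIGMA j:{1..s}. monomials_deg n (d j)) \<rightarrow>\<^sub>E UNIV"

definition gen_form :: "nat \<Rightarrow> (nat \<Rightarrow> nat) \<Rightarrow> (nat \<times> mon \<Rightarrow> 'k::field) \<Rightarrow> nat \<Rightarrow> 'k mpol" where
  "gen_form n d a j = (\<Sum>m\<in>monomials_deg n (d j). Poly_Mapping.single m (a (j, m)))"

definition ideal_of :: "nat \<Rightarrow> nat \<Rightarrow> (nat \<Rightarrow> nat) \<Rightarrow> (nat \<times> mon \<Rightarrow> 'k::field) \<Rightarrow> 'k mpol set" where
  "ideal_of n s d a = is_ideal n hull (gen_form n d a ` {1..s})"

definition hilb_ideal ::
    "nat \<Rightarrow> nat \<Rightarrow> (nat \<Rightarrow> nat) \<Rightarrow> (nat \<times> mon \<Rightarrow> 'k::field) \<Rightarrow> nat \<Rightarrow> nat" where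
  "hilb_ideal n s d a e = mpol.dim (ideal_of n s d a \<inter> polys_deg n e)"

definition U_deg :: "nat \<Rightarrow> nat \<Rightarrow> (nat \<Rightarrow> nat) \<Rightarrow> nat \<Rightarrow> (nat \<times> mon \<Rightarrow> 'k::field) set" where
  "U_deg n s d e = {a \<in> coeff_space n s d. hilb_ideal n s d a e =
     Max ((\<lambda>b :: nat \<times> mon \<Rightarrow> 'k. hilb_ideal n s d b e) ` coeff_space n s d)}"

(* A standard exterior monomial m_1 /\ ... /\ m_t with m_1 > ... > m_t is encoded as the strictly
   decreasing list [m_1,...,m_t]; in_ext n I e is the one formed by the monomials of in(I)_e. *)
definition in_ext :: "nat \<Rightarrow> ('k::field) mpol set \<Rightarrow> nat \<Rightarrow> mon list" where
  "in_ext n I e =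
     rev (sorted_list_of_set {m \<in> monomials_deg n e. Poly_Mapping.single m 1 \<in> init_ideal I})"

(* used only for lists of the same length *)
definition ext_ge :: "mon list \<Rightarrow> mon list \<Rightarrow> bool" where
  "ext_ge u v \<longleftrightarrow> u = v \<or>
     (\<exists>i < length u. (\<forall>k < i. u ! k = v ! k) \<and> u ! i \<noteq> v ! i \<and> v ! i \<le> u ! i)"

definition max_ext :: "'k::field itself \<Rightarrow> nat \<Rightarrow> nat \<Rightarrow> (nat \<Rightarrow> nat) \<Rightarrow> nat \<Rightarrow> mon list" where
  "max_ext _ n s d e =
     (let E = (\<lambda>b :: nat \<times> mon \<Rightarrow> 'k. in_ext n (ideal_of n s d b) e) ` U_deg n s d e
      in (THE u. u \<in> E \<and> (\<forall>v\<in>E. ext_ge u v)))"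

definition V_deg :: "nat \<Rightarrow> nat \<Rightarrow> (nat \<Rightarrow> nat) \<Rightarrow> nat \<Rightarrow> (nat \<times> mon \<Rightarrow> 'k::field) set" where
  "V_deg n s d e =
     {a \<in> U_deg n s d e. in_ext n (ideal_of n s d a) e = max_ext TYPE('k) n s d e}"

definition V_set :: "nat \<Rightarrow> nat \<Rightarrow> (nat \<Rightarrow> nat) \<Rightarrow> (nat \<times> mon \<Rightarrow> 'k::field) set" where
  "V_set n s d = (\<Inter>e. V_deg n s d e)"

end

(* In each degree e the dimension of I_a is at most the number T of monomials of degree e divisible by
   some x_i^(d_i): along the pencil joining (f_1,...,f_s) to (x_1^(d_1),...,x_s^(d_s)) a general member has at least
   the dimensions of both ends, and it satisfies the bound because dim (f_1,...,f_s)_e is at most the sum of the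
   dim S_(e-d_j) - dim (f_1,...,f_(j-1))_(e-d_j). Since V is defined degree by degree, it therefore suffices to find, for
   every e separately, one choice of forms for which the dimension is T and the smallest monomials of degree e are independent
   modulo the ideal: then the maximal standard exterior monomial consists of the lexicographically largest monomials
   of that degree.

   For s = n - 1 the forms are products of linear forms cutting out d_1...d_s points with last coordinate 1 and
   next to last coordinate y = 0, 1, 2, ... Independence is tested on these points. If e is large, only the powers of y occur
   and a Vandermonde argument suffices; for the other e finite differences in y eliminate the powers of y and leave
   a small integer matrix, which is checked to be nonsingular modulo 29. For s = n = 3 the forms are powers of linear forms,
   which a substitution turns into x_i^(d_i), and only finitely many e matter. *)

theory Submission
  imports Defs "HOL-Computational_Algebra.Polynomial"
begin

section \<open>Monomials, polynomials and independence\<close>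

text \<open>The bound on the dimension does not follow by induction for arbitrary forms: the
  recursion subtracts the dimensions of (f_1,...,f_(j-1)), so it needs lower bounds for these
  smaller ideals, and special forms (such as 0) violate them. A general member of the pencil
  satisfies all of them at once without losing dimension in degree e; for this the field has to be
  infinite. The ideal of a witness is never computed. Its dimension is large enough because the
  forms have the leading terms x_j^(d_j) for a suitable weight. Independence of the smallest
  monomials modulo the ideal only uses that the ideal lies in the kernel of an explicit linear map:
  evaluation at the points, or reduction modulo the pure powers after the substitution. Calculating
  modulo 29 merely keeps the entries small: a pivot that is nonzero modulo 29 is a nonzero integer,
  hence nonzero in every field of characteristic 0. As 29 is the first prime above 27, the largest
  number of points, the y-coordinates stay distinct modulo it.\<close>

abbreviation lookup :: "('a \<Rightarrow>\<^sub>0 'b::zero) \<Rightarrow> 'a \<Rightarrow> 'b" where "lookup \<equiv> Poly_Mapping.lookup"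
abbreviation keys :: "('a \<Rightarrow>\<^sub>0 'b::zero) \<Rightarrow> 'a set" where "keys \<equiv> Poly_Mapping.keys"
abbreviation single :: "'a \<Rightarrow> 'b \<Rightarrow> 'a \<Rightarrow>\<^sub>0 'b::zero" where "single \<equiv> Poly_Mapping.single"

lemma mdeg_eq_sum: "finite A \<Longrightarrow> keys m \<subseteq> A \<Longrightarrow> mdeg m = (\<Sum>i\<in>A. lookup m i)"
  unfolding mdeg_def by (rule sum.mono_neutral_left) (auto simp: in_keys_iff)

lemma mdeg_add [simp]: "mdeg (m + m') = mdeg m + mdeg m'"
proof -
  let ?A = "keys m \<union> keys m'"
  have "mdeg (m + m') = (\<Sum>i\<in>?A. lookup (m + m') i)"
    by (rule mdeg_eq_sum) (use keys_add[of m m'] in auto)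
  moreover have "mdeg m = (\<Sum>i\<in>?A. lookup m i)" "mdeg m' = (\<Sum>i\<in>?A. lookup m' i)"
    by (rule mdeg_eq_sum; auto)+
  ultimately show ?thesis by (simp add: lookup_add sum.distrib)
qed

lemma mdeg_single [simp]: "mdeg (single i k) = k"
  using mdeg_eq_sum[of "{i}" "single i k"] by (auto simp: keys_single)

lemma keys_plus_nat: "keys (m + m' :: mon) = keys m \<union> keys m'"
  by (auto simp: in_keys_iff lookup_add)

lemma monomials_add [simp]: "m + m' \<in> monomials n \<longleftrightarrow> m \<in> monomials n \<and> m' \<in> monomials n"
  by (auto simp: monomials_def keys_plus_nat)

lemma monomials_single [simp]: "1 \<le> i \<Longrightarrow> i \<le> n \<Longrightarrow> single i k \<in> monomials n"
  by (auto simp: monomials_def keys_single)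

lemma monomials_zero [simp]: "0 \<in> monomials n"
  by (simp add: monomials_def)

lemma monomials_deg_subset: "monomials_deg n e \<subseteq> monomials n"
  by (auto simp: monomials_deg_def)

lemma finite_monomials_deg [simp]: "finite (monomials_deg n e)"
proof (rule finite_imageD)
  show "finite ((\<lambda>m. restrict (lookup m) {1..n}) ` monomials_deg n e)"
  proof (rule finite_subset)
    show "(\<lambda>m. restrict (lookup m) {1..n}) ` monomials_deg n e \<subseteq> {1..n} \<rightarrow>\<^sub>E {..e}"
    proof -
      have "lookup m i \<le> e" if m: "m \<in> monomials_deg n e" and i: "i \<in> {1..n}" for m i
      proof -
        have "e = (\<Sum>i\<in>{1..n}. lookup m i)"
          using m mdeg_eq_sum[of "{1..n}" m] by (auto simp: monomials_deg_def monomials_def)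
        then show ?thesis using member_le_sum[OF i, of "lookup m"] by auto
      qed
      then show ?thesis by auto
    qed
  qed (auto intro: finite_PiE)
  show "inj_on (\<lambda>m. restrict (lookup m) {1..n}) (monomials_deg n e)"
  proof (rule inj_onI, rule poly_mapping_eqI)
    fix m m' i
    assume *: "m \<in> monomials_deg n e" "m' \<in> monomials_deg n e"
      "restrict (lookup m) {1..n} = restrict (lookup m') {1..n}"
    show "lookup m i = lookup m' i"
    proof (cases "i \<in> {1..n}")
      case True
      then show ?thesis using fun_cong[OF *(3), of i] by simp
    next
      case False
      then have "i \<notin> keys m" "i \<notin> keys m'" using * by (auto simp: monomials_deg_def monomials_def)
      then show ?thesis by (simp add: in_keys_iff)
    qed
  qed
qed

lemma lookup_pscale [simp]: "lookup (pscale c p) m = c * lookup p m"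
  unfolding pscale_def by (simp add: mult_map_scale_conv_mult[symmetric] Poly_Mapping.map.rep_eq when_def)

lemma pscale_single [simp]: "pscale c (single m b) = single m (c * b)"
  by (simp add: pscale_def mult_single)

lemma pscale_mult: "pscale c (p * q) = pscale c p * q" "p * pscale c q = pscale c (p * q)"
  by (simp_all add: pscale_def algebra_simps)

lemma lookup_single_mult: "lookup (single m c * p) (m + k) = c * lookup (p :: 'k::field mpol) k"
proof -
  have "lookup (single m c * p) (m + k) = (\<Sum>l. c * (\<Sum>q. lookup p q when m + k = l + q) when m = l)"
    unfolding lookup_mult lookup_single by (simp only: when_mult)
  also have "\<dots> = c * (\<Sum>q. lookup p q when m + k = m + q)" by simp
  also have "(\<Sum>q. lookup p q when m + k = m + q) = lookup p k" by simp
  finally show ?thesis .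
qed

lemma keys_single_mult: "keys (single m c * p) \<subseteq> (+) m ` keys (p :: 'k::field mpol)"
  using keys_mult[of "single m c" p] by (auto simp: keys_single split: if_splits)

lemma mpol_eq_sum_superset:
  "finite A \<Longrightarrow> keys p \<subseteq> A \<Longrightarrow> p = (\<Sum>m\<in>A. single m (lookup p m))"
  by (rule poly_mapping_eqI) (auto simp: lookup_sum lookup_single when_def in_keys_iff)

lemma mpol_eq_sum: "p = (\<Sum>m\<in>keys p. single m (lookup p m))"
  by (rule mpol_eq_sum_superset) auto

lemma subspace_keys: "mpol.subspace {p :: 'k::field mpol. keys p \<subseteq> A}"
proof (rule mpol.subspaceI)
  show "x + y \<in> {p. keys p \<subseteq> A}" if "x \<in> {p. keys p \<subseteq> A}" "y \<in> {p. keys p \<subseteq> A}" for x y :: "'k mpol"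
    using that keys_add[of x y] by auto
qed (auto simp: in_keys_iff)

lemma subspace_polys: "mpol.subspace (polys n)"
  unfolding polys_def by (rule subspace_keys)

lemma subspace_polys_deg: "mpol.subspace (polys_deg n e)"
  unfolding polys_deg_def by (rule subspace_keys)

lemma polys_deg_subset: "polys_deg n e \<subseteq> polys n"
  using monomials_deg_subset by (auto simp: polys_deg_def polys_def)

lemma span_monomials:
  assumes "finite A"
  shows "mpol.span ((\<lambda>m. single m 1) ` A) = {p :: 'k::field mpol. keys p \<subseteq> A}"
proof (intro equalityI subsetI)
  fix p :: "'k mpol" assume "p \<in> mpol.span ((\<lambda>m. single m 1) ` A)"
  moreover have "mpol.span ((\<lambda>m. single m 1) ` A) \<subseteq> {p :: 'k mpol. keys p \<subseteq> A}"
    by (rule mpol.span_minimal[OF _ subspace_keys]) (auto simp: keys_single)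
  ultimately show "p \<in> {p. keys p \<subseteq> A}" by blast
next
  fix p :: "'k mpol" assume "p \<in> {p. keys p \<subseteq> A}"
  then have "p = (\<Sum>m\<in>A. pscale (lookup p m) (single m 1))"
    using mpol_eq_sum_superset[OF assms] by auto
  also have "\<dots> \<in> mpol.span ((\<lambda>m. single m 1) ` A)"
    by (intro mpol.span_sum mpol.span_scale mpol.span_base) auto
  finally show "p \<in> mpol.span ((\<lambda>m. single m 1) ` A)" .
qed

text \<open>A family rather than a set: generators \<open>single m 1 * F j\<close> with different
  indices may coincide, and when the entries depend on a parameter t the index set can stay fixed
  while t varies.\<close>

definition indep_family :: "'i set \<Rightarrow> ('i \<Rightarrow> 'x \<Rightarrow> 'k::field) \<Rightarrow> bool" where
  "indep_family A f \<longleftrightarrow> (\<forall>c. (\<forall>x. (\<Sum>i\<in>A. c i * f i x) = 0) \<longrightarrow> (\<forall>i\<in>A. c i = 0))"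

lemma indep_familyD:
  "indep_family A f \<Longrightarrow> (\<And>x. (\<Sum>i\<in>A. c i * f i x) = 0) \<Longrightarrow> i \<in> A \<Longrightarrow> c i = 0"
  unfolding indep_family_def by blast

lemma indep_family_lookup_iff:
  fixes p :: "'i \<Rightarrow> 'k::field mpol"
  assumes "finite A"
  shows "indep_family A (\<lambda>i. lookup (p i)) \<longleftrightarrow> inj_on p A \<and> mpol.independent (p ` A)"
proof (intro iffI conjI)
  assume ind: "indep_family A (\<lambda>i. lookup (p i))"
  show inj: "inj_on p A"
  proof (rule inj_onI, rule ccontr)
    fix i j assume ij: "i \<in> A" "j \<in> A" "p i = p j" "i \<noteq> j"
    define c where "c k = (if k = i then 1 else if k = j then - 1 else 0 :: 'k)" for k
    have "(\<Sum>k\<in>A. c k * lookup (p k) x) = 0" for x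
    proof -
      have "(\<Sum>k\<in>A. c k * lookup (p k) x) = (\<Sum>k\<in>{i, j}. c k * lookup (p k) x)"
        by (rule sum.mono_neutral_right) (use assms ij in \<open>auto simp: c_def\<close>)
      then show ?thesis using ij by (simp add: c_def)
    qed
    from indep_familyD[OF ind this ij(1)] show False by (simp add: c_def)
  qed
  show "mpol.independent (p ` A)"
  proof (rule mpol.independent_if_scalars_zero)
    fix f x assume *: "(\<Sum>x\<in>p ` A. pscale (f x) x) = 0" and "x \<in> p ` A"
    then obtain i where i: "i \<in> A" "x = p i" by auto
    have "(\<Sum>i\<in>A. f (p i) * lookup (p i) y) = 0" for y
      using arg_cong[OF *, of "\<lambda>q. lookup q y"] inj by (simp add: sum.reindex lookup_sum)
    from indep_familyD[OF ind this i(1)] show "f x = 0" using i by simp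
  qed (use assms in simp)
next
  assume *: "inj_on p A \<and> mpol.independent (p ` A)"
  show "indep_family A (\<lambda>i. lookup (p i))" unfolding indep_family_def
  proof (intro allI impI)
    fix c assume c: "\<forall>x. (\<Sum>i\<in>A. c i * lookup (p i) x) = 0"
    define g where "g = c \<circ> the_inv_into A p"
    have g: "g (p i) = c i" if "i \<in> A" for i
      using that * by (simp add: g_def the_inv_into_f_f)
    have "(\<Sum>x\<in>p ` A. pscale (g x) x) = 0"
    proof (rule poly_mapping_eqI)
      fix y show "lookup (\<Sum>x\<in>p ` A. pscale (g x) x) y = lookup 0 y"
        using c * g by (simp add: sum.reindex lookup_sum)
    qed
    then have "\<forall>x\<in>p ` A. g x = 0"
      using * assms mpol.dependent_finite[of "p ` A"] by auto
    then show "\<forall>i\<in>A. c i = 0" using g by auto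
  qed
qed

lemma basis_of_subset_span:
  fixes V B :: "'k::field mpol set"
  assumes "V \<subseteq> mpol.span B" "finite B"
  obtains C where "C \<subseteq> V" "finite C" "mpol.independent C" "V \<subseteq> mpol.span C" "card C = mpol.dim V"
proof -
  obtain C where C: "C \<subseteq> V" "mpol.independent C" "V \<subseteq> mpol.span C" "card C = mpol.dim V"
    using mpol.basis_exists by blast
  moreover have "finite C"
    using mpol.independent_span_bound[OF assms(2) C(2)] C(1) assms(1) by auto
  ultimately show ?thesis using that by blast
qed

lemma card_le_dim:
  fixes V B :: "'k::field mpol set"
  assumes "V \<subseteq> mpol.span B" "finite B" "C \<subseteq> V" "mpol.independent C"
  shows "card C \<le> mpol.dim V"
proof -
  obtain D where D: "finite D" "V \<subseteq> mpol.span D" "card D = mpol.dim V"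
    using basis_of_subset_span[OF assms(1,2)] by metis
  then show ?thesis using mpol.independent_span_bound[OF D(1) assms(4)] assms(3) by auto
qed

lemma polys_deg_span: "polys_deg n e = mpol.span ((\<lambda>m. single m (1::'k::field)) ` monomials_deg n e)"
  by (simp add: span_monomials polys_deg_def)

text \<open>Among the members with nonzero coefficient take one of maximal \<open>ord\<close>: its
  monomial m occurs in no other of them, so nothing cancels at m. Ties of \<open>ord\<close> are
  harmless, which admits weights as well as the lexicographic order.\<close>

lemma triangular_indep_family:
  fixes p :: "mon \<Rightarrow> 'k::field mpol" and ord :: "mon \<Rightarrow> 'o::linorder"
  assumes "finite A" and nz: "\<And>m. m \<in> A \<Longrightarrow> lookup (p m) m \<noteq> 0"
    and less: "\<And>m k. m \<in> A \<Longrightarrow> k \<in> keys (p m) \<Longrightarrow> k = m \<or> ord k < ord m"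
  shows "indep_family A (\<lambda>m. lookup (p m))"
  unfolding indep_family_def
proof (intro allI impI, rule ccontr)
  fix c assume c: "\<forall>x. (\<Sum>i\<in>A. c i * lookup (p i) x) = 0" and "\<not> (\<forall>i\<in>A. c i = 0)"
  then have B: "{i \<in> A. c i \<noteq> 0} \<noteq> {}" by auto
  obtain m where m: "m \<in> A" "c m \<noteq> 0" and max: "\<And>i. i \<in> A \<Longrightarrow> c i \<noteq> 0 \<Longrightarrow> ord i \<le> ord m"
  proof -
    have fin: "finite (ord ` {i \<in> A. c i \<noteq> 0})" using assms(1) by simp
    from Max_in[OF fin] B obtain m where "m \<in> A" "c m \<noteq> 0" "ord m = Max (ord ` {i \<in> A. c i \<noteq> 0})"
      by auto
    moreover have "ord i \<le> ord m" if "i \<in> A" "c i \<noteq> 0" for i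
      using Max_ge[OF fin, of "ord i"] that calculation by auto
    ultimately show ?thesis using that by blast
  qed
  have "(\<Sum>i\<in>A. c i * lookup (p i) m) = (\<Sum>i\<in>{m}. c i * lookup (p i) m)"
  proof (rule sum.mono_neutral_right)
    show "\<forall>i\<in>A - {m}. c i * lookup (p i) m = 0"
    proof
      fix i assume i: "i \<in> A - {m}"
      show "c i * lookup (p i) m = 0"
      proof (rule ccontr)
        assume "c i * lookup (p i) m \<noteq> 0"
        then have "m \<in> keys (p i)" "c i \<noteq> 0" by (auto simp: in_keys_iff)
        then show False using less[of i m] max[of i] i by auto
      qed
    qed
  qed (use assms m in auto)
  with c nz m show False by simp
qed

section \<open>Lead monomials and dimension\<close>

definition lead_monomials :: "'k::field mpol set \<Rightarrow> mon set" where
  "lead_monomials V = (\<lambda>p. Max (keys p)) ` (V - {0})"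

lemma lead_monomials_subset: "V \<subseteq> {p. keys p \<subseteq> A} \<Longrightarrow> lead_monomials V \<subseteq> A"
  unfolding lead_monomials_def using Max_in[OF finite_keys] by fastforce

text \<open>One element of V for each lead monomial gives a triangular, hence independent family. It
  spans V because subtracting a suitable multiple of a member lowers the lead monomial.\<close>

lemma card_lead_monomials:
  fixes V :: "'k::field mpol set"
  assumes "mpol.subspace V" "V \<subseteq> {p. keys p \<subseteq> A}" "finite A"
  shows "card (lead_monomials V) = mpol.dim V"
proof -
  let ?L = "lead_monomials V"
  have finL: "finite ?L" using lead_monomials_subset[OF assms(2)] assms(3) finite_subset by blast
  have "\<forall>m\<in>?L. \<exists>p\<in>V. p \<noteq> 0 \<and> Max (keys p) = m" by (auto simp: lead_monomials_def)
  then obtain p where p: "\<And>m. m \<in> ?L \<Longrightarrow> p m \<in> V \<and> p m \<noteq> 0 \<and> Max (keys (p m)) = m" by metis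
  have lead: "lookup (p m) m \<noteq> 0" if "m \<in> ?L" for m
    using p[OF that] Max_in[of "keys (p m)"] by (auto simp: in_keys_iff)
  have "indep_family ?L (\<lambda>m. lookup (p m))"
  proof (rule triangular_indep_family[where ord = "\<lambda>m. m"])
    fix m k assume "m \<in> ?L" "k \<in> keys (p m)"
    then show "k = m \<or> k < m" using p[of m] Max_ge[of "keys (p m)" k] by fastforce
  qed (use finL lead in auto)
  then have ind: "inj_on p ?L" "mpol.independent (p ` ?L)"
    using indep_family_lookup_iff[OF finL] by blast+
  have V: "V \<subseteq> mpol.span ((\<lambda>m. single m 1) ` A)" using assms(2,3) by (simp add: span_monomials)
  have "q \<in> mpol.span (p ` ?L)" if "q \<in> V" for q
    using that
  \<comment> \<open>The order on all monomials is not well-founded, since x_1 > x_2 > x_3 > ...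
    never ends; the induction counts the monomials of the finite set A up to the lead
    monomial.\<close>
  proof (induction "card {k \<in> A. k \<le> Max (keys q)}" arbitrary: q rule: less_induct)
    case less
    show ?case
    proof (cases "q = 0")
      case False
      define b where "b = Max (keys q)"
      have b: "b \<in> ?L" "b \<in> keys q"
        using False less.prems Max_in[of "keys q"] by (auto simp: b_def lead_monomials_def)
      define r where "r = q - pscale (lookup q b / lookup (p b) b) (p b)"
      have rV: "r \<in> V" unfolding r_def using assms(1) less.prems p[OF b(1)]
        by (intro mpol.subspace_diff mpol.subspace_scale) auto
      have "r \<in> mpol.span (p ` ?L)"
      proof (cases "r = 0")
        case False
        have "k < b" if k: "k \<in> keys r" for k
        proof -
          have "k \<noteq> b" using k lead[OF b(1)] by (auto simp: r_def in_keys_iff lookup_minus)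
          moreover have "k \<in> keys q \<or> k \<in> keys (p b)" using k by (auto simp: r_def in_keys_iff lookup_minus)
          then have "k \<le> b" using p[OF b(1)] Max_ge[of "keys (p b)" k] Max_ge[of "keys q" k] b_def by auto
          ultimately show ?thesis by simp
        qed
        then have "Max (keys r) < b" using False Max_in[of "keys r"] by auto
        then have "{k \<in> A. k \<le> Max (keys r)} \<subset> {k \<in> A. k \<le> Max (keys q)}"
          using b(2) assms(2) less.prems unfolding b_def[symmetric] by (intro psubsetI subsetI) (force dest: leD)+
        then show ?thesis using less.hyps[OF psubset_card_mono rV] assms(3) by auto
      qed (simp add: mpol.span_zero)
      moreover have "q = r + pscale (lookup q b / lookup (p b) b) (p b)" by (simp add: r_def)
      ultimately show ?thesis
        using b by (metis image_eqI mpol.span_add mpol.span_base mpol.span_scale)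
    qed (simp add: mpol.span_zero)
  qed
  then have "mpol.dim V \<le> card (p ` ?L)"
    by (intro mpol.dim_le_card) (use finL in auto)
  moreover have "card (p ` ?L) \<le> mpol.dim V"
    by (rule card_le_dim[OF V _ _ ind(2)]) (use p assms(3) in auto)
  ultimately show ?thesis using card_image[OF ind(1)] by simp
qed

section \<open>Graded ideals and the maximal Hilbert function\<close>

lemma polys_mult: "p \<in> polys n \<Longrightarrow> q \<in> polys n \<Longrightarrow> p * q \<in> polys n"
  using keys_mult[of p q] by (fastforce simp: polys_def)

lemma polys_deg_mult:
  assumes "p \<in> polys_deg n e" "q \<in> polys_deg n e'"
  shows "p * q \<in> polys_deg n (e + e')"
  using keys_mult[of p q] assms by (fastforce simp: polys_deg_def monomials_deg_def)

lemma polys_deg_single: "m \<in> monomials_deg n e \<Longrightarrow> single m c \<in> polys_deg n e"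
  by (simp add: polys_deg_def keys_single)

lemma is_ideal_polys: "is_ideal n (polys n)"
  using polys_mult mpol.subspace_add[OF subspace_polys] mpol.subspace_0[OF subspace_polys]
  by (auto simp: is_ideal_def)

lemma is_idealD:
  assumes "is_ideal n I"
  shows "I \<subseteq> polys n" "0 \<in> I" "p \<in> I \<Longrightarrow> q \<in> I \<Longrightarrow> p + q \<in> I" "r \<in> polys n \<Longrightarrow> p \<in> I \<Longrightarrow> r * p \<in> I"
  using assms unfolding is_ideal_def by blast+

text \<open>The ring \<open>polys n\<close> is itself an ideal containing X, so the intersection
  runs over a nonempty family and stays inside the ring.\<close>

lemma is_ideal_hull:
  assumes "X \<subseteq> polys n"
  shows "is_ideal n (is_ideal n hull X)"
proof -
  have mem: "p \<in> is_ideal n hull X \<longleftrightarrow> (\<forall>T. is_ideal n T \<longrightarrow> X \<subseteq> T \<longrightarrow> p \<in> T)" for p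
    by (auto simp: hull_def)
  have "is_ideal n hull X \<subseteq> polys n" using assms is_ideal_polys by (intro hull_minimal)
  then show ?thesis
    unfolding is_ideal_def[of n "is_ideal n hull X"] Ball_def mem
    by (simp add: is_idealD)
qed

lemma is_ideal_scale: "is_ideal n I \<Longrightarrow> p \<in> I \<Longrightarrow> pscale c p \<in> I"
  unfolding pscale_def is_ideal_def by (auto simp: polys_def keys_single)

lemma is_ideal_subspace: "is_ideal n I \<Longrightarrow> mpol.subspace I"
  using is_ideal_scale by (auto simp: is_ideal_def intro!: mpol.subspaceI)

definition hcomp :: "nat \<Rightarrow> 'k::field mpol \<Rightarrow> 'k mpol" where
  "hcomp e p = (\<Sum>m\<in>{m \<in> keys p. mdeg m = e}. single m (lookup p m))"

lemma lookup_hcomp: "lookup (hcomp e p) m = (if mdeg m = e then lookup p m else 0)"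
  by (auto simp: hcomp_def lookup_sum lookup_single when_def in_keys_iff)

lemma hcomp_zero [simp]: "hcomp e 0 = 0"
  by (simp add: hcomp_def)

lemma hcomp_add: "hcomp e (p + q) = hcomp e p + hcomp e q"
  by (rule poly_mapping_eqI) (simp add: lookup_hcomp lookup_add)

lemma hcomp_sum: "hcomp e (\<Sum>i\<in>A. f i) = (\<Sum>i\<in>A. hcomp e (f i))"
  by (induction A rule: infinite_finite_induct) (simp_all add: hcomp_add)

lemma hcomp_polys_deg: "p \<in> polys_deg n d \<Longrightarrow> hcomp e p = (if d = e then p else 0)"
  by (rule poly_mapping_eqI)
     (auto simp: lookup_hcomp polys_deg_def monomials_deg_def in_keys_iff subset_eq)

lemma hcomp_in_polys_deg: "p \<in> polys n \<Longrightarrow> hcomp e p \<in> polys_deg n e"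
  by (auto simp: polys_deg_def polys_def monomials_deg_def in_keys_iff lookup_hcomp subset_eq split: if_splits)

lemma polys_eq_sum_hcomp: "p = (\<Sum>e\<in>mdeg ` keys p. hcomp e p)"
  by (rule poly_mapping_eqI) (auto simp: lookup_sum lookup_hcomp in_keys_iff)

lemma hcomp_single_mult:
  assumes "p \<in> polys n" "m \<in> monomials n"
  shows "hcomp e (single m c * p) = (if mdeg m \<le> e then single m c * hcomp (e - mdeg m) p else 0)"
proof -
  let ?E = "mdeg ` keys p"
  have mp: "single m c \<in> polys_deg n (mdeg m)" using assms by (simp add: polys_deg_single monomials_deg_def)
  have "hcomp e (single m c * p) = hcomp e (single m c * (\<Sum>i\<in>?E. hcomp i p))"
    using polys_eq_sum_hcomp[of p] by simp
  also have "\<dots> = (\<Sum>i\<in>?E. if mdeg m + i = e then single m c * hcomp i p else 0)"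
    unfolding sum_distrib_left hcomp_sum
    using hcomp_polys_deg[OF polys_deg_mult[OF mp hcomp_in_polys_deg[OF assms(1)]]] by simp
  also have "\<dots> = (if mdeg m \<le> e then single m c * hcomp (e - mdeg m) p else 0)"
  proof (cases "mdeg m \<le> e \<and> e - mdeg m \<in> ?E")
    case True
    then have "(mdeg m + i = e) = (i = e - mdeg m)" for i by auto
    then show ?thesis using True by simp
  next
    case False
    have "hcomp (e - mdeg m) p = 0" if "e - mdeg m \<notin> ?E"
      using that by (intro poly_mapping_eqI) (simp add: lookup_hcomp, metis imageI in_keys_iff)
    then show ?thesis using False by (auto intro!: sum.neutral)
  qed
  finally show ?thesis .
qed

text \<open>The guard \<open>d j \<le> e\<close> excludes generators of too large degree, for which
  the truncated difference would be 0. The set J is a parameter because the dimension bound adds the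
  forms one at a time.\<close>

definition gen_index :: "nat \<Rightarrow> nat set \<Rightarrow> (nat \<Rightarrow> nat) \<Rightarrow> nat \<Rightarrow> (nat \<times> mon) set" where
  "gen_index n J d e = (SIGMA j:{j \<in> J. d j \<le> e}. monomials_deg n (e - d j))"

definition gen_piece :: "nat \<Rightarrow> nat set \<Rightarrow> (nat \<Rightarrow> nat) \<Rightarrow> (nat \<Rightarrow> 'k::field mpol) \<Rightarrow> nat \<Rightarrow> 'k mpol set" where
  "gen_piece n J d F e = mpol.span ((\<lambda>(j, m). single m 1 * F j) ` gen_index n J d e)"

lemma finite_gen_index [simp]: "finite J \<Longrightarrow> finite (gen_index n J d e)"
  by (auto simp: gen_index_def)

lemma subspace_gen_piece: "mpol.subspace (gen_piece n J d F e)"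
  by (simp add: gen_piece_def)

lemma gen_piece_subset:
  assumes "\<And>j. j \<in> J \<Longrightarrow> F j \<in> polys_deg n (d j)"
  shows "gen_piece n J d F e \<subseteq> polys_deg n e"
  unfolding gen_piece_def
proof (rule mpol.span_minimal[OF _ subspace_polys_deg], safe)
  fix j m assume "(j, m) \<in> gen_index n J d e"
  then show "single m 1 * F j \<in> polys_deg n e"
    using polys_deg_mult[OF polys_deg_single[of m n "e - d j" 1] assms[of j]] by (auto simp: gen_index_def)
qed

lemma single_mult_gen_piece:
  assumes "p \<in> gen_piece n J d F e" "m \<in> monomials_deg n e'"
  shows "single m c * p \<in> gen_piece n J d F (e' + e)"
  using assms(1) unfolding gen_piece_def
proof (induction rule: mpol.span_induct_alt)
  case base
  show ?case by (simp add: mpol.span_zero)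
next
  case (step b x y)
  then obtain j k where jk: "(j, k) \<in> gen_index n J d e" "x = single k 1 * F j" by auto
  have "(j, m + k) \<in> gen_index n J d (e' + e)"
    using jk assms(2) by (auto simp: gen_index_def monomials_deg_def)
  then have "pscale (b * c) (single (m + k) 1 * F j) \<in> mpol.span ((\<lambda>(j, m). single m 1 * F j) ` gen_index n J d (e' + e))"
    by (intro mpol.span_scale mpol.span_base) force
  moreover have "single m c * (pscale b x + y) = pscale (b * c) (single (m + k) 1 * F j) + single m c * y"
    by (simp add: jk pscale_def algebra_simps mult_single flip: mult.assoc)
  ultimately show ?case using step by (simp add: mpol.span_add)
qed

lemma mult_gen_piece:
  assumes "p \<in> gen_piece n J d F e" "q \<in> polys_deg n e'"
  shows "q * p \<in> gen_piece n J d F (e' + e)"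
proof -
  have "q * p = (\<Sum>m\<in>keys q. single m (lookup q m) * p)"
    by (subst mpol_eq_sum[of q]) (simp add: sum_distrib_right)
  also have "\<dots> \<in> gen_piece n J d F (e' + e)"
    using assms by (intro mpol.subspace_sum[OF subspace_gen_piece] single_mult_gen_piece) (auto simp: polys_deg_def)
  finally show ?thesis .
qed

text \<open>The polynomials all of whose components lie in the spans \<open>gen_piece\<close> form
  an ideal containing the generators. Minimality of the hull then applies, and no expression of p by
  the generators has to be decomposed.\<close>

lemma hcomp_hull:
  assumes F: "\<And>j. j \<in> J \<Longrightarrow> F j \<in> polys_deg n (d j)" and "p \<in> is_ideal n hull (F ` J)"
  shows "hcomp e p \<in> gen_piece n J d F e"
proof -
  let ?T = "{p \<in> polys n. \<forall>e. hcomp e p \<in> gen_piece n J d F e}"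
  have "is_ideal n hull (F ` J) \<subseteq> ?T"
  proof (rule hull_minimal)
    show "F ` J \<subseteq> ?T"
    proof safe
      fix j assume j: "j \<in> J"
      show "F j \<in> polys n" using F[OF j] polys_deg_subset by blast
      fix e
      have "F j \<in> gen_piece n J d F (d j)"
        unfolding gen_piece_def using j
        by (intro mpol.span_base image_eqI[where x = "(j, 0)"]) (auto simp: gen_index_def monomials_deg_def mdeg_def)
      then show "hcomp e (F j) \<in> gen_piece n J d F e"
        using hcomp_polys_deg[OF F[OF j], of e] mpol.subspace_0[OF subspace_gen_piece] by auto
    qed
    have "hcomp e (r * p) \<in> gen_piece n J d F e" if r: "r \<in> polys n" and p: "p \<in> ?T" for r p e
    proof -
      have "hcomp e (r * p) = (\<Sum>m\<in>keys r. hcomp e (single m (lookup r m) * p))"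
        by (subst mpol_eq_sum[of r]) (simp add: sum_distrib_right hcomp_sum)
      also have "\<dots> \<in> gen_piece n J d F e"
      proof (rule mpol.subspace_sum[OF subspace_gen_piece])
        fix m assume "m \<in> keys r"
        then have m: "m \<in> monomials n" using r by (auto simp: polys_def)
        show "hcomp e (single m (lookup r m) * p) \<in> gen_piece n J d F e"
          using single_mult_gen_piece[of "hcomp (e - mdeg m) p" n J d F "e - mdeg m" m "mdeg m"] p m
            hcomp_single_mult[of p n m e] mpol.subspace_0[OF subspace_gen_piece]
          by (auto simp: monomials_deg_def)
      qed
      finally show ?thesis .
    qed
    then show "is_ideal n ?T"
      unfolding is_ideal_def
      by (auto simp: hcomp_add intro: polys_mult mpol.subspace_add[OF subspace_polys]
          mpol.subspace_0[OF subspace_polys] mpol.subspace_add[OF subspace_gen_piece]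
          mpol.subspace_0[OF subspace_gen_piece])
  qed
  then show ?thesis using assms(2) by blast
qed

lemma gen_piece_subset_hull:
  assumes F: "\<And>j. j \<in> J \<Longrightarrow> F j \<in> polys_deg n (d j)"
  shows "gen_piece n J d F e \<subseteq> is_ideal n hull (F ` J)"
proof -
  have sub: "F ` J \<subseteq> polys n" using F polys_deg_subset by blast
  note id = is_ideal_hull[OF sub]
  show ?thesis unfolding gen_piece_def
  proof (rule mpol.span_minimal[OF _ is_ideal_subspace[OF id]], safe)
    fix j m assume "(j, m) \<in> gen_index n J d e"
    then have "single m 1 \<in> polys n" "F j \<in> is_ideal n hull (F ` J)"
      using hull_subset[of "F ` J" "is_ideal n"] by (auto simp: gen_index_def polys_def keys_single monomials_deg_def)
    then show "single m 1 * F j \<in> is_ideal n hull (F ` J)" using id by (auto simp: is_ideal_def)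
  qed
qed

lemma hull_inter_polys_deg:
  assumes F: "\<And>j. j \<in> J \<Longrightarrow> F j \<in> polys_deg n (d j)"
  shows "is_ideal n hull (F ` J) \<inter> polys_deg n e = gen_piece n J d F e"
proof (intro equalityI subsetI)
  fix p assume p: "p \<in> is_ideal n hull (F ` J) \<inter> polys_deg n e"
  then have "hcomp e p \<in> gen_piece n J d F e" by (intro hcomp_hull[OF F]) auto
  with p show "p \<in> gen_piece n J d F e" using hcomp_polys_deg[of p n e e] by simp
next
  fix p assume "p \<in> gen_piece n J d F e"
  then show "p \<in> is_ideal n hull (F ` J) \<inter> polys_deg n e"
    using gen_piece_subset_hull[where F = F, OF F] gen_piece_subset[where F = F, OF F] by (meson IntI subsetD)
qed

section \<open>Upper bound for the Hilbert function, one form at a time\<close>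

lemma dim_polys_deg: "mpol.dim (polys_deg n e :: 'k::field mpol set) = card (monomials_deg n e)"
proof -
  have "indep_family (monomials_deg n e) (\<lambda>m. lookup (single m (1::'k)))"
    by (rule triangular_indep_family[where ord = "\<lambda>m. m"]) (auto simp: keys_single)
  then have "inj_on (\<lambda>m. single m (1::'k)) (monomials_deg n e)"
    "mpol.independent ((\<lambda>m. single m (1::'k)) ` monomials_deg n e)"
    using indep_family_lookup_iff[where p = "\<lambda>m. single m (1::'k)", OF finite_monomials_deg] by blast+
  then show ?thesis
    by (simp add: polys_deg_span mpol.dim_eq_card_independent card_image)
qed

text \<open>Multiples of the new form by elements of the old ideal already belong to the old ideal.
  A basis of the old ideal in the lower degree is extended to a basis of all forms there, and only
  the added vectors can contribute new dimensions.\<close>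

lemma gen_piece_step:
  fixes F :: "nat \<Rightarrow> 'k::field mpol"
  assumes F: "\<And>j. j \<in> {1..Suc s} \<Longrightarrow> F j \<in> polys_deg n (d j)"
  shows "mpol.dim (gen_piece n {1..Suc s} d F e) \<le> mpol.dim (gen_piece n {1..s} d F e) +
    (if d (Suc s) \<le> e then card (monomials_deg n (e - d (Suc s))) - mpol.dim (gen_piece n {1..s} d F (e - d (Suc s))) else 0)"
proof -
  let ?e = "e - d (Suc s)" and ?G = "gen_piece n {1..s} d F"
  have sub: "?G e \<subseteq> polys_deg n e" for e by (rule gen_piece_subset) (use F in auto)
  note fin = finite_imageI[OF finite_monomials_deg]
  obtain D where D: "D \<subseteq> ?G e" "finite D" "?G e \<subseteq> mpol.span D" "card D = mpol.dim (?G e)"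
    using basis_of_subset_span[OF _ fin] sub[of e, unfolded polys_deg_span] by metis
  show ?thesis
  proof (cases "d (Suc s) \<le> e")
    case False
    then have "gen_index n {1..Suc s} d e = gen_index n {1..s} d e"
      by (auto simp: gen_index_def le_Suc_eq)
    then show ?thesis by (simp add: gen_piece_def)
  next
    case True
    obtain C where C: "C \<subseteq> ?G ?e" "mpol.independent C" "card C = mpol.dim (?G ?e)"
      using mpol.basis_exists by metis
    obtain B where B: "C \<subseteq> B" "B \<subseteq> polys_deg n ?e" "mpol.independent B" "polys_deg n ?e \<subseteq> mpol.span B"
      using mpol.maximal_independent_subset_extend[of C "polys_deg n ?e"] C sub by blast
    have finB: "finite B"
      using mpol.independent_span_bound[OF fin B(3)] B(2) unfolding polys_deg_span by blast
    have cardB: "card B = card (monomials_deg n ?e)"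
      using mpol.basis_card_eq_dim[OF B(2,4,3)] dim_polys_deg[of n ?e, where 'k = 'k] by simp
    let ?X = "D \<union> (\<lambda>b. b * F (Suc s)) ` (B - C)"
    have BF: "b * F (Suc s) \<in> mpol.span ?X" if b: "b \<in> B" for b
    proof (cases "b \<in> C")
      case True
      then have "F (Suc s) * b \<in> ?G (d (Suc s) + ?e)"
        using C(1) F by (intro mult_gen_piece) auto
      then show ?thesis using D(3) \<open>d (Suc s) \<le> e\<close> mpol.span_mono[of D ?X] by (auto simp: mult.commute)
    next
      case False
      then show ?thesis using b by (intro mpol.span_base) auto
    qed
    have SF: "p * F (Suc s) \<in> mpol.span ?X" if "p \<in> mpol.span B" for p
      using that
    proof (induction rule: mpol.span_induct_alt)
      case (step c x y)
      then show ?case using BF[OF step(1)]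
        by (simp add: distrib_right mpol.span_add mpol.span_scale flip: pscale_mult(1))
    qed (simp add: mpol.span_zero)
    have "gen_piece n {1..Suc s} d F e \<subseteq> mpol.span ?X"
      unfolding gen_piece_def[of n "{1..Suc s}"]
    proof (rule mpol.span_minimal[OF _ mpol.subspace_span], safe)
      fix j m assume jm: "(j, m) \<in> gen_index n {1..Suc s} d e"
      show "single m 1 * F j \<in> mpol.span ?X"
      proof (cases "j = Suc s")
        case True
        then have "single m 1 \<in> polys_deg n ?e" using jm by (auto simp: gen_index_def polys_deg_single)
        then show ?thesis using SF B(4) True by blast
      next
        case False
        then have "(j, m) \<in> gen_index n {1..s} d e" using jm by (auto simp: gen_index_def)
        then have "single m 1 * F j \<in> ?G e" unfolding gen_piece_def by (intro mpol.span_base) force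
        then show ?thesis using D(3) mpol.span_mono[of D ?X] by auto
      qed
    qed
    then have "mpol.dim (gen_piece n {1..Suc s} d F e) \<le> card ?X"
      by (rule mpol.dim_le_card) (use D finB in auto)
    also have "\<dots> \<le> card D + card ((\<lambda>b. b * F (Suc s)) ` (B - C))" by (rule card_Un_le)
    also have "\<dots> \<le> card D + card (B - C)" using finB by (simp add: card_image_le)
    also have "card (B - C) = card B - card C" using B(1) finB by (simp add: card_Diff_subset finite_subset)
    finally show ?thesis using D C cardB True by simp
  qed
qed

text \<open>The Hilbert function of the ideal (x_1^(d_1),...,x_s^(d_s)), the model of a complete
  intersection.\<close>

definition ci_count :: "nat \<Rightarrow> nat \<Rightarrow> (nat \<Rightarrow> nat) \<Rightarrow> nat \<Rightarrow> nat" where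
  "ci_count n s d e = card {m \<in> monomials_deg n e. \<exists>j\<in>{1..s}. d j \<le> lookup m j}"

text \<open>The new power is a nonzerodivisor modulo the previous ones, so the estimate of
  \<open>gen_piece_step\<close> becomes an equality: division by the new power matches the monomials
  that are added with the monomials of lower degree outside the old ideal.\<close>

lemma ci_count_step:
  assumes "Suc s \<le> n"
  shows "ci_count n (Suc s) d e = ci_count n s d e +
    (if d (Suc s) \<le> e then card (monomials_deg n (e - d (Suc s))) - ci_count n s d (e - d (Suc s)) else 0)"
proof -
  let ?x = "single (Suc s) (d (Suc s)) :: mon"
  let ?A = "\<lambda>e. {m \<in> monomials_deg n e. \<exists>j\<in>{1..s}. d j \<le> lookup m j}"
  let ?B = "{m \<in> monomials_deg n e. d (Suc s) \<le> lookup m (Suc s) \<and> \<not> (\<exists>j\<in>{1..s}. d j \<le> lookup m j)}"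
  have "{m \<in> monomials_deg n e. \<exists>j\<in>{1..Suc s}. d j \<le> lookup m j} = ?A e \<union> ?B"
    by (auto simp: atLeastAtMostSuc_conv)
  then have 1: "ci_count n (Suc s) d e = ci_count n s d e + card ?B"
    unfolding ci_count_def by (subst card_Un_disjoint[symmetric]) auto
  have split: "?x + (m - ?x) = m" if "d (Suc s) \<le> lookup m (Suc s)" for m :: mon
    using that by (intro poly_mapping_eqI) (auto simp: lookup_add lookup_minus lookup_single when_def)
  have xm: "?x \<in> monomials n" using assms by simp
  have "card ?B = (if d (Suc s) \<le> e then card (monomials_deg n (e - d (Suc s))) - ci_count n s d (e - d (Suc s)) else 0)"
  proof (cases "d (Suc s) \<le> e")
    case True
    have "?B = (+) ?x ` (monomials_deg n (e - d (Suc s)) - ?A (e - d (Suc s)))"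
    proof (intro equalityI subsetI)
      fix m assume m: "m \<in> ?B"
      let ?m = "m - ?x"
      have s: "?x + ?m = m" using m split by blast
      have "mdeg m = d (Suc s) + mdeg ?m" using arg_cong[OF s, of mdeg] by simp
      moreover have "?m \<in> monomials n" using m s monomials_add[of ?x ?m n] by (auto simp: monomials_deg_def)
      moreover have "lookup ?m j = lookup m j" if "j \<in> {1..s}" for j
        using that by (simp add: lookup_minus lookup_single when_def)
      ultimately have "?m \<in> monomials_deg n (e - d (Suc s)) - ?A (e - d (Suc s))"
        using m by (auto simp: monomials_deg_def)
      then show "m \<in> (+) ?x ` (monomials_deg n (e - d (Suc s)) - ?A (e - d (Suc s)))"
        using s by (metis (no_types, lifting) image_eqI)
    next
      fix m assume "m \<in> (+) ?x ` (monomials_deg n (e - d (Suc s)) - ?A (e - d (Suc s)))"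
      then show "m \<in> ?B" using True xm
        by (auto simp: monomials_deg_def lookup_add lookup_single when_def)
    qed
    then have "card ?B = card (monomials_deg n (e - d (Suc s)) - ?A (e - d (Suc s)))"
      by (simp add: card_image)
    also have "\<dots> = card (monomials_deg n (e - d (Suc s))) - ci_count n s d (e - d (Suc s))"
      unfolding ci_count_def by (rule card_Diff_subset) auto
    finally show ?thesis using True by simp
  next
    case False
    have "?B = {}"
    proof (rule ccontr)
      assume "?B \<noteq> {}"
      then obtain m where "m \<in> ?B" by blast
      then have "e = d (Suc s) + mdeg (m - ?x)"
        using arg_cong[OF split, of m mdeg] by (auto simp: monomials_deg_def)
      with False show False by simp
    qed
    then show ?thesis using False by simp
  qed
  with 1 show ?thesis by simp
qed

text \<open>In the recursion a dimension is subtracted, so an upper bound requires that the first i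
  forms already reach the expected dimension in the degree e - d_(i+1). Then the two recursions can
  be compared term by term.\<close>

lemma dim_gen_piece_le_of_generic:
  fixes F :: "nat \<Rightarrow> 'k::field mpol"
  assumes "\<And>j. j \<in> {1..s} \<Longrightarrow> F j \<in> polys_deg n (d j)" "s \<le> n"
    and "\<And>i. i < s \<Longrightarrow> d (Suc i) \<le> e \<Longrightarrow> ci_count n i d (e - d (Suc i)) \<le> mpol.dim (gen_piece n {1..i} d F (e - d (Suc i)))"
  shows "mpol.dim (gen_piece n {1..s} d F e) \<le> ci_count n s d e"
  using assms
proof (induction s)
  case 0
  then show ?case
    by (simp add: gen_piece_def gen_index_def mpol.dim_eq_card_independent[OF mpol.independent_empty]
        del: mpol.span_empty)
next
  case (Suc s)
  have "mpol.dim (gen_piece n {1..s} d F e) \<le> ci_count n s d e" using Suc by auto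
  moreover have "ci_count n s d (e - d (Suc s)) \<le> mpol.dim (gen_piece n {1..s} d F (e - d (Suc s)))"
    if "d (Suc s) \<le> e" using Suc.prems(3)[of s] that by simp
  then have "card (monomials_deg n (e - d (Suc s))) - mpol.dim (gen_piece n {1..s} d F (e - d (Suc s)))
      \<le> card (monomials_deg n (e - d (Suc s))) - ci_count n s d (e - d (Suc s))" if "d (Suc s) \<le> e"
    using that by (intro diff_le_mono2) auto
  ultimately show ?case
    using gen_piece_step[where F = F and d = d and n = n and s = s and e = e, OF Suc.prems(1)] ci_count_step[OF Suc.prems(2), of d e]
    by (cases "d (Suc s) \<le> e") auto
qed

text \<open>Gaussian elimination over the polynomial ring in \<open>t\<close>: only finitely many values of \<open>t\<close> are
  zeros of one of the pivots.\<close>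

lemma indep_family_generic:
  fixes v :: "'i \<Rightarrow> 'x \<Rightarrow> 'k::field poly"
  assumes "finite A" "indep_family A (\<lambda>i x. poly (v i x) t0)"
  shows "finite {t. \<not> indep_family A (\<lambda>i x. poly (v i x) t)}"
  using assms
proof (induction A arbitrary: v rule: finite_induct)
  case empty
  then show ?case by (simp add: indep_family_def)
next
  case (insert k A)
  have "\<exists>x. poly (v k x) t0 \<noteq> 0"
  proof (rule ccontr)
    assume *: "\<not> ?thesis"
    have "(\<Sum>i\<in>insert k A. (if i = k then 1 else 0) * poly (v i x) t0) = 0" for x
      using * insert.hyps by (intro sum.neutral) auto
    from indep_familyD[OF insert.prems this, of k] show False by simp
  qed
  then obtain y where y: "poly (v k y) t0 \<noteq> 0" by blast
  \<comment> \<open>Column y is cleared with pivot row k by cross-multiplication; without division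
    the entries remain polynomials in t.\<close>
  define w where "w i x = v k y * v i x - v i y * v k x" for i x
  have expand: "(\<Sum>i\<in>A. c i * poly (w i x) t) = poly (v k y) t * (\<Sum>i\<in>A. c i * poly (v i x) t)
      - (\<Sum>i\<in>A. c i * poly (v i y) t) * poly (v k x) t" for c x t
    by (simp add: w_def sum_subtractf sum_distrib_left sum_distrib_right algebra_simps)
  have "indep_family A (\<lambda>i x. poly (w i x) t0)"
    unfolding indep_family_def
  proof (intro allI impI ballI)
    fix c i assume c: "\<forall>x. (\<Sum>i\<in>A. c i * poly (w i x) t0) = 0" and i: "i \<in> A"
    \<comment> \<open>A relation between the reduced rows lifts to the original ones once row k gets
      the coefficient that cancels column y.\<close>
    define c' where "c' i = (if i = k then - (\<Sum>i\<in>A. c i * poly (v i y) t0) else poly (v k y) t0 * c i)" for i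
    have "(\<Sum>i\<in>insert k A. c' i * poly (v i x) t0) = 0" for x
    proof -
      have "(\<Sum>i\<in>A. c' i * poly (v i x) t0) = poly (v k y) t0 * (\<Sum>i\<in>A. c i * poly (v i x) t0)"
        using insert.hyps by (auto simp: c'_def sum_distrib_left algebra_simps intro!: sum.cong)
      then show ?thesis using c[rule_format, of x] expand[of c x t0] insert.hyps by (simp add: c'_def)
    qed
    from indep_familyD[OF insert.prems this, of i] i have "c' i = 0" by blast
    moreover have "i \<noteq> k" using i insert.hyps by blast
    ultimately show "c i = 0" using y by (simp add: c'_def)
  qed
  from insert.IH[OF this] have "finite {t. \<not> indep_family A (\<lambda>i x. poly (w i x) t)}" .
  moreover have "finite {t. poly (v k y) t = 0}" using y by (intro poly_roots_finite) auto
  moreover have "{t. \<not> indep_family (insert k A) (\<lambda>i x. poly (v i x) t)} \<subseteq>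
     {t. \<not> indep_family A (\<lambda>i x. poly (w i x) t)} \<union> {t. poly (v k y) t = 0}"
  proof (rule subsetI, rule ccontr)
    fix t assume t: "t \<in> {t. \<not> indep_family (insert k A) (\<lambda>i x. poly (v i x) t)}"
      "t \<notin> {t. \<not> indep_family A (\<lambda>i x. poly (w i x) t)} \<union> {t. poly (v k y) t = 0}"
    then obtain c i where c: "\<forall>x. (\<Sum>i\<in>insert k A. c i * poly (v i x) t) = 0" "i \<in> insert k A" "c i \<noteq> 0"
      by (auto simp: indep_family_def)
    have c1: "(\<Sum>i\<in>A. c i * poly (v i x) t) = - (c k * poly (v k x) t)" for x
      using c(1)[rule_format, of x] insert.hyps by (simp add: eq_neg_iff_add_eq_0 add.commute)
    have "(\<Sum>i\<in>A. c i * poly (w i x) t) = 0" for x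
      unfolding expand c1 by (simp add: algebra_simps)
    then have cA: "c j = 0" if "j \<in> A" for j
      using indep_familyD[of A "\<lambda>i x. poly (w i x) t" c] t(2) that by auto
    then have "c k * poly (v k y) t = 0" using c1[of y] by simp
    then have "c k = 0" using t(2) by auto
    with cA c show False by auto
  qed
  ultimately show ?case by (meson finite_UnI finite_subset)
qed

text \<open>This turns a lower bound for the dimension into independence of a fixed set of indices
  of generators, a condition that can be followed along a pencil while the space itself
  moves.\<close>

lemma dim_gen_piece_ge_iff:
  fixes F :: "nat \<Rightarrow> 'k::field mpol"
  assumes "finite J"
  shows "r \<le> mpol.dim (gen_piece n J d F e) \<longleftrightarrow>
    (\<exists>A\<subseteq>gen_index n J d e. card A = r \<and> indep_family A (\<lambda>(j, m). lookup (single m 1 * F j)))"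
proof -
  let ?p = "\<lambda>(j, m). single m 1 * F j" and ?X = "gen_index n J d e"
  have lam: "(\<lambda>(j, m). lookup (single m 1 * F j)) = (\<lambda>i. lookup (?p i))" by (auto simp: fun_eq_iff)
  have fin: "finite ?X" using assms by simp
  show ?thesis
  proof
    assume r: "r \<le> mpol.dim (gen_piece n J d F e)"
    obtain B where B: "B \<subseteq> ?p ` ?X" "mpol.independent B" "?p ` ?X \<subseteq> mpol.span B" "card B = mpol.dim (?p ` ?X)"
      using mpol.basis_exists by metis
    then have "r \<le> card B" using r by (simp add: gen_piece_def)
    then obtain B' where B': "B' \<subseteq> B" "card B' = r" by (meson obtain_subset_with_card_n)
    have "B' \<subseteq> ?p ` ?X" by (rule order.trans[OF B'(1) B(1)])
    then obtain A where A: "A \<subseteq> ?X" "inj_on ?p A" "?p ` A = B'"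
      unfolding subset_image_inj by blast
    have "mpol.independent (?p ` A)" unfolding A(3) by (rule mpol.independent_mono[OF B(2) B'(1)])
    then have "indep_family A (\<lambda>i. lookup (?p i))"
      using A finite_subset[OF A(1) fin] by (subst indep_family_lookup_iff) auto
    then show "\<exists>A\<subseteq>?X. card A = r \<and> indep_family A (\<lambda>(j, m). lookup (single m 1 * F j))"
      unfolding lam using A(1,3) B'(2) card_image[OF A(2)] by (intro exI[of _ A]) simp
  next
    assume "\<exists>A\<subseteq>?X. card A = r \<and> indep_family A (\<lambda>(j, m). lookup (single m 1 * F j))"
    then obtain A where A: "A \<subseteq> ?X" "card A = r" "indep_family A (\<lambda>i. lookup (?p i))" unfolding lam by blast
    then have "inj_on ?p A" "mpol.independent (?p ` A)"
      using indep_family_lookup_iff[OF finite_subset[OF A(1) fin]] by blast+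
    moreover from this have "card (?p ` A) \<le> mpol.dim (gen_piece n J d F e)"
      by (intro card_le_dim[of _ "?p ` ?X"]) (use A(1) fin in \<open>auto simp: gen_piece_def intro!: mpol.span_base\<close>)
    ultimately show "r \<le> mpol.dim (gen_piece n J d F e)" using A(2) by (simp add: card_image)
  qed
qed

section \<open>Semicontinuity along a pencil\<close>

definition pencil :: "(nat \<Rightarrow> 'k::field mpol) \<Rightarrow> (nat \<Rightarrow> 'k mpol) \<Rightarrow> 'k \<Rightarrow> nat \<Rightarrow> 'k mpol" where
  "pencil G H t j = pscale (1 - t) (G j) + pscale t (H j)"

text \<open>The coefficients of the generators have degree at most 1 in t, so a subfamily that is
  independent at t0 is independent for all but finitely many t. This is lower semicontinuity of the
  rank.\<close>

lemma dim_pencil_generic: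
  fixes G H :: "nat \<Rightarrow> 'k::field mpol"
  assumes "finite J"
  shows "finite {t. mpol.dim (gen_piece n J d (pencil G H t) e) < mpol.dim (gen_piece n J d (pencil G H t0) e)}"
proof -
  let ?r = "mpol.dim (gen_piece n J d (pencil G H t0) e)"
  define v where "v i x = (case i of (j, m) \<Rightarrow>
    [:lookup (single m 1 * G j) x, lookup (single m 1 * H j) x - lookup (single m 1 * G j) x:])" for i x
  have v: "(\<lambda>i x. poly (v i x) t) = (\<lambda>(j, m). lookup (single m 1 * pencil G H t j))" for t
    by (auto simp: fun_eq_iff v_def pencil_def pscale_mult(2) lookup_add lookup_minus algebra_simps)
  obtain A where A: "A \<subseteq> gen_index n J d e" "card A = ?r" "indep_family A (\<lambda>i x. poly (v i x) t0)"
    using dim_gen_piece_ge_iff[OF assms, of ?r n d "pencil G H t0" e] unfolding v by auto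
  have "finite {t. \<not> indep_family A (\<lambda>i x. poly (v i x) t)}"
    using A assms by (intro indep_family_generic) (auto intro: finite_subset)
  moreover have "{t. mpol.dim (gen_piece n J d (pencil G H t) e) < ?r} \<subseteq> {t. \<not> indep_family A (\<lambda>i x. poly (v i x) t)}"
    using dim_gen_piece_ge_iff[OF assms, of ?r n d _ e] A unfolding v by (auto simp flip: not_le)
  ultimately show ?thesis using finite_subset by blast
qed

section \<open>Leading powers with respect to a weight\<close>

definition weight :: "(nat \<Rightarrow> nat) \<Rightarrow> mon \<Rightarrow> nat" where
  "weight w m = (\<Sum>i\<in>keys m. w i * lookup m i)"

lemma weight_eq_sum: "finite A \<Longrightarrow> keys m \<subseteq> A \<Longrightarrow> weight w m = (\<Sum>i\<in>A. w i * lookup m i)"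
  unfolding weight_def by (rule sum.mono_neutral_left) (auto simp: in_keys_iff)

lemma weight_add [simp]: "weight w (m + m') = weight w m + weight w m'"
proof -
  let ?A = "keys m \<union> keys m'"
  have "weight w (m + m') = (\<Sum>i\<in>?A. w i * lookup (m + m') i)"
    by (rule weight_eq_sum) (auto simp: keys_plus_nat)
  moreover have "weight w m = (\<Sum>i\<in>?A. w i * lookup m i)" "weight w m' = (\<Sum>i\<in>?A. w i * lookup m' i)"
    by (rule weight_eq_sum; auto)+
  ultimately show ?thesis by (simp add: lookup_add sum.distrib algebra_simps)
qed

lemma weight_single [simp]: "weight w (single i k) = w i * k"
  using weight_eq_sum[of "{i}" "single i k" w] by (auto simp: keys_single)

text \<open>A weight with ties replaces a term order: only the pure power has to beat all other
  terms strictly. For the weight 0 the condition describes the nonzero multiples of the pure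
  power.\<close>

definition lead_power :: "(nat \<Rightarrow> nat) \<Rightarrow> nat \<Rightarrow> nat \<Rightarrow> 'k::field mpol \<Rightarrow> bool" where
  "lead_power w j k p \<longleftrightarrow> lookup p (single j k) \<noteq> 0 \<and>
     (\<forall>m\<in>keys p. m = single j k \<or> weight w m < w j * k)"

text \<open>Every monomial m in the ideal of the pure powers is the leading monomial of a multiple
  of some form: choose j such that x_j^(d_j) divides m and multiply F j by the quotient. These
  multiples are triangular in m.\<close>

lemma ci_count_le_dim:
  fixes F :: "nat \<Rightarrow> 'k::field mpol"
  assumes lp: "\<And>j. j \<in> {1..s} \<Longrightarrow> lead_power w j (d j) (F j)" and "s \<le> n"
  shows "ci_count n s d e \<le> mpol.dim (gen_piece n {1..s} d F e)"
proof -
  let ?A = "{m \<in> monomials_deg n e. \<exists>j\<in>{1..s}. d j \<le> lookup m j}"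
  define f where "f m = (SOME j. j \<in> {1..s} \<and> d j \<le> lookup m j)" for m :: mon
  have f: "f m \<in> {1..s}" "d (f m) \<le> lookup m (f m)" if "m \<in> ?A" for m
  proof -
    have "\<exists>j. j \<in> {1..s} \<and> d j \<le> lookup m j" using that by blast
    from someI_ex[OF this] show "f m \<in> {1..s}" "d (f m) \<le> lookup m (f m)"
      unfolding f_def by blast+
  qed
  define q where "q m = m - single (f m) (d (f m))" for m :: mon
  have q: "q m + single (f m) (d (f m)) = m" if "m \<in> ?A" for m
    using f[OF that] by (intro poly_mapping_eqI) (auto simp: q_def lookup_add lookup_minus lookup_single when_def)
  have ind: "(f m, q m) \<in> gen_index n {1..s} d e" if m: "m \<in> ?A" for m
  proof -
    have "e = mdeg (q m) + d (f m)" using arg_cong[OF q[OF m], of mdeg] m by (simp add: monomials_deg_def)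
    moreover have "q m + single (f m) (d (f m)) \<in> monomials n"
      unfolding q[OF m] using m by (simp add: monomials_deg_def)
    then have "q m \<in> monomials n" by (simp only: monomials_add)
    ultimately show ?thesis using f[OF m] by (auto simp: gen_index_def monomials_deg_def)
  qed
  have "indep_family ?A (\<lambda>m. lookup (single (q m) 1 * F (f m)))"
  proof (rule triangular_indep_family[where ord = "weight w"])
    fix m assume m: "m \<in> ?A"
    note L = lp[OF f(1)[OF m], unfolded lead_power_def]
    show "lookup (single (q m) 1 * F (f m)) m \<noteq> 0"
      using lookup_single_mult[of "q m" 1 "F (f m)" "single (f m) (d (f m))"] L q[OF m] by simp
    fix k assume "k \<in> keys (single (q m) 1 * F (f m))"
    then obtain l where l: "l \<in> keys (F (f m))" "k = q m + l" using keys_single_mult by blast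
    then have "l = single (f m) (d (f m)) \<or> weight w l < w (f m) * d (f m)" using L by blast
    moreover have "weight w m = weight w (q m) + w (f m) * d (f m)"
      using arg_cong[OF q[OF m], of "weight w"] by simp
    ultimately show "k = m \<or> weight w k < weight w m" using l q[OF m] by auto
  qed auto
  then have "inj_on (\<lambda>m. single (q m) 1 * F (f m)) ?A" "mpol.independent ((\<lambda>m. single (q m) 1 * F (f m)) ` ?A)"
    by (subst (asm) indep_family_lookup_iff; simp)+
  moreover from this have "card ((\<lambda>m. single (q m) 1 * F (f m)) ` ?A) \<le> mpol.dim (gen_piece n {1..s} d F e)"
  proof (intro card_le_dim[of _ "(\<lambda>(j, m). single m 1 * F j) ` gen_index n {1..s} d e"])
    show "(\<lambda>m. single (q m) 1 * F (f m)) ` ?A \<subseteq> gen_piece n {1..s} d F e"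
      unfolding gen_piece_def using ind by (intro image_subsetI mpol.span_base) force
  qed (auto simp: gen_piece_def)
  ultimately show ?thesis by (simp add: ci_count_def card_image)
qed

theorem dim_gen_piece_le:
  fixes F :: "nat \<Rightarrow> 'k::field_char_0 mpol"
  assumes F: "\<And>j. j \<in> {1..s} \<Longrightarrow> F j \<in> polys_deg n (d j)" and "s \<le> n"
  shows "mpol.dim (gen_piece n {1..s} d F e) \<le> ci_count n s d e"
proof -
  define P where "P j = (single (single j (d j)) 1 :: 'k mpol)" for j
  define Ft where "Ft = pencil P F"
  have Ft: "Ft 0 = P" "Ft 1 = F" by (auto simp: Ft_def pencil_def fun_eq_iff)
  have FtD: "Ft t j \<in> polys_deg n (d j)" if "j \<in> {1..s}" for t j
    using that F[OF that] assms(2) unfolding Ft_def pencil_def P_def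
    by (intro mpol.subspace_add[OF subspace_polys_deg] mpol.subspace_scale[OF subspace_polys_deg])
       (auto simp: monomials_deg_def intro!: polys_deg_single)
  define bad where "bad J t0 e = {t. mpol.dim (gen_piece n J d (Ft t) e) < mpol.dim (gen_piece n J d (Ft t0) e)}" for J t0 e
  have "finite (bad J t0 e)" if "finite J" for J t0 e
    unfolding bad_def Ft_def by (rule dim_pencil_generic[OF that])
  \<comment> \<open>Finitely many conditions suffice: one for F in degree e, and one for each proper
    initial subfamily of the pure powers, in the single degree in which the recursion refers to
    it.\<close>
  then have "finite (bad {1..s} 1 e \<union> (\<Union>i<s. bad {1..i} 0 (e - d (Suc i))))"
    by simp
  from ex_new_if_finite[OF infinite_UNIV_char_0 this]
  obtain t where t: "t \<notin> bad {1..s} 1 e" "\<And>i. i < s \<Longrightarrow> t \<notin> bad {1..i} 0 (e - d (Suc i))"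
    by auto
  have "mpol.dim (gen_piece n {1..s} d F e) \<le> mpol.dim (gen_piece n {1..s} d (Ft t) e)"
    using t(1) by (simp add: Ft bad_def)
  also have "\<dots> \<le> ci_count n s d e"
  proof (rule dim_gen_piece_le_of_generic[where F = "Ft t" and d = d, OF FtD assms(2)])
    fix i assume i: "i < s"
    have "ci_count n i d (e - d (Suc i)) \<le> mpol.dim (gen_piece n {1..i} d P (e - d (Suc i)))"
      by (rule ci_count_le_dim[where w = "\<lambda>_. 0"]) (use i assms(2) in \<open>auto simp: lead_power_def P_def keys_single\<close>)
    then show "ci_count n i d (e - d (Suc i)) \<le> mpol.dim (gen_piece n {1..i} d (Ft t) (e - d (Suc i)))"
      using t(2)[OF i] by (simp add: Ft bad_def)
  qed
  finally show ?thesis .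
qed

section \<open>Reduction to one witness in each degree\<close>

lemma init_ideal_eq:
  fixes I :: "'k::field mpol set"
  shows "init_ideal I = {p. keys p \<subseteq> lead_monomials I}"
proof (intro equalityI subsetI)
  fix p :: "'k mpol" assume "p \<in> init_ideal I"
  moreover have "init_ideal I \<subseteq> {p. keys p \<subseteq> lead_monomials I}"
    unfolding init_ideal_def
    by (rule mpol.span_minimal[OF _ subspace_keys])
       (auto simp: in_term_def Let_def keys_single lead_monomials_def split: if_splits)
  ultimately show "p \<in> {p. keys p \<subseteq> lead_monomials I}" by blast
next
  fix p :: "'k mpol" assume p: "p \<in> {p. keys p \<subseteq> lead_monomials I}"
  have "single m c \<in> init_ideal I" if "m \<in> lead_monomials I" for m and c :: 'k
  proof -
    from that obtain f where f: "f \<in> I" "f \<noteq> 0" "m = Max (keys f)" by (auto simp: lead_monomials_def)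
    then have "m \<in> keys f" using Max_in[of "keys f"] by simp
    then have "lookup f m \<noteq> 0" by (simp add: in_keys_iff)
    then have "single m c = pscale (c / lookup f m) (in_term f)"
      using f by (simp add: in_term_def Let_def)
    also have "\<dots> \<in> init_ideal I"
      unfolding init_ideal_def using f by (intro mpol.span_scale mpol.span_base) auto
    finally show ?thesis .
  qed
  then have "(\<Sum>m\<in>keys p. single m (lookup p m)) \<in> init_ideal I"
    using p by (auto simp: init_ideal_def intro!: mpol.span_sum)
  then show "p \<in> init_ideal I" using mpol_eq_sum[of p] by simp
qed

lemma single_in_init_ideal: "single m (1::'k::field) \<in> init_ideal I \<longleftrightarrow> m \<in> lead_monomials I"
  by (simp add: init_ideal_eq keys_single)

lemma Max_keys_single_mult:
  assumes "(f :: 'k::field mpol) \<noteq> 0"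
  shows "single a 1 * f \<noteq> 0" "Max (keys (single a 1 * f)) = a + Max (keys f)"
proof -
  have "Max (keys f) \<in> keys f" using assms by (intro Max_in) auto
  then have *: "a + Max (keys f) \<in> keys (single a 1 * f)"
    using lookup_single_mult[of a 1 f] by (simp add: in_keys_iff)
  then show "single a 1 * f \<noteq> 0" by auto
  show "Max (keys (single a 1 * f)) = a + Max (keys f)"
  proof (rule Max_eqI[OF finite_keys _ *])
    fix y assume "y \<in> keys (single a 1 * f)"
    then obtain k where "k \<in> keys f" "y = a + k" using keys_single_mult by blast
    then show "y \<le> a + Max (keys f)" by (simp add: add_left_mono)
  qed
qed

text \<open>The lexicographic order is compatible with multiplication, so the lead monomials of an
  ideal are closed under multiplication by monomials, and the space they span is the ideal they
  generate.\<close>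

lemma is_monomial_ideal_init_ideal:
  fixes I :: "'k::field mpol set"
  assumes I: "is_ideal n I"
  shows "is_monomial_ideal n (init_ideal I)"
proof -
  let ?M = "lead_monomials I"
  have M: "?M \<subseteq> monomials n"
    by (rule lead_monomials_subset) (use is_idealD(1)[OF I] in \<open>auto simp: polys_def\<close>)
  have closed: "a + m \<in> ?M" if a: "a \<in> monomials n" and m: "m \<in> ?M" for a m
  proof -
    from m obtain f where f: "f \<in> I" "f \<noteq> 0" "m = Max (keys f)" by (auto simp: lead_monomials_def)
    have "single a 1 * f \<in> I" using is_idealD(4)[OF I _ f(1)] a by (simp add: polys_def keys_single)
    then show ?thesis using Max_keys_single_mult[OF f(2), of a] f(3) by (force simp: lead_monomials_def)
  qed
  have sub: "(\<lambda>m. single m (1::'k)) ` ?M \<subseteq> polys n" using M by (auto simp: polys_def keys_single)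
  have "is_ideal n {p :: 'k mpol. keys p \<subseteq> ?M}"
    unfolding is_ideal_def
  proof (intro conjI ballI)
    fix r p :: "'k mpol" assume rp: "r \<in> polys n" "p \<in> {p. keys p \<subseteq> ?M}"
    show "r * p \<in> {p. keys p \<subseteq> ?M}"
    proof (rule CollectI, rule subsetI)
      fix k assume "k \<in> keys (r * p)"
      then obtain a b where "a \<in> keys r" "b \<in> keys p" "k = a + b" using keys_mult[of r p] by blast
      then show "k \<in> ?M" using rp closed[of a b] by (auto simp: polys_def)
    qed
  next
    fix p q :: "'k mpol" assume "p \<in> {p. keys p \<subseteq> ?M}" "q \<in> {p. keys p \<subseteq> ?M}"
    then show "p + q \<in> {p. keys p \<subseteq> ?M}" by (rule mpol.subspace_add[OF subspace_keys])
  qed (use M in \<open>auto simp: polys_def\<close>)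
  then have "is_ideal n hull ((\<lambda>m. single m (1::'k)) ` ?M) \<subseteq> init_ideal I"
    unfolding init_ideal_eq by (intro hull_minimal) (auto simp: keys_single)
  moreover have "init_ideal I \<subseteq> is_ideal n hull ((\<lambda>m. single m (1::'k)) ` ?M)"
  proof
    note id = is_ideal_hull[OF sub]
    fix p :: "'k mpol" assume p: "p \<in> init_ideal I"
    have "(\<Sum>m\<in>keys p. pscale (lookup p m) (single m 1)) \<in> is_ideal n hull ((\<lambda>m. single m (1::'k)) ` ?M)"
    proof (intro mpol.subspace_sum[OF is_ideal_subspace[OF id]] is_ideal_scale[OF id])
      fix m assume "m \<in> keys p"
      then have "m \<in> ?M" using p by (auto simp: init_ideal_eq)
      then show "single m 1 \<in> is_ideal n hull ((\<lambda>m. single m (1::'k)) ` ?M)"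
        using hull_subset[of "(\<lambda>m. single m (1::'k)) ` ?M" "is_ideal n"] by blast
    qed
    then show "p \<in> is_ideal n hull ((\<lambda>m. single m (1::'k)) ` ?M)" using mpol_eq_sum[of p] by simp
  qed
  ultimately show ?thesis unfolding is_monomial_ideal_def using M by (metis equalityI)
qed

text \<open>The order does not refine the degree, but the homogeneous component of f that contains
  the lead monomial of f still has it as its maximum, and this component lies in the ideal.\<close>

lemma lead_monomials_deg:
  fixes F :: "nat \<Rightarrow> 'k::field mpol"
  assumes F: "\<And>j. j \<in> J \<Longrightarrow> F j \<in> polys_deg n (d j)"
  shows "lead_monomials (is_ideal n hull (F ` J)) \<inter> monomials_deg n e = lead_monomials (gen_piece n J d F e)"
proof (intro equalityI subsetI)
  fix m assume m: "m \<in> lead_monomials (is_ideal n hull (F ` J)) \<inter> monomials_deg n e"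
  then obtain f where f: "f \<in> is_ideal n hull (F ` J)" "f \<noteq> 0" "m = Max (keys f)" by (auto simp: lead_monomials_def)
  have keys: "keys (hcomp e f) = {k \<in> keys f. mdeg k = e}" by (auto simp: in_keys_iff lookup_hcomp split: if_splits)
  have mf: "m \<in> keys (hcomp e f)"
    using m f Max_in[of "keys f"] unfolding keys by (auto simp: monomials_deg_def)
  have "Max (keys (hcomp e f)) = m"
    by (rule Max_eqI[OF finite_keys _ mf]) (use f keys in auto)
  moreover have "hcomp e f \<in> gen_piece n J d F e" by (rule hcomp_hull[where F = F, OF F f(1)])
  moreover have "hcomp e f \<noteq> 0" using mf by auto
  ultimately show "m \<in> lead_monomials (gen_piece n J d F e)" by (auto simp: lead_monomials_def)
next
  fix m assume m: "m \<in> lead_monomials (gen_piece n J d F e)"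
  have "lead_monomials (gen_piece n J d F e) \<subseteq> monomials_deg n e"
    by (rule lead_monomials_subset) (use gen_piece_subset[where F = F, OF F] in \<open>auto simp: polys_deg_def\<close>)
  moreover have "lead_monomials (gen_piece n J d F e) \<subseteq> lead_monomials (is_ideal n hull (F ` J))"
    unfolding lead_monomials_def using gen_piece_subset_hull[where F = F, OF F] by (intro image_mono Diff_mono) auto
  ultimately show "m \<in> lead_monomials (is_ideal n hull (F ` J)) \<inter> monomials_deg n e" using m by blast
qed

section \<open>Comparison of standard exterior monomials\<close>

lemma first_difference:
  assumes "length u = length v" "u \<noteq> v"
  obtains i where "i < length u" "\<And>k. k < i \<Longrightarrow> u ! k = v ! k" "u ! i \<noteq> v ! i"
proof -
  have "\<exists>i. i < length u \<and> u ! i \<noteq> v ! i" using assms by (metis nth_equalityI)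
  then obtain i where "i < length u \<and> u ! i \<noteq> v ! i" "\<And>k. k < i \<Longrightarrow> \<not> (k < length u \<and> u ! k \<noteq> v ! k)"
    using exists_least_iff[of "\<lambda>i. i < length u \<and> u ! i \<noteq> v ! i"] by auto
  then show ?thesis using that by force
qed

text \<open>If v had the larger entry at position i, this entry would lie in U by upward closure and
  so occur in the decreasing list u before position i. There u and v agree, so v would contain it
  twice.\<close>

lemma upper_set_dominates:
  fixes U L X :: "'a::linorder set"
  assumes "finite X" "U \<subseteq> X" "L \<subseteq> X" "card L = card U"
    and up: "\<And>x y. x \<in> U \<Longrightarrow> y \<in> X \<Longrightarrow> x \<le> y \<Longrightarrow> y \<in> U"
  defines "u \<equiv> rev (sorted_list_of_set U)" and "v \<equiv> rev (sorted_list_of_set L)"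
  assumes i: "i < length u" "\<And>k. k < i \<Longrightarrow> u ! k = v ! k" "u ! i \<noteq> v ! i"
  shows "v ! i < u ! i"
proof (rule ccontr)
  have fin: "finite U" "finite L"
    using finite_subset[OF assms(2,1)] finite_subset[OF assms(3,1)] by auto
  have len: "length u = length v" using assms(4) fin by (simp add: u_def v_def)
  assume "\<not> v ! i < u ! i"
  with i have less: "u ! i < v ! i" by auto
  have "u ! i \<in> U" using i(1) nth_mem[of i u] fin by (simp add: u_def)
  moreover have "v ! i \<in> X" using i(1) len nth_mem[of i v] fin assms(3) by (auto simp: v_def)
  ultimately have "v ! i \<in> U" using up less by (meson less_imp_le)
  then have "v ! i \<in> set u" using fin by (simp add: u_def)
  then obtain k where k: "k < length u" "u ! k = v ! i" by (auto simp: in_set_conv_nth)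
  have "sorted_wrt (\<ge>) u" unfolding u_def by (simp add: sorted_wrt_rev)
  then have "k < i" using less k i(1) sorted_wrt_nth_less[of "(\<ge>)" u i k]
    by (metis leD linorder_neqE_nat order.refl)
  then have "v ! k = v ! i" using i(2) k by simp
  moreover have "distinct v" by (simp add: v_def)
  ultimately show False using \<open>k < i\<close> i(1) len by (simp add: nth_eq_iff_index_eq)
qed

text \<open>The forms may depend on \<open>e\<close>, since \<open>V\<close> is an intersection over all degrees.\<close>

definition lex_witness ::
    "nat \<Rightarrow> nat \<Rightarrow> (nat \<Rightarrow> nat) \<Rightarrow> nat \<Rightarrow> mon set \<Rightarrow> (nat \<Rightarrow> 'k::field mpol) \<Rightarrow> bool" where
  "lex_witness n s d e W F \<longleftrightarrow> W \<subseteq> monomials_deg n e \<and>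
     (\<forall>m\<in>W. \<forall>k\<in>monomials_deg n e. k \<le> m \<longrightarrow> k \<in> W) \<and>
     card W + ci_count n s d e = card (monomials_deg n e) \<and>
     (\<forall>j\<in>{1..s}. F j \<in> polys_deg n (d j)) \<and>
     (\<forall>p\<in>gen_piece n {1..s} d F e. keys p \<subseteq> W \<longrightarrow> p = 0) \<and>
     ci_count n s d e \<le> mpol.dim (gen_piece n {1..s} d F e)"

lemma lex_witness_card:
  "lex_witness n s d e W F \<Longrightarrow> card (monomials_deg n e - W) = ci_count n s d e"
  using card_Diff_subset[of W "monomials_deg n e"] finite_subset[OF _ finite_monomials_deg, of W n e]
  unfolding lex_witness_def by linarith

text \<open>W is a lower set, so an element of the piece with lead monomial in W is supported on W
  and must be 0. Lead monomials thus avoid W, and the dimension leaves exactly as many of them as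
  the complement has elements.\<close>

lemma lex_witness_lead_monomials:
  assumes "lex_witness n s d e W (F :: nat \<Rightarrow> 'k::field_char_0 mpol)" "s \<le> n"
  shows "lead_monomials (gen_piece n {1..s} d F e) = monomials_deg n e - W"
    "mpol.dim (gen_piece n {1..s} d F e) = ci_count n s d e"
proof -
  note w = assms(1)[unfolded lex_witness_def]
  have F: "\<And>j. j \<in> {1..s} \<Longrightarrow> F j \<in> polys_deg n (d j)" using w by blast
  have sub: "gen_piece n {1..s} d F e \<subseteq> {p. keys p \<subseteq> monomials_deg n e}"
    using gen_piece_subset[where F = F and d = d and J = "{1..s}" and e = e, OF F] by (simp only: polys_deg_def)
  show dim: "mpol.dim (gen_piece n {1..s} d F e) = ci_count n s d e"
    using w dim_gen_piece_le[where F = F and d = d, OF F assms(2)] by (meson le_antisym)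
  have "lead_monomials (gen_piece n {1..s} d F e) \<subseteq> monomials_deg n e - W"
  proof
    fix m assume m: "m \<in> lead_monomials (gen_piece n {1..s} d F e)"
    then obtain p where p: "p \<in> gen_piece n {1..s} d F e" "p \<noteq> 0" "m = Max (keys p)"
      by (auto simp: lead_monomials_def)
    have "m \<in> monomials_deg n e" using lead_monomials_subset[OF sub] m by blast
    moreover have "m \<notin> W"
    proof
      assume mW: "m \<in> W"
      have "keys p \<subseteq> W"
      proof
        fix k assume k: "k \<in> keys p"
        then have "k \<le> m" "k \<in> monomials_deg n e" using p sub by auto
        then show "k \<in> W" using w mW by blast
      qed
      then show False using w p by blast
    qed
    ultimately show "m \<in> monomials_deg n e - W" by blast
  qed
  moreover have "card (lead_monomials (gen_piece n {1..s} d F e)) = card (monomials_deg n e - W)"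
    using card_lead_monomials[OF subspace_gen_piece sub] dim lex_witness_card[OF assms(1)] by simp
  ultimately show "lead_monomials (gen_piece n {1..s} d F e) = monomials_deg n e - W"
    by (intro card_subset_eq) auto
qed

lemma gen_form_polys_deg: "gen_form n d a j \<in> polys_deg n (d j)"
  unfolding gen_form_def
  by (intro mpol.subspace_sum[OF subspace_polys_deg] polys_deg_single)

text \<open>The order of the forms does not affect the ideal, so \<pi> may match the degrees with
  those of the witness. The complement of W is an upper set, hence its list beats every competitor
  at the first difference, and the forms of the witness attain it.\<close>

lemma V_deg_lead_monomials:
  fixes a :: "nat \<times> mon \<Rightarrow> 'k::field_char_0" and F :: "nat \<Rightarrow> 'k mpol"
  assumes a: "a \<in> V_deg n s d e" and W: "lex_witness n s d' e W F" and "s \<le> n"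
    and \<pi>: "bij_betw \<pi> {1..s} {1..s}" "\<And>j. j \<in> {1..s} \<Longrightarrow> d (\<pi> j) = d' j"
  shows "lead_monomials (ideal_of n s d a) \<inter> monomials_deg n e = monomials_deg n e - W"
proof -
  let ?X = "monomials_deg n e" and ?T = "ci_count n s d' e"
  let ?G = "\<lambda>b. gen_piece n {1..s} d' (gen_form n d b \<circ> \<pi>) e"
  let ?L = "\<lambda>b. lead_monomials (ideal_of n s d b) \<inter> ?X"
  note w = W[unfolded lex_witness_def]
  have forms: "(gen_form n d b \<circ> \<pi>) j \<in> polys_deg n (d' j)" if "j \<in> {1..s}" for b :: "nat \<times> mon \<Rightarrow> 'k" and j
    using gen_form_polys_deg[of n d b "\<pi> j"] \<pi>(2)[OF that] by simp
  have ideal: "ideal_of n s d b = is_ideal n hull ((gen_form n d b \<circ> \<pi>) ` {1..s})" for b :: "nat \<times> mon \<Rightarrow> 'k"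
    using \<pi>(1) by (simp add: ideal_of_def bij_betw_def flip: image_image)
  have hilb: "hilb_ideal n s d b e = mpol.dim (?G b)" for b :: "nat \<times> mon \<Rightarrow> 'k"
    unfolding hilb_ideal_def ideal
    using hull_inter_polys_deg[where F = "gen_form n d b \<circ> \<pi>" and d = d' and J = "{1..s}" and n = n and e = e, OF forms] by simp
  have L: "?L b = lead_monomials (?G b)" for b :: "nat \<times> mon \<Rightarrow> 'k"
    unfolding ideal by (rule lead_monomials_deg[where F = "gen_form n d b \<circ> \<pi>" and d = d', OF forms])
  have le: "hilb_ideal n s d b e \<le> ?T" for b :: "nat \<times> mon \<Rightarrow> 'k"
    unfolding hilb by (rule dim_gen_piece_le[where F = "gen_form n d b \<circ> \<pi>" and d = d', OF forms assms(3)])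
  \<comment> \<open>The point of the affine space whose form number \<pi> j is F j; both maxima in
    the definition of V are attained there.\<close>
  define b0 where "b0 = (\<lambda>(j, m)\<in>(SIGMA j:{1..s}. monomials_deg n (d j)). lookup (F (the_inv_into {1..s} \<pi> j)) m)"
  have b0: "b0 \<in> coeff_space n s d" unfolding coeff_space_def b0_def by auto
  have b0F: "(gen_form n d b0 \<circ> \<pi>) j = F j" if j: "j \<in> {1..s}" for j
  proof -
    have "\<pi> j \<in> {1..s}" using \<pi>(1) j by (auto simp: bij_betw_def)
    moreover have "the_inv_into {1..s} \<pi> (\<pi> j) = j" using \<pi>(1) j by (auto simp: bij_betw_def the_inv_into_f_f)
    ultimately have "gen_form n d b0 (\<pi> j) = (\<Sum>m\<in>monomials_deg n (d (\<pi> j)). single m (lookup (F j) m))"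
      unfolding gen_form_def by (intro sum.cong) (auto simp: b0_def)
    also have "\<dots> = F j"
      using w j \<pi>(2)[OF j] by (intro mpol_eq_sum_superset[symmetric]) (auto simp: polys_deg_def)
    finally show ?thesis by simp
  qed
  have Gb0: "?G b0 = gen_piece n {1..s} d' F e"
    unfolding gen_piece_def using b0F by (intro arg_cong[of _ _ mpol.span] image_cong) (auto simp: gen_index_def)
  have hb0: "hilb_ideal n s d b0 e = ?T" and Lb0: "?L b0 = ?X - W"
    unfolding hilb L Gb0 using lex_witness_lead_monomials[OF W assms(3)] by blast+
  have "Max ((\<lambda>b :: nat \<times> mon \<Rightarrow> 'k. hilb_ideal n s d b e) ` coeff_space n s d) = ?T"
  proof (rule Max_eqI)
    \<comment> \<open>The affine space is infinite; it is the bound on the values that makes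
      \<open>Max\<close> meaningful here.\<close>
    show "finite ((\<lambda>b :: nat \<times> mon \<Rightarrow> 'k. hilb_ideal n s d b e) ` coeff_space n s d)"
      by (rule finite_subset[of _ "{..?T}"]) (use le in auto)
    show "?T \<in> (\<lambda>b :: nat \<times> mon \<Rightarrow> 'k. hilb_ideal n s d b e) ` coeff_space n s d"
      using b0 hb0 by (metis image_eqI)
  qed (use le in auto)
  then have U: "U_deg n s d e = {b :: nat \<times> mon \<Rightarrow> 'k. b \<in> coeff_space n s d \<and> hilb_ideal n s d b e = ?T}"
    by (simp add: U_deg_def)
  have ext: "in_ext n (ideal_of n s d b) e = rev (sorted_list_of_set (?L b))" for b :: "nat \<times> mon \<Rightarrow> 'k"
    unfolding in_ext_def single_in_init_ideal by (rule arg_cong[of _ _ "\<lambda>X. rev (sorted_list_of_set X)"]) auto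
  have cardX: "card (?X - W) = ?T"
    using W by (rule lex_witness_card)
  have card: "card (?L b) = card (?X - W)" if "b \<in> U_deg n s d e" for b :: "nat \<times> mon \<Rightarrow> 'k"
  proof -
    have sub: "?G b \<subseteq> {p. keys p \<subseteq> ?X}"
      using gen_piece_subset[where F = "gen_form n d b \<circ> \<pi>" and d = d' and J = "{1..s}" and e = e, OF forms]
      by (simp only: polys_deg_def)
    show ?thesis
      unfolding L cardX card_lead_monomials[OF subspace_gen_piece sub finite_monomials_deg]
      using that unfolding U hilb by blast
  qed
  define u where "u = rev (sorted_list_of_set (?X - W))"
  have uE: "u = in_ext n (ideal_of n s d b0) e" unfolding ext Lb0 u_def ..
  have dom: "v ! i < u ! i" if "b \<in> U_deg n s d e" "v = in_ext n (ideal_of n s d b) e"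
    "i < length u" "\<And>k. k < i \<Longrightarrow> u ! k = v ! k" "u ! i \<noteq> v ! i" for b :: "nat \<times> mon \<Rightarrow> 'k" and v i
    using that(3-) unfolding that(2) ext u_def
    by (intro upper_set_dominates[of ?X]) (use card[OF that(1)] w in \<open>auto simp del: rev_nth\<close>)
  have len: "length (in_ext n (ideal_of n s d b) e) = length u" if "b \<in> U_deg n s d e" for b :: "nat \<times> mon \<Rightarrow> 'k"
    using card[OF that] by (simp add: ext u_def)
  have "max_ext TYPE('k) n s d e = u"
    unfolding max_ext_def Let_def
  proof (rule the_equality)
    show "u \<in> (\<lambda>b :: nat \<times> mon \<Rightarrow> 'k. in_ext n (ideal_of n s d b) e) ` U_deg n s d e \<and>
      (\<forall>v\<in>(\<lambda>b :: nat \<times> mon \<Rightarrow> 'k. in_ext n (ideal_of n s d b) e) ` U_deg n s d e. ext_ge u v)"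
    proof (intro conjI ballI)
      show "u \<in> (\<lambda>b :: nat \<times> mon \<Rightarrow> 'k. in_ext n (ideal_of n s d b) e) ` U_deg n s d e"
        using uE b0 hb0 U by auto
      fix v assume "v \<in> (\<lambda>b :: nat \<times> mon \<Rightarrow> 'k. in_ext n (ideal_of n s d b) e) ` U_deg n s d e"
      then obtain b :: "nat \<times> mon \<Rightarrow> 'k" where b: "b \<in> U_deg n s d e" "v = in_ext n (ideal_of n s d b) e" by auto
      show "ext_ge u v"
      proof (cases "u = v")
        case False
        then obtain i where i: "i < length u" "\<And>k. k < i \<Longrightarrow> u ! k = v ! k" "u ! i \<noteq> v ! i"
          using len[OF b(1)] b(2) first_difference[of u v] by metis
        then show ?thesis using dom[OF b i] unfolding ext_ge_def by (metis less_imp_le)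
      qed (simp add: ext_ge_def)
    qed
  next
    fix v assume v: "v \<in> (\<lambda>b :: nat \<times> mon \<Rightarrow> 'k. in_ext n (ideal_of n s d b) e) ` U_deg n s d e \<and>
      (\<forall>v'\<in>(\<lambda>b :: nat \<times> mon \<Rightarrow> 'k. in_ext n (ideal_of n s d b) e) ` U_deg n s d e. ext_ge v v')"
    then obtain b :: "nat \<times> mon \<Rightarrow> 'k" where b: "b \<in> U_deg n s d e" "v = in_ext n (ideal_of n s d b) e" by auto
    have "ext_ge v u" using v uE b0 hb0 U by auto
    \<comment> \<open>A second maximal list would have to be at least u, but at its first difference
      from u it is smaller.\<close>
    then show "v = u" unfolding ext_ge_def
    proof (elim disjE exE conjE)
      fix i assume i: "i < length v" "\<forall>k<i. v ! k = u ! k" "v ! i \<noteq> u ! i" "u ! i \<le> v ! i"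
      have "v ! i < u ! i" by (rule dom[OF b]) (use i len[OF b(1)] b(2) in auto)
      with i(4) show ?thesis by simp
    qed
  qed
  moreover have "in_ext n (ideal_of n s d a) e = max_ext TYPE('k) n s d e" using a by (simp add: V_deg_def)
  ultimately have "rev (sorted_list_of_set (?L a)) = rev (sorted_list_of_set (?X - W))"
    unfolding ext u_def by simp
  then have "set (sorted_list_of_set (?L a)) = set (sorted_list_of_set (?X - W))" by simp
  then show ?thesis by simp
qed

theorem lexsegment_if_witnesses:
  fixes a :: "nat \<times> mon \<Rightarrow> 'k::field_char_0"
  assumes a: "a \<in> V_set n s d" and "s \<le> n"
    and \<pi>: "bij_betw \<pi> {1..s} {1..s}" "\<And>j. j \<in> {1..s} \<Longrightarrow> d (\<pi> j) = d' j"
    and W: "\<And>e. \<exists>W F. lex_witness n s d' e W (F :: nat \<Rightarrow> 'k mpol)"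
  shows "lexsegment n (init_ideal (ideal_of n s d a))"
  unfolding lexsegment_def
proof (intro conjI ballI impI)
  have "gen_form n d a ` {1..s} \<subseteq> polys n"
    using gen_form_polys_deg[of n d a] polys_deg_subset by blast
  then show "is_monomial_ideal n (init_ideal (ideal_of n s d a))"
    unfolding ideal_of_def by (intro is_monomial_ideal_init_ideal is_ideal_hull)
next
  fix m m' assume m: "m \<in> monomials n" "m' \<in> monomials n"
    and *: "single m 1 \<in> init_ideal (ideal_of n s d a) \<and> mdeg m' = mdeg m \<and> m \<le> m'"
  let ?e = "mdeg m"
  obtain W and F :: "nat \<Rightarrow> 'k mpol" where w: "lex_witness n s d' ?e W F" using W by blast
  have "a \<in> V_deg n s d ?e" using a by (simp add: V_set_def)
  note L = V_deg_lead_monomials[OF this w assms(2) \<pi>]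
  have "m \<in> monomials_deg n ?e" "m' \<in> monomials_deg n ?e" using m * by (auto simp: monomials_deg_def)
  moreover from this have "m \<notin> W" using L * by (auto simp: single_in_init_ideal)
  ultimately have "m' \<in> monomials_deg n ?e - W" using w * by (auto simp: lex_witness_def)
  then show "single m' 1 \<in> init_ideal (ideal_of n s d a)"
    using L by (auto simp: single_in_init_ideal)
qed

section \<open>Nonsingularity of integer matrices\<close>

fun pivot :: "int list list \<Rightarrow> (int list \<times> int list list) option" where
  "pivot [] = None"
| "pivot (r # rs) = (if hd r \<noteq> 0 then Some (r, rs) else map_option (\<lambda>(q, qs). (q, r # qs)) (pivot rs))"

text \<open>Cross-multiplication instead of division: no residue has to be inverted, and the same
  formula over the integers yields a row with these residues.\<close>

definition elim_row :: "int \<Rightarrow> int list \<Rightarrow> int list \<Rightarrow> int list" where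
  "elim_row p r q = (let a = hd r; b = hd q in map2 (\<lambda>x y. (a * y - b * x) mod p) (tl r) (tl q))"

text \<open>Full column rank is tested, n being the number of columns. In degrees with fewer
  standard monomials than points the matrix has more rows than columns.\<close>

fun full_rank :: "int \<Rightarrow> nat \<Rightarrow> int list list \<Rightarrow> bool" where
  "full_rank p 0 rs = True"
| "full_rank p (Suc n) rs = (case pivot rs of None \<Rightarrow> False
     | Some (r, qs) \<Rightarrow> full_rank p n (map (elim_row p r) qs))"

definition dot :: "int list \<Rightarrow> 'k::comm_ring_1 list \<Rightarrow> 'k" where
  "dot r c = (\<Sum>(x, y)\<leftarrow>zip r c. of_int x * y)"

lemma dot_simps [simp]: "dot [] c = 0" "dot r [] = 0" "dot (x # r) (y # c) = of_int x * y + dot r c"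
  by (simp_all add: dot_def)

lemma dot_zeros: "\<forall>y\<in>set c. y = 0 \<Longrightarrow> dot r c = 0"
  by (induction r c rule: list_induct2') auto

lemma dot_append: "length r = length c \<Longrightarrow> dot (r @ r') (c @ c') = dot r c + dot r' c'"
  by (simp add: dot_def)

lemma dot_comb:
  "length r = length q \<Longrightarrow> dot (map2 (\<lambda>x y. a * y - b * x) r q) c = of_int a * dot q c - of_int b * dot r c"
proof (induction r q arbitrary: c rule: list_induct2)
  case (Cons x xs y ys)
  then show ?case by (cases c) (auto simp: algebra_simps)
qed simp

text \<open>Allows the choice of a pivot made on the residues to be repeated on the integer
  rows.\<close>

lemma pivot_map:
  assumes "pivot (map f M) = Some (r, qs)"
  shows "\<exists>r' qs'. r = f r' \<and> qs = map f qs' \<and> r' \<in> set M \<and> set qs' \<subseteq> set M \<and> hd r \<noteq> 0"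
  using assms
proof (induction M arbitrary: r qs)
  case (Cons m M)
  show ?case
  proof (cases "hd (f m) \<noteq> 0")
    case True
    with Cons.prems show ?thesis by (intro exI[of _ m] exI[of _ M]) auto
  next
    case False
    with Cons.prems obtain qs1 where *: "pivot (map f M) = Some (r, qs1)" "qs = f m # qs1"
      by auto
    from Cons.IH[OF *(1)] obtain r' qs' where "r = f r'" "qs1 = map f qs'" "r' \<in> set M"
      "set qs' \<subseteq> set M" "hd r \<noteq> 0" by blast
    with *(2) show ?thesis by (intro exI[of _ r'] exI[of _ "m # qs'"]) auto
  qed
qed simp

text \<open>The elimination modulo \<open>p\<close> is shadowed by the fraction-free elimination of the integer
  matrix itself, whose pivots are nonzero because they are nonzero modulo \<open>p\<close>.\<close>

lemma full_rank_sound: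
  fixes c :: "'k::field_char_0 list"
  assumes "full_rank p n (map (map (\<lambda>x. x mod p)) M)"
    and "\<And>r. r \<in> set M \<Longrightarrow> length r = n \<and> dot r c = 0" and "length c = n"
  shows "\<forall>x\<in>set c. x = 0"
  using assms
proof (induction n arbitrary: M c)
  case (Suc n)
  let ?m = "map (\<lambda>x. x mod p)"
  from Suc.prems(1) obtain r0 qs0 where piv: "pivot (map ?m M) = Some (r0, qs0)"
    and fr: "full_rank p n (map (elim_row p r0) qs0)"
    by (auto split: option.splits)
  from pivot_map[OF piv] obtain r qs where r: "r0 = ?m r" "qs0 = map ?m qs" "r \<in> set M"
    "set qs \<subseteq> set M" "hd r0 \<noteq> 0" by blast
  from Suc.prems(2)[OF r(3)] obtain a u where ru: "r = a # u" "length u = n"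
    by (cases r) auto
  from Suc.prems(3) obtain y d where c: "c = y # d" "length d = n" by (cases c) auto
  define el where "el q = map2 (\<lambda>x y. a * y - hd q * x) u (tl q)" for q
  have a0: "a \<noteq> 0" using r ru by auto
  have el: "?m (el q) = elim_row p r0 (?m q)" if "q \<in> set qs" for q
  proof -
    have "length q = Suc n" using that r Suc.prems(2) by auto
    then obtain b v where "q = b # v" by (cases q) auto
    then show ?thesis unfolding el_def elim_row_def r ru
      by (auto simp: zip_map1 zip_map2 split_def intro!: map_cong)
         (metis mod_diff_eq mod_mult_eq)
  qed
  have "\<forall>x\<in>set d. x = 0"
  proof (rule Suc.IH[of "map el qs"])
    show "full_rank p n (map ?m (map el qs))"
      using fr el unfolding r(2) by (simp cong: map_cong)
    fix q' assume "q' \<in> set (map el qs)"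
    then obtain q where q: "q \<in> set qs" "q' = el q" by auto
    then have Q: "length q = Suc n" "dot q c = 0" using r Suc.prems(2) by auto
    then obtain b v where v: "q = b # v" "length v = n" by (cases q) auto
    have "of_int a * y + dot u d = 0" using Suc.prems(2)[OF r(3)] ru c by auto
    moreover have "of_int b * y + dot v d = 0" using Q v c by auto
    ultimately have "dot u d = - (of_int a * y)" "dot v d = - (of_int b * y)"
      by (simp_all add: eq_neg_iff_add_eq_0 add.commute)
    then have "dot (el q) d = 0"
      unfolding el_def v using dot_comb[of u v a b d] ru v by simp
    then show "length q' = n \<and> dot q' d = 0" using q ru v by (simp add: el_def)
  qed (use c in auto)
  moreover from this have "dot u d = 0"
    by (rule dot_zeros)
  then have "y = 0" using Suc.prems(2)[OF r(3)] ru c a0 by auto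
  ultimately show ?case using c by auto
qed simp

section \<open>Finite differences and moments\<close>

definition diff_row :: "int list \<Rightarrow> int list" where
  "diff_row v = map2 (-) (v @ [0]) (0 # v)"

text \<open>The entries are (-1)^k binomial(n, k), produced by repeated differences.\<close>

primrec signed_binomials :: "nat \<Rightarrow> int list" where
  "signed_binomials 0 = [1]"
| "signed_binomials (Suc n) = diff_row (signed_binomials n)"

lemma length_signed_binomials [simp]: "length (signed_binomials n) = Suc n"
  by (induction n) (simp_all add: diff_row_def)

text \<open>Entry m is the power moment of the weights v at the nodes ts. Each step multiplies the
  weights by the nodes once, so that no powers are computed.\<close>

fun moments :: "int \<Rightarrow> nat \<Rightarrow> int list \<Rightarrow> int list \<Rightarrow> int list" where
  "moments p 0 ts v = []"
| "moments p (Suc k) ts v = (sum_list v mod p) # moments p k ts (map2 (\<lambda>t x. (t * x) mod p) ts v)"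

text \<open>Entry m is, up to sign and modulo p, the difference of order D - 1 in y of the function
  w^a x^i y^m on the D points.\<close>

definition moment_table :: "int \<Rightarrow> (int \<times> int) list \<Rightarrow> nat \<Rightarrow> nat \<Rightarrow> int list" where
  "moment_table p pts a i = (let D = length pts in
     moments p D (map int [0..<D])
       (map2 (\<lambda>c (w, x). (c * w ^ a * x ^ i) mod p) (signed_binomials (D - 1)) pts))"

text \<open>Row r multiplies by y^r before taking the difference. The column of w^a x^i y^j
  therefore holds entry r + j of the table for (a, i), and shifted slices of one table give all
  rows.\<close>

definition hankel :: "nat \<Rightarrow> (int list \<times> nat) list \<Rightarrow> int list list" where
  "hankel R bl = map (\<lambda>r. concat (map (\<lambda>(T, l). take l (drop r T)) bl)) [0..<R]"

lemma signed_binomials_nth_Suc: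
  "k \<le> Suc n \<Longrightarrow> signed_binomials (Suc n) ! k =
     (if k \<le> n then signed_binomials n ! k else 0) - (if k = 0 then 0 else signed_binomials n ! (k - 1))"
  by (auto simp: diff_row_def nth_append nth_Cons')

lemma signed_binomials_Suc_sum:
  fixes f :: "nat \<Rightarrow> int"
  shows "(\<Sum>k\<le>Suc n. signed_binomials (Suc n) ! k * f k) = (\<Sum>k\<le>n. signed_binomials n ! k * (f k - f (Suc k)))"
proof -
  have "(\<Sum>k\<le>Suc n. signed_binomials (Suc n) ! k * f k) =
     (\<Sum>k\<le>Suc n. (if k \<le> n then signed_binomials n ! k else 0) * f k) -
     (\<Sum>k\<le>Suc n. (if k = 0 then 0 else signed_binomials n ! (k - 1)) * f k)"
    unfolding sum_subtractf[symmetric]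
    by (intro sum.cong refl) (subst signed_binomials_nth_Suc, auto simp: algebra_simps)
  also have "(\<Sum>k\<le>Suc n. (if k \<le> n then signed_binomials n ! k else 0) * f k) = (\<Sum>k\<le>n. signed_binomials n ! k * f k)"
    by simp
  also have "(\<Sum>k\<le>Suc n. (if k = 0 then 0 else signed_binomials n ! (k - 1)) * f k) = (\<Sum>k\<le>n. signed_binomials n ! k * f (Suc k))"
    by (subst sum.atMost_Suc_shift) simp
  finally show ?thesis by (simp add: sum_subtractf algebra_simps)
qed

text \<open>One step replaces q(y) by q(y) - q(y + 1), where the leading terms cancel, so the degree
  drops each time. The alternative q = 0 ends the induction, since the zero polynomial has degree 0
  here.\<close>

lemma signed_binomials_poly:
  fixes q :: "int poly"
  shows "degree q < n \<or> q = 0 \<Longrightarrow> (\<Sum>k\<le>n. signed_binomials n ! k * poly q (int k)) = 0"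
proof (induction n arbitrary: q)
  case (Suc n)
  let ?q = "q - q \<circ>\<^sub>p [:1, 1:]"
  have "degree ?q < n \<or> ?q = 0"
  proof (cases "degree q = 0")
    case True
    then obtain c where "q = [:c:]" by (metis degree_eq_zeroE)
    then show ?thesis by simp
  next
    case False
    have "coeff (q \<circ>\<^sub>p [:1, 1:]) (degree q) = lead_coeff q"
      using lead_coeff_comp[of "[:1, 1::int:]" q] by (simp add: degree_pcompose)
    moreover have "degree ?q \<le> degree q" by (rule degree_diff_le) (auto simp: degree_pcompose)
    ultimately have "degree ?q < degree q"
      using False by (metis coeff_diff diff_self eq_zero_or_degree_less degree_0 gr0I le_neq_implies_less leading_coeff_0_iff)
    then show ?thesis using Suc.prems False by auto
  qed
  from Suc.IH[OF this] show ?case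
    unfolding signed_binomials_Suc_sum by (simp add: poly_pcompose add.commute)
qed auto

lemma signed_binomials_power:
  "m < n \<Longrightarrow> (\<Sum>k\<le>n. signed_binomials n ! k * int k ^ m) = 0"
  using signed_binomials_poly[of "monom 1 m" n] by (simp add: poly_monom degree_monom_eq)

lemma moments_eq:
  assumes "length v = length ts"
  shows "moments p k ts (map (\<lambda>x. x mod p) v) = map (\<lambda>m. (\<Sum>t<length ts. v ! t * ts ! t ^ m) mod p) [0..<k]"
  using assms
proof (induction k arbitrary: v)
  case (Suc k)
  have e: "map2 (\<lambda>t x. (t * x) mod p) ts (map (\<lambda>x. x mod p) v) = map (\<lambda>x. x mod p) (map2 (*) ts v)"
    by (simp add: zip_map2 split_def mod_simps)
  have "moments p (Suc k) ts (map (\<lambda>x. x mod p) v) =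
     (\<Sum>x\<leftarrow>v. x mod p) mod p # map (\<lambda>m. (\<Sum>t<length ts. map2 (*) ts v ! t * ts ! t ^ m) mod p) [0..<k]"
    unfolding moments.simps e by (subst Suc.IH) (use Suc.prems in simp_all)
  also have "(\<Sum>x\<leftarrow>v. x mod p) mod p = (\<Sum>t<length ts. v ! t * ts ! t ^ 0) mod p"
    by (simp add: sum_list_sum_nth Suc.prems mod_sum_eq atLeast0LessThan)
  also have "map (\<lambda>m. (\<Sum>t<length ts. map2 (*) ts v ! t * ts ! t ^ m) mod p) [0..<k] =
     map (\<lambda>m. (\<Sum>t<length ts. v ! t * ts ! t ^ m) mod p) (map Suc [0..<k])"
    using Suc.prems by (auto intro!: sum.cong arg_cong2[where f="(mod)"])
  finally show ?case
    by (simp only: map_Suc_upt upt_conv_Cons[OF zero_less_Suc] list.map)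
qed simp

lemma moment_table_eq:
  assumes "pts \<noteq> []"
  shows "moment_table p pts a i = map (\<lambda>m. (\<Sum>t<length pts. signed_binomials (length pts - 1) ! t *
     fst (pts ! t) ^ a * snd (pts ! t) ^ i * int t ^ m) mod p) [0..<length pts]"
proof -
  let ?D = "length pts"
  let ?v = "map2 (\<lambda>c (w, x). c * w ^ a * x ^ i) (signed_binomials (?D - 1)) pts"
  have l: "length ?v = length (map int [0..<?D])" using assms by simp
  have "moment_table p pts a i = moments p ?D (map int [0..<?D]) (map (\<lambda>x. x mod p) ?v)"
    by (simp add: moment_table_def Let_def comp_def split_def)
  then show ?thesis unfolding moments_eq[OF l] using assms
    by (auto simp: split_def intro!: sum.cong arg_cong2[where f="(mod)"])
qed

lemma dot_map_upt: "dot (map f [0..<l]) (map g [0..<l]) = (\<Sum>j<l. of_int (f j) * g j)"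
  by (induction l) (simp_all add: dot_append)

lemma dot_concat:
  "dot (concat (map (\<lambda>b. map (f b) [0..<len b]) bl)) (concat (map (\<lambda>b. map (g b) [0..<len b]) bl)) =
     (\<Sum>b\<leftarrow>bl. \<Sum>j<len b. of_int (f b j) * g b j)"
  by (induction bl) (simp_all add: dot_append dot_map_upt)

lemma sum_list_sum_swap: "(\<Sum>b\<leftarrow>bl. \<Sum>t\<in>A. f b t) = (\<Sum>t\<in>A. \<Sum>b\<leftarrow>bl. f b t)"
  by (induction bl) (simp_all add: sum.distrib)

text \<open>Blocks \<open>(a, i, l)\<close> stand for the monomials \<open>w^a x^i y^j\<close> with \<open>j < l\<close>, evaluated at points whose
  \<open>y\<close>-coordinates are \<open>0, 1, \<dots>, D - 1\<close>. Finite differences of order \<open>D - 1\<close> in \<open>y\<close> eliminate the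
  pure powers of \<open>y\<close> and leave a matrix made of Hankel blocks.\<close>

lemma points_independent:
  fixes c :: "nat \<Rightarrow> nat \<Rightarrow> nat \<Rightarrow> 'k::field_char_0" and bl :: "(nat \<times> nat \<times> nat) list"
  defines "len \<equiv> \<lambda>b::nat \<times> nat \<times> nat. snd (snd b)"
  assumes D: "D = length pts" "pts \<noteq> []" "l0 \<le> D"
    and rank: "full_rank p (\<Sum>b\<leftarrow>bl. len b)
      (hankel (D - l0) (map (\<lambda>(a, i, l). (moment_table p pts a i, l)) bl))"
    and len: "\<And>b. b \<in> set bl \<Longrightarrow> len b \<le> l0"
    and vanish: "\<And>t. t < D \<Longrightarrow> (\<Sum>j<l0. c 0 0 j * of_nat t ^ j) +
      (\<Sum>(a, i, l)\<leftarrow>bl. \<Sum>j<l. c a i j * of_int (fst (pts ! t) ^ a * snd (pts ! t) ^ i * int t ^ j)) = 0"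
  shows "(\<forall>j<l0. c 0 0 j = 0) \<and> (\<forall>(a, i, l)\<in>set bl. \<forall>j<l. c a i j = 0)"
proof -
  define g where "g b t = fst (pts ! t) ^ fst b * snd (pts ! t) ^ fst (snd b)" for b :: "nat \<times> nat \<times> nat" and t
  define sb where "sb t = signed_binomials (D - 1) ! t" for t
  define mu where "mu b m = (\<Sum>t<D. sb t * g b t * int t ^ m)" for b m
  define cc where "cc b j = c (fst b) (fst (snd b)) j" for b :: "nat \<times> nat \<times> nat" and j
  define C where "C = concat (map (\<lambda>b. map (cc b) [0..<len b]) bl)"
  define row where "row r = concat (map (\<lambda>b. map (\<lambda>j. mu b (r + j)) [0..<len b]) bl)" for r
  have vanish': "(\<Sum>b\<leftarrow>bl. \<Sum>j<len b. cc b j * of_int (g b t * int t ^ j)) = - (\<Sum>j<l0. c 0 0 j * of_nat t ^ j)"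
    if "t < D" for t
    using vanish[OF that]
    by (simp add: split_def cc_def g_def len_def eq_neg_iff_add_eq_0 add.commute)
  have "\<forall>x\<in>set C. x = 0"
  proof (rule full_rank_sound)
    have "take (len b) (drop r (moment_table p pts (fst b) (fst (snd b)))) =
        map (\<lambda>x. x mod p) (map (\<lambda>j. mu b (r + j)) [0..<len b])"
      if "b \<in> set bl" "r < D - l0" for b r
    proof -
      have "r + len b \<le> D" using len[OF that(1)] that(2) D by auto
      then show ?thesis unfolding moment_table_eq[OF D(2)] D(1)[symmetric]
        by (intro nth_equalityI) (auto simp: mu_def g_def sb_def algebra_simps)
    qed
    then have "hankel (D - l0) (map (\<lambda>(a, i, l). (moment_table p pts a i, l)) bl) =
        map (map (\<lambda>x. x mod p)) (map row [0..<D - l0])"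
      unfolding hankel_def row_def
      by (auto simp: map_concat split_def comp_def len_def intro!: arg_cong[of _ _ concat])
    then show "full_rank p (\<Sum>b\<leftarrow>bl. len b) (map (map (\<lambda>x. x mod p)) (map row [0..<D - l0]))"
      using rank by simp
  next
    fix r' assume "r' \<in> set (map row [0..<D - l0])"
    then obtain r where r: "r' = row r" "r < D - l0" by auto
    have "dot (row r) C = (\<Sum>b\<leftarrow>bl. \<Sum>j<len b. of_int (mu b (r + j)) * cc b j)"
      unfolding row_def C_def by (rule dot_concat)
    also have "\<dots> = (\<Sum>b\<leftarrow>bl. \<Sum>t<D. of_int (sb t * int t ^ r) * (\<Sum>j<len b. cc b j * of_int (g b t * int t ^ j)))"
    proof (intro arg_cong[of _ _ sum_list] map_cong refl)
      fix b
      have "(\<Sum>j<len b. of_int (mu b (r + j)) * cc b j) =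
        (\<Sum>j<len b. \<Sum>t<D. of_int (sb t * int t ^ r) * (cc b j * of_int (g b t * int t ^ j)))"
        by (simp add: mu_def sum_distrib_right sum_distrib_left power_add algebra_simps)
      then show "(\<Sum>j<len b. of_int (mu b (r + j)) * cc b j) =
         (\<Sum>t<D. of_int (sb t * int t ^ r) * (\<Sum>j<len b. cc b j * of_int (g b t * int t ^ j)))"
        by (simp only: sum_distrib_left sum.swap[of _ "{..<D}"])
    qed
    also have "\<dots> = (\<Sum>t<D. of_int (sb t * int t ^ r) * (\<Sum>b\<leftarrow>bl. \<Sum>j<len b. cc b j * of_int (g b t * int t ^ j)))"
      by (simp only: sum_list_sum_swap sum_list_const_mult)
    also have "\<dots> = (\<Sum>t<D. of_int (sb t * int t ^ r) * - (\<Sum>j<l0. c 0 0 j * of_nat t ^ j))"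
      by (intro sum.cong refl) (simp only: vanish' lessThan_iff)
    also have "\<dots> = - (\<Sum>j<l0. c 0 0 j * of_int (\<Sum>t<D. sb t * int t ^ (r + j)))"
      by (simp add: sum_negf sum_distrib_left power_add sum.swap[of _ "{..<l0}"] algebra_simps)
    also have "\<dots> = 0"
    proof -
      \<comment> \<open>From r < D - l0 and j < l0 one gets r + j < D - 1, the range in which
        differences of order D - 1 vanish; this is why there are D - l0 rows.\<close>
      have "(\<Sum>t<D. sb t * int t ^ (r + j)) = 0" if "j < l0" for j
        using signed_binomials_power[of "r + j" "D - 1"] that r(2) D
        by (simp add: sb_def lessThan_Suc_atMost[symmetric])
      then show ?thesis by simp
    qed
    finally show "length r' = (\<Sum>b\<leftarrow>bl. len b) \<and> dot r' C = 0"
      unfolding r(1) by (simp add: row_def length_concat comp_def)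
  qed (simp add: C_def length_concat comp_def)
  then have C0: "cc b j = 0" if "b \<in> set bl" "j < len b" for b j
    using that unfolding C_def by auto
  \<comment> \<open>With the other blocks gone, a polynomial in y of degree below D remains, with
    the D roots 0, 1, ..., D - 1; they are distinct in characteristic 0.\<close>
  have "poly (\<Sum>j<l0. monom (c 0 0 j) j) (of_nat t) = 0" if "t < D" for t
  proof -
    have "(\<Sum>b\<leftarrow>bl. \<Sum>j<len b. cc b j * of_int (g b t * int t ^ j)) = (\<Sum>b\<leftarrow>bl. 0)"
      by (intro arg_cong[of _ _ sum_list] map_cong refl sum.neutral) (auto simp: C0)
    with vanish'[OF that] show ?thesis by (simp add: poly_sum poly_monom)
  qed
  then have "(of_nat ` {..<D} :: 'k set) \<subseteq> {x. poly (\<Sum>j<l0. monom (c 0 0 j) j) x = 0}" by auto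
  moreover have "card (of_nat ` {..<D} :: 'k set) = D" by (simp add: card_image inj_on_def)
  moreover have "degree (\<Sum>j<l0. monom (c 0 0 j) j) < D"
  proof (cases l0)
    case (Suc l)
    have "degree (\<Sum>j<l0. monom (c 0 0 j) j) \<le> l"
      by (rule degree_sum_le) (auto simp: Suc intro: order.trans[OF degree_monom_le])
    then show ?thesis using Suc D by simp
  qed (use D in simp)
  ultimately have "(\<Sum>j<l0. monom (c 0 0 j) j) = 0"
    using card_poly_roots_bound[of "\<Sum>j<l0. monom (c 0 0 j) j"]
      card_mono[OF poly_roots_finite, of "\<Sum>j<l0. monom (c 0 0 j) j" "of_nat ` {..<D}"]
    by fastforce
  then have "c 0 0 j = 0" if "j < l0" for j
  proof -
    have "coeff (\<Sum>j<l0. monom (c 0 0 j) j) j = c 0 0 j" using that by (simp add: coeff_sum)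
    then show ?thesis using \<open>(\<Sum>j<l0. monom (c 0 0 j) j) = 0\<close> by simp
  qed
  with C0 show ?thesis by (force simp: cc_def len_def)
qed

section \<open>Witnesses from linear forms\<close>

locale poly_evaluation =
  fixes C :: "'k::field \<Rightarrow> 'r::comm_ring_1" and v :: "nat \<Rightarrow> 'r"
  assumes C_zero: "C 0 = 0" and C_one: "C 1 = 1"
    and C_add: "C (x + y) = C x + C y" and C_mult: "C (x * y) = C x * C y"
begin

definition mon_eval :: "mon \<Rightarrow> 'r" where
  "mon_eval m = (\<Prod>i\<in>keys m. v i ^ lookup m i)"

definition peval :: "'k mpol \<Rightarrow> 'r" where
  "peval p = (\<Sum>m\<in>keys p. C (lookup p m) * mon_eval m)"

lemma mon_eval_superset: "finite A \<Longrightarrow> keys m \<subseteq> A \<Longrightarrow> mon_eval m = (\<Prod>i\<in>A. v i ^ lookup m i)"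
  unfolding mon_eval_def by (rule prod.mono_neutral_left) (auto simp: in_keys_iff)

lemma mon_eval_add: "mon_eval (m + m') = mon_eval m * mon_eval m'"
proof -
  let ?A = "keys m \<union> keys m'"
  have "mon_eval (m + m') = (\<Prod>i\<in>?A. v i ^ lookup (m + m') i)"
    by (rule mon_eval_superset) (auto simp: keys_plus_nat)
  moreover have "mon_eval m = (\<Prod>i\<in>?A. v i ^ lookup m i)" "mon_eval m' = (\<Prod>i\<in>?A. v i ^ lookup m' i)"
    by (rule mon_eval_superset; auto)+
  ultimately show ?thesis by (simp add: lookup_add power_add prod.distrib)
qed

lemma mon_eval_single [simp]: "mon_eval (single i k) = v i ^ k"
  using mon_eval_superset[of "{i}" "single i k"] by (auto simp: keys_single)

lemma peval_superset: "finite A \<Longrightarrow> keys p \<subseteq> A \<Longrightarrow> peval p = (\<Sum>m\<in>A. C (lookup p m) * mon_eval m)"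
  unfolding peval_def by (rule sum.mono_neutral_left) (auto simp: in_keys_iff C_zero)

lemma peval_zero [simp]: "peval 0 = 0"
  by (simp add: peval_def)

lemma peval_add: "peval (p + q) = peval p + peval q"
proof -
  let ?A = "keys p \<union> keys q"
  have "peval (p + q) = (\<Sum>m\<in>?A. C (lookup (p + q) m) * mon_eval m)"
    by (rule peval_superset) (use keys_add[of p q] in auto)
  moreover have "peval p = (\<Sum>m\<in>?A. C (lookup p m) * mon_eval m)" "peval q = (\<Sum>m\<in>?A. C (lookup q m) * mon_eval m)"
    by (rule peval_superset; auto)+
  ultimately show ?thesis by (simp add: lookup_add C_add sum.distrib algebra_simps)
qed

lemma peval_sum: "peval (\<Sum>i\<in>A. f i) = (\<Sum>i\<in>A. peval (f i))"
  by (induction A rule: infinite_finite_induct) (simp_all add: peval_add)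

lemma peval_single: "peval (single m c) = C c * mon_eval m"
  using peval_superset[of "{m}" "single m c"] by (auto simp: keys_single C_zero)

lemma peval_single_mult: "peval (single m c * p) = C c * mon_eval m * peval p"
proof -
  have "single m c * p = (\<Sum>k\<in>keys p. single (m + k) (c * lookup p k))"
    by (subst mpol_eq_sum[of p]) (simp add: sum_distrib_left mult_single)
  then show ?thesis
    by (simp add: peval_sum peval_single mon_eval_add C_mult peval_def[of p] sum_distrib_left algebra_simps)
qed

lemma peval_mult: "peval (p * q) = peval p * peval q"
proof -
  have "p * q = (\<Sum>m\<in>keys p. single m (lookup p m) * q)"
    by (subst mpol_eq_sum[of p]) (simp add: sum_distrib_right)
  then show ?thesis
    by (simp add: peval_sum peval_single_mult peval_def[of p] sum_distrib_right)
qed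

lemma peval_prod_list: "peval (prod_list ps) = prod_list (map peval ps)"
  using peval_single[of 0 1] by (induction ps) (simp_all add: peval_mult mon_eval_def C_one)

lemma C_of_int: "C (of_int z) = of_int z"
proof -
  have nat: "C (of_nat k) = of_nat k" for k by (induction k) (simp_all add: C_add C_zero C_one)
  have "C (- x) = - C x" for x using C_add[of x "- x"] by (simp add: C_zero eq_neg_iff_add_eq_0 add.commute)
  then show ?thesis using nat by (cases z rule: int_cases) (simp_all del: of_nat_Suc add: of_nat_Suc[symmetric] C_add)
qed

text \<open>A linear condition on values need only be checked on generators. It is applied to
  scalars, as vanishing at a point, and to polynomials, as vanishing of one coefficient after a
  substitution.\<close>

lemma gen_piece_peval:
  assumes "p \<in> gen_piece n J d F e"
    and "mpol.subspace {p. Q (peval p)}"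
    and "\<And>m j. j \<in> J \<Longrightarrow> d j \<le> e \<Longrightarrow> m \<in> monomials_deg n (e - d j) \<Longrightarrow> Q (mon_eval m * peval (F j))"
  shows "Q (peval p)"
proof -
  have "gen_piece n J d F e \<subseteq> {p. Q (peval p)}"
    unfolding gen_piece_def
    by (rule mpol.span_minimal[OF _ assms(2)]) (auto simp: gen_index_def peval_single_mult C_one assms(3))
  with assms(1) show ?thesis by blast
qed

end

text \<open>Only the variables \<open>x\<^sub>b\<close>, \<dots>, \<open>x\<^sub>b\<^sub>+\<^sub>3\<close> occur from here on, where \<open>n = b + 3\<close>. This treats \<open>n = 3\<close> and
  \<open>n = 4\<close> alike; for \<open>n = 3\<close> the first of them is the illegal \<open>x\<^sub>0\<close> and has to be avoided.\<close>

definition lin :: "nat \<Rightarrow> int list \<Rightarrow> 'k::field mpol" where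
  "lin b c = (\<Sum>q<4. single (single (b + q) 1) (of_int (c ! q)))"

definition xmon :: "nat \<Rightarrow> nat \<Rightarrow> nat \<Rightarrow> nat \<Rightarrow> nat \<Rightarrow> mon" where
  "xmon b a i j k = single b a + single (b + 1) i + single (b + 2) j + single (b + 3) k"

lemma single_Suc_0_eq_iff [simp]: "single i (Suc 0) = single j (Suc 0) \<longleftrightarrow> i = j"
  by (metis lookup_single_eq lookup_single_not_eq nat.simps(3))

lemma lookup_lin:
  "q < 4 \<Longrightarrow> lookup (lin b c :: 'k::field mpol) (single (b + q) 1) = of_int (c ! q)"
  by (simp add: lin_def lookup_sum lookup_single when_def)

lemma keys_lin: "k \<in> keys (lin b c :: 'k::field mpol) \<Longrightarrow> \<exists>q<4. k = single (b + q) 1 \<and> c ! q \<noteq> 0"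
  by (rule ccontr) (auto simp: lin_def lookup_sum lookup_single when_def in_keys_iff sum.neutral)

lemma lead_power_lin:
  assumes "q < 4" "c ! q = 1" "\<And>r. r < 4 \<Longrightarrow> c ! r \<noteq> 0 \<Longrightarrow> r = q \<or> w (b + r) < w (b + q)"
  shows "lead_power w (b + q) 1 (lin b c :: 'k::field mpol)"
  using keys_lin[of _ b c, where 'k = 'k] lookup_lin[OF assms(1), of b c, where 'k = 'k] assms
  by (fastforce simp: lead_power_def)

text \<open>The product of the two pure powers cannot cancel, since every other product of terms has
  strictly smaller weight.\<close>

lemma lead_power_mult:
  fixes p q :: "'k::field mpol"
  assumes p: "lead_power w i k p" and q: "lead_power w i l q"
  shows "lead_power w i (k + l) (p * q)"
proof -
  define r where "r = p - single (single i k) (lookup p (single i k))"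
  have r: "weight w m < w i * k" if "m \<in> keys r" for m
  proof -
    have "m \<noteq> single i k" "m \<in> keys p" using that
      by (auto simp: r_def in_keys_iff lookup_minus lookup_single when_def split: if_splits)
    then show ?thesis using p by (auto simp: lead_power_def)
  qed
  have qle: "weight w m \<le> w i * l" if "m \<in> keys q" for m
    using q that by (auto simp: lead_power_def)
  have rq: "weight w m < w i * (k + l)" if mk: "m \<in> keys (r * q)" for m
  proof -
    obtain a c where "m = a + c" "a \<in> keys r" "c \<in> keys q" using mk keys_mult[of r q] by blast
    then show ?thesis using r[of a] qle[of c] by (simp add: algebra_simps)
  qed
  have pq: "p * q = single (single i k) (lookup p (single i k)) * q + r * q"
    by (simp add: r_def algebra_simps)
  have il: "single i (k + l) = single i k + single i l" by (rule single_add)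
  have "single i (k + l) \<notin> keys (r * q)" using rq[of "single i (k + l)"] by auto
  then have "lookup (p * q) (single i (k + l)) = lookup p (single i k) * lookup q (single i l)"
    unfolding pq lookup_add il lookup_single_mult by (simp add: in_keys_iff flip: il)
  then have "lookup (p * q) (single i (k + l)) \<noteq> 0" using p q by (simp add: lead_power_def)
  moreover have "m = single i (k + l) \<or> weight w m < w i * (k + l)" if mk: "m \<in> keys (p * q)" for m
  proof -
    obtain a c where ac: "m = a + c" "a \<in> keys p" "c \<in> keys q" using mk keys_mult[of p q] by blast
    then have "a = single i k \<or> weight w a < w i * k" "c = single i l \<or> weight w c < w i * l"
      using p q by (auto simp: lead_power_def)
    then show ?thesis unfolding ac(1) by (auto simp: il algebra_simps)
  qed
  ultimately show ?thesis by (simp add: lead_power_def)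
qed

lemma lead_power_prod_list:
  assumes "\<And>c. c \<in> set cs \<Longrightarrow> lead_power w i 1 (f c :: 'k::field mpol)"
  shows "lead_power w i (length cs) (prod_list (map f cs))"
  using assms
proof (induction cs)
  case Nil
  then show ?case by (simp add: lead_power_def)
next
  case (Cons c cs)
  then show ?case using lead_power_mult[of w i 1 "f c" "length cs"] by simp
qed

lemma prod_list_polys_deg:
  assumes "\<And>c. c \<in> set cs \<Longrightarrow> f c \<in> polys_deg n 1"
  shows "prod_list (map f cs) \<in> polys_deg n (length cs)"
  using assms
proof (induction cs)
  case Nil
  then show ?case by (simp add: polys_deg_def monomials_deg_def mdeg_def)
next
  case (Cons c cs)
  then show ?case using polys_deg_mult[of "f c" n 1 "prod_list (map f cs)" "length cs"] by simp
qed

lemma lin_polys_deg: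
  assumes "b = 0 \<longrightarrow> c ! 0 = 0"
  shows "(lin b c :: 'k::field mpol) \<in> polys_deg (b + 3) 1"
  unfolding polys_deg_def
proof (rule CollectI, rule subsetI)
  fix k assume "k \<in> keys (lin b c :: 'k mpol)"
  then obtain q where "q < 4" "k = single (b + q) 1" "c ! q \<noteq> 0" using keys_lin by blast
  then show "k \<in> monomials_deg (b + 3) 1"
    using assms by (cases "b + q = 0") (auto simp: monomials_deg_def)
qed

lemma lookup_xmon [simp]:
  shows "lookup (xmon b a i j k) b = a" and "lookup (xmon b a i j k) (b + 1) = i"
    and "lookup (xmon b a i j k) (Suc b) = i" and "lookup (xmon b a i j k) (Suc (Suc b)) = j" and "lookup (xmon b a i j k) (b + 2) = j"
    and "lookup (xmon b a i j k) (b + 3) = k"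
  by (simp_all only: xmon_def lookup_add lookup_single when_def) simp_all

lemma mdeg_xmon [simp]: "mdeg (xmon b a i j k) = a + i + j + k"
  by (simp add: xmon_def)

lemma xmon_in_monomials: "b = 0 \<longrightarrow> a = 0 \<Longrightarrow> xmon b a i j k \<in> monomials (b + 3)"
  by (cases "b = 0") (simp_all add: xmon_def)

lemma monomials_eq_xmon:
  assumes "m \<in> monomials (b + 3)" "b \<le> 1"
  shows "m = xmon b (lookup m b) (lookup m (b + 1)) (lookup m (b + 2)) (lookup m (b + 3))"
proof (rule poly_mapping_eqI)
  fix i
  consider "i < b" | "i = b" | "i = b + 1" | "i = b + 2" | "i = b + 3" | "i > b + 3" by linarith
  then show "lookup m i = lookup (xmon b (lookup m b) (lookup m (b + 1)) (lookup m (b + 2)) (lookup m (b + 3))) i"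
  proof cases
    case 1
    then have "i \<notin> keys m" using assms by (auto simp: monomials_def)
    then show ?thesis using 1 by (simp add: in_keys_iff xmon_def lookup_add lookup_single when_def)
  next
    case 6
    then have "i \<notin> keys m" using assms by (auto simp: monomials_def)
    then show ?thesis using 6 by (simp add: in_keys_iff xmon_def lookup_add lookup_single when_def)
  qed simp_all
qed

lemma monomials_lookup_zero: "m \<in> monomials n \<Longrightarrow> lookup m 0 = 0"
  using in_keys_iff[of 0 m] by (force simp: monomials_def)

section \<open>The lexicographically smallest monomials of a degree\<close>

definition low_index :: "nat \<Rightarrow> nat \<Rightarrow> nat \<Rightarrow> nat \<Rightarrow> (nat \<times> nat \<times> nat) set" where
  "low_index e A I l = {(a, i, j). a + i + j \<le> e \<and> (a < A \<or> a = A \<and> (i < I \<or> i = I \<and> j < l))}"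

text \<open>The triple (A, I, l) of exponents of the first three variables marks where the set
  stops; the exponent of the last variable is forced by the degree.\<close>

definition low_mons :: "nat \<Rightarrow> nat \<Rightarrow> nat \<Rightarrow> nat \<Rightarrow> nat \<Rightarrow> mon set" where
  "low_mons b e A I l = (\<lambda>(a, i, j). xmon b a i j (e - a - i - j)) ` low_index e A I l"

text \<open>In a lexicographic lower set the exponents j allowed for given (a, i) form an initial
  segment, and a block records its length. Only the segment of (A, I) may be incomplete, possibly of
  length 0.\<close>

definition blocks :: "nat \<Rightarrow> nat \<Rightarrow> nat \<Rightarrow> nat \<Rightarrow> (nat \<times> nat \<times> nat) list" where
  "blocks e A I l = concat (map (\<lambda>a. map (\<lambda>i. (a, i, e - a - i + 1)) [0..<e - a + 1]) [0..<A]) @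
     map (\<lambda>i. (A, i, e - A - i + 1)) [0..<I] @ [(A, I, l)]"

lemma inj_xmon: "inj_on (\<lambda>(a, i, j). xmon b a i j (e - a - i - j)) X"
proof (rule inj_onI)
  fix x y :: "nat \<times> nat \<times> nat"
  assume eq: "(case x of (a, i, j) \<Rightarrow> xmon b a i j (e - a - i - j)) = (case y of (a, i, j) \<Rightarrow> xmon b a i j (e - a - i - j))"
  obtain a i j where x: "x = (a, i, j)" by (rule prod_cases3)
  obtain a' i' j' where y: "y = (a', i', j')" by (rule prod_cases3)
  have *: "xmon b a i j (e - a - i - j) = xmon b a' i' j' (e - a' - i' - j')" using eq x y by simp
  show "x = y"
    using arg_cong[OF *, of "\<lambda>m. lookup m b"] arg_cong[OF *, of "\<lambda>m. lookup m (b + 1)"]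
      arg_cong[OF *, of "\<lambda>m. lookup m (b + 2)"] x y by simp
qed

lemma low_index_eq:
  assumes "A + I \<le> e" "l \<le> e - A - I + 1"
  shows "low_index e A I l = (SIGMA a:{..<A}. SIGMA i:{..<e - a + 1}. {..<e - a - i + 1}) \<union>
     (SIGMA a:{A}. SIGMA i:{..<I}. {..<e - A - i + 1}) \<union> (SIGMA a:{A}. SIGMA i:{I}. {..<l})"
  using assms unfolding low_index_def by (auto simp: less_Suc_eq_le)

lemma finite_low_index: "finite (low_index e A I l)"
  by (rule finite_subset[of _ "{..e} \<times> {..e} \<times> {..e}"]) (auto simp: low_index_def)

lemma sum_blocks:
  fixes g :: "nat \<Rightarrow> nat \<Rightarrow> nat \<Rightarrow> 'r::comm_monoid_add"
  assumes "A + I \<le> e" "l \<le> e - A - I + 1"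
  shows "(\<Sum>(a, i, j)\<in>low_index e A I l. g a i j) = (\<Sum>(a, i, l)\<leftarrow>blocks e A I l. \<Sum>j<l. g a i j)"
proof -
  have concat: "sum_list (map f (concat xss)) = (\<Sum>xs\<leftarrow>xss. sum_list (map f xs))"
    for f :: "nat \<times> nat \<times> nat \<Rightarrow> 'r" and xss by (induction xss) simp_all
  have "(\<Sum>(a, i, j)\<in>low_index e A I l. g a i j) =
     (\<Sum>a<A. \<Sum>i<e - a + 1. \<Sum>j<e - a - i + 1. g a i j) + (\<Sum>i<I. \<Sum>j<e - A - i + 1. g A i j) + (\<Sum>j<l. g A I j)"
    unfolding low_index_eq[OF assms]
    by (subst sum.union_disjoint, simp, simp, force, subst sum.union_disjoint, simp, simp, force)
       (simp add: sum.Sigma[symmetric])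
  also have "\<dots> = (\<Sum>(a, i, l)\<leftarrow>blocks e A I l. \<Sum>j<l. g a i j)"
    by (simp add: blocks_def concat comp_def interv_sum_list_conv_sum_set_nat atLeast0LessThan add.assoc del: upt_Suc)
  finally show ?thesis .
qed

lemma sum_low_mons:
  assumes "A + I \<le> e" "l \<le> e - A - I + 1"
  shows "(\<Sum>m\<in>low_mons b e A I l. f m) = (\<Sum>(a, i, l)\<leftarrow>blocks e A I l. \<Sum>j<l. f (xmon b a i j (e - a - i - j)))"
  unfolding low_mons_def sum_blocks[OF assms, symmetric] by (subst sum.reindex[OF inj_xmon]) (simp add: split_def)

lemma card_low_mons:
  assumes "A + I \<le> e" "l \<le> e - A - I + 1"
  shows "card (low_mons b e A I l) = (\<Sum>(a, i, l)\<leftarrow>blocks e A I l. l)"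
  using sum_low_mons[OF assms, of "\<lambda>_. 1::nat"] by simp

lemma low_mons_subset:
  assumes "b = 0 \<longrightarrow> A = 0"
  shows "low_mons b e A I l \<subseteq> monomials_deg (b + 3) e"
  using assms by (auto simp: low_mons_def low_index_def monomials_deg_def intro!: xmon_in_monomials)

lemma low_mons_iff:
  assumes "m \<in> monomials_deg (b + 3) e" "b \<le> 1"
  shows "m \<in> low_mons b e A I l \<longleftrightarrow> lookup m b < A \<or> lookup m b = A \<and>
     (lookup m (b + 1) < I \<or> lookup m (b + 1) = I \<and> lookup m (b + 2) < l)"
proof
  assume "m \<in> low_mons b e A I l"
  then show "lookup m b < A \<or> lookup m b = A \<and>
     (lookup m (b + 1) < I \<or> lookup m (b + 1) = I \<and> lookup m (b + 2) < l)"
    by (auto simp: low_mons_def low_index_def)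
next
  assume *: "lookup m b < A \<or> lookup m b = A \<and>
     (lookup m (b + 1) < I \<or> lookup m (b + 1) = I \<and> lookup m (b + 2) < l)"
  have m: "m = xmon b (lookup m b) (lookup m (b + 1)) (lookup m (b + 2)) (lookup m (b + 3))"
    using assms by (intro monomials_eq_xmon) (auto simp: monomials_deg_def)
  have "e = lookup m b + lookup m (b + 1) + lookup m (b + 2) + lookup m (b + 3)"
    using arg_cong[OF m, of mdeg] assms(1) by (simp add: monomials_deg_def)
  then show "m \<in> low_mons b e A I l" unfolding low_mons_def using m *
    by (intro image_eqI[of _ _ "(lookup m b, lookup m (b + 1), lookup m (b + 2))"]) (auto simp: low_index_def)
qed

text \<open>Membership depends on the exponents of the first three variables, compared
  lexicographically, so the first index at which k and m differ decides.\<close>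

lemma low_mons_down:
  assumes m: "m \<in> low_mons b e A I l" and k: "k \<in> monomials_deg (b + 3) e" "k \<le> m"
    and b: "b \<le> 1" "b = 0 \<longrightarrow> A = 0"
  shows "k \<in> low_mons b e A I l"
proof (cases "k = m")
  case False
  with k have "k < m" by simp
  then obtain i where i: "lookup k i < lookup m i" "\<And>i'. i' < i \<Longrightarrow> lookup k i' = lookup m i'"
    by (auto simp: less_poly_mapping.rep_eq less_fun_def)
  have mX: "m \<in> monomials_deg (b + 3) e" using m low_mons_subset[OF b(2)] by blast
  have "i \<in> keys m" using i(1) by (auto simp: in_keys_iff)
  then have "i \<in> {1..b + 3}" using mX by (auto simp: monomials_deg_def monomials_def)
  then consider "i = b" | "i = b + 1" | "i = b + 2" | "i = b + 3" using b(1) by force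
  then show ?thesis
    using i(1) i(2)[of b] i(2)[of "b + 1"] i(2)[of "b + 2"] m
    unfolding low_mons_iff[OF k(1) b(1)] low_mons_iff[OF mX b(1)] by cases auto
qed (use m in simp)

section \<open>Products of linear forms and their standard monomials\<close>

definition degs :: "nat \<Rightarrow> int list list list \<Rightarrow> nat \<Rightarrow> nat" where
  "degs b Ls j = length (Ls ! (j - b))"

definition form :: "nat \<Rightarrow> int list list list \<Rightarrow> nat \<Rightarrow> 'k::field mpol" where
  "form b Ls j = prod_list (map (lin b) (Ls ! (j - b)))"

text \<open>Triangularity: each linear factor of form j has leading variable x_j for the weight, so
  the product has a leading pure power. For b = 0 the coefficient of the illegal x_0 must
  vanish.\<close>

definition forms_ok :: "nat \<Rightarrow> nat \<Rightarrow> nat list \<Rightarrow> int list list list \<Rightarrow> bool" where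
  "forms_ok b s wt Ls \<longleftrightarrow> list_all (\<lambda>j. list_all (\<lambda>c. c ! (j - b) = 1 \<and> (b = 0 \<longrightarrow> c ! 0 = 0) \<and>
     list_all (\<lambda>r. c ! r \<noteq> 0 \<longrightarrow> r = j - b \<or> wt ! r < wt ! (j - b)) [0..<4]) (Ls ! (j - b))) [1..<Suc s]"

lemma forms_okD:
  assumes "forms_ok b s wt Ls" "b \<le> 1" "s \<le> b + 3" "j \<in> {1..s}"
  shows "(form b Ls j :: 'k::field mpol) \<in> polys_deg (b + 3) (degs b Ls j)"
    and "lead_power (\<lambda>i. wt ! (i - b)) j (degs b Ls j) (form b Ls j :: 'k mpol)"
proof -
  have c: "c ! (j - b) = 1" "b = 0 \<longrightarrow> c ! 0 = 0"
    "\<And>r. r < 4 \<Longrightarrow> c ! r \<noteq> 0 \<Longrightarrow> r = j - b \<or> wt ! r < wt ! (j - b)" if "c \<in> set (Ls ! (j - b))" for c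
  proof -
    have j: "j \<in> set [1..<Suc s]" using assms(4) by (simp del: upt_Suc)
    have "c ! (j - b) = 1 \<and> (b = 0 \<longrightarrow> c ! 0 = 0) \<and>
        (\<forall>r\<in>set [0..<4]. c ! r \<noteq> 0 \<longrightarrow> r = j - b \<or> wt ! r < wt ! (j - b))"
      using assms(1) j that unfolding forms_ok_def list_all_iff by blast
    then show "c ! (j - b) = 1" "b = 0 \<longrightarrow> c ! 0 = 0"
      "\<And>r. r < 4 \<Longrightarrow> c ! r \<noteq> 0 \<Longrightarrow> r = j - b \<or> wt ! r < wt ! (j - b)"
      by (simp_all del: upt_Suc)
  qed
  show "(form b Ls j :: 'k mpol) \<in> polys_deg (b + 3) (degs b Ls j)"
    unfolding form_def degs_def by (rule prod_list_polys_deg) (use c lin_polys_deg in blast)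
  have j: "j - b < 4" "b + (j - b) = j" using assms by auto
  show "lead_power (\<lambda>i. wt ! (i - b)) j (degs b Ls j) (form b Ls j :: 'k mpol)"
    unfolding form_def degs_def
  proof (rule lead_power_prod_list)
    fix c assume "c \<in> set (Ls ! (j - b))"
    from c[OF this] lead_power_lin[OF j(1), of c "\<lambda>i. wt ! (i - b)" b, where 'k = 'k]
    show "lead_power (\<lambda>i. wt ! (i - b)) j 1 (lin b c :: 'k mpol)" unfolding j(2) by simp
  qed
qed

text \<open>For b = 0 the first exponent belongs to x_0 and has to be 0; \<open>Ls ! 0\<close> is
  then an empty placeholder, whose length would give an empty product.\<close>

definition box :: "nat \<Rightarrow> int list list list \<Rightarrow> (nat \<times> nat \<times> nat) list" where
  "box b Ls = List.product [0..<(if b = 0 then 1 else length (Ls ! 0))]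
     (List.product [0..<length (Ls ! 1)] [0..<length (Ls ! 2)])"

text \<open>The number of monomials of degree e outside the ideal of the pure powers. For s = n - 1
  the last variable is free and absorbs the missing degree; for s = n its exponent is bounded
  too.\<close>

definition std_count :: "nat \<Rightarrow> nat \<Rightarrow> int list list list \<Rightarrow> nat \<Rightarrow> nat" where
  "std_count b s Ls e = length (filter (\<lambda>(a, i, j). a + i + j \<le> e \<and> (s = b + 3 \<longrightarrow> e - a - i - j < length (Ls ! 3)))
     (box b Ls))"

lemma std_count:
  assumes "b \<le> 1" "s = b + 2 \<or> s = 3 \<and> b = 0"
  shows "ci_count (b + 3) s (degs b Ls) e + std_count b s Ls e = card (monomials_deg (b + 3) e)"
proof -
  let ?X = "monomials_deg (b + 3) e"
  let ?S = "{m \<in> ?X. \<forall>j\<in>{1..s}. lookup m j < degs b Ls j}"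
  let ?I = "{(a, i, j). a < (if b = 0 then 1 else length (Ls ! 0)) \<and> i < length (Ls ! 1) \<and> j < length (Ls ! 2) \<and>
     a + i + j \<le> e \<and> (s = b + 3 \<longrightarrow> e - a - i - j < length (Ls ! 3))}"
  have "{m \<in> ?X. \<exists>j\<in>{1..s}. degs b Ls j \<le> lookup m j} = ?X - ?S" by (auto simp: not_less)
  then have "ci_count (b + 3) s (degs b Ls) e = card ?X - card ?S"
    unfolding ci_count_def by (simp add: card_Diff_subset)
  moreover have "card ?S \<le> card ?X" by (rule card_mono) auto
  moreover have "card ?S = std_count b s Ls e"
  proof -
    have s: "(\<forall>j\<in>{1..s}. lookup m j < degs b Ls j) \<longleftrightarrow> lookup m b < (if b = 0 then 1 else length (Ls ! 0)) \<and>
       lookup m (b + 1) < length (Ls ! 1) \<and> lookup m (b + 2) < length (Ls ! 2) \<and>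
       (s = b + 3 \<longrightarrow> lookup m (b + 3) < length (Ls ! 3))" if "m \<in> ?X" for m
    proof -
      consider "b = 0" "s = 2" | "b = 0" "s = 3" | "b = 1" "s = 3" using assms by fastforce
      then show ?thesis
      proof cases
        case 1
        have "{1..s} = {1, 2}" using 1 by auto
        moreover have "lookup m 0 = 0" using that by (intro monomials_lookup_zero) (auto simp: monomials_deg_def)
        ultimately show ?thesis using 1 by (simp add: degs_def numeral_2_eq_2)
      next
        case 2
        have "{1..s} = {1, 2, 3}" using 2 by auto
        moreover have "lookup m 0 = 0" using that by (intro monomials_lookup_zero) (auto simp: monomials_deg_def)
        ultimately show ?thesis using 2 by (simp add: degs_def numeral_2_eq_2 numeral_3_eq_3)
      next
        case 3
        have "{1..s} = {1, 2, 3}" using 3 by auto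
        then show ?thesis using 3 by (simp add: degs_def numeral_2_eq_2 numeral_3_eq_3)
      qed
    qed
    have "?S = (\<lambda>(a, i, j). xmon b a i j (e - a - i - j)) ` ?I"
    proof (intro equalityI subsetI)
      fix m assume m: "m \<in> ?S"
      then have mm: "m = xmon b (lookup m b) (lookup m (b + 1)) (lookup m (b + 2)) (lookup m (b + 3))"
        using assms by (intro monomials_eq_xmon) (auto simp: monomials_deg_def)
      have "e = lookup m b + lookup m (b + 1) + lookup m (b + 2) + lookup m (b + 3)"
        using arg_cong[OF mm, of mdeg] m by (simp add: monomials_deg_def)
      then show "m \<in> (\<lambda>(a, i, j). xmon b a i j (e - a - i - j)) ` ?I"
        using m mm s[of m] by (intro image_eqI[of _ _ "(lookup m b, lookup m (b + 1), lookup m (b + 2))"]) auto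
    next
      fix m assume "m \<in> (\<lambda>(a, i, j). xmon b a i j (e - a - i - j)) ` ?I"
      then obtain a i j where aij: "(a, i, j) \<in> ?I" "m = xmon b a i j (e - a - i - j)" by auto
      then have "m \<in> ?X" using xmon_in_monomials[of b a i j] by (auto simp: monomials_deg_def split: if_splits)
      then show "m \<in> ?S" using s[of m] aij by auto
    qed
    then have "card ?S = card ?I" using card_image[OF inj_xmon] by (simp only:)
    also have "?I = set (filter (\<lambda>(a, i, j). a + i + j \<le> e \<and> (s = b + 3 \<longrightarrow> e - a - i - j < length (Ls ! 3)))
     (box b Ls))"
      by (auto simp: box_def)
    also have "card \<dots> = std_count b s Ls e"
      unfolding std_count_def by (rule distinct_card) (simp add: distinct_product box_def)
    finally show ?thesis .
  qed
  ultimately show ?thesis by simp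
qed

text \<open>Triangularity and counting settle everything except independence modulo the ideal. That
  remaining premise is where points or substitutions enter.\<close>

lemma lex_witness_low_mons:
  assumes "forms_ok b s wt Ls" "b \<le> 1" "s = b + 2 \<or> s = 3 \<and> b = 0" "b = 0 \<longrightarrow> A = 0"
    and "A + I \<le> e" "l \<le> e - A - I + 1" "(\<Sum>(a, i, l)\<leftarrow>blocks e A I l. l) = std_count b s Ls e"
    and "\<And>p. p \<in> gen_piece (b + 3) {1..s} (degs b Ls) (form b Ls :: nat \<Rightarrow> 'k::field mpol) e \<Longrightarrow>
      keys p \<subseteq> low_mons b e A I l \<Longrightarrow> p = 0"
  shows "lex_witness (b + 3) s (degs b Ls) e (low_mons b e A I l) (form b Ls :: nat \<Rightarrow> 'k mpol)"
  unfolding lex_witness_def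
proof (intro conjI ballI impI)
  have s: "s \<le> b + 3" using assms(3) by auto
  show "low_mons b e A I l \<subseteq> monomials_deg (b + 3) e" by (rule low_mons_subset[OF assms(4)])
  show "k \<in> low_mons b e A I l" if "m \<in> low_mons b e A I l" "k \<in> monomials_deg (b + 3) e" "k \<le> m" for m k
    using low_mons_down[OF that assms(2,4)] .
  show "card (low_mons b e A I l) + ci_count (b + 3) s (degs b Ls) e = card (monomials_deg (b + 3) e)"
    using std_count[OF assms(2,3), of Ls e] unfolding card_low_mons[OF assms(5,6)] assms(7) by simp
  show "(form b Ls j :: 'k mpol) \<in> polys_deg (b + 3) (degs b Ls j)" if "j \<in> {1..s}" for j
    using forms_okD(1)[OF assms(1,2) s that] .
  show "ci_count (b + 3) s (degs b Ls) e \<le> mpol.dim (gen_piece (b + 3) {1..s} (degs b Ls) (form b Ls :: nat \<Rightarrow> 'k mpol) e)"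
    using forms_okD(2)[OF assms(1,2) s] s by (rule ci_count_le_dim)
qed (rule assms(8))

context poly_evaluation begin

lemma peval_pscale: "peval (pscale c p) = C c * peval p"
  by (simp add: pscale_def peval_single_mult mon_eval_def)

lemma peval_lin: "peval (lin b c) = (\<Sum>q<4. of_int (c ! q) * v (b + q))"
  by (simp add: lin_def peval_sum peval_single C_of_int)

lemma peval_lin_expand: "peval (lin b c) =
    of_int (c ! 0) * v b + of_int (c ! 1) * v (b + 1) + of_int (c ! 2) * v (b + 2) + of_int (c ! 3) * v (b + 3)"
proof -
  have "{..<4} = {0, 1, 2, 3::nat}" by auto
  then show ?thesis by (simp add: peval_lin add.assoc)
qed

lemma mon_eval_xmon: "mon_eval (xmon b a i j k) = v b ^ a * v (b + 1) ^ i * v (b + 2) ^ j * v (b + 3) ^ k"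
  by (simp add: xmon_def mon_eval_add)

end

lemma low_index_blocks:
  assumes "(a, i, j) \<in> low_index e A I l"
  shows "\<exists>l'. (a, i, l') \<in> set (blocks e A I l) \<and> j < l'"
proof -
  consider "a < A" | "a = A" "i < I" | "a = A" "i = I" using assms by (auto simp: low_index_def)
  then show ?thesis
  proof cases
    case 1
    then have "(a, i, e - a - i + 1) \<in> set (blocks e A I l)"
      using assms by (auto simp: blocks_def low_index_def image_iff simp del: upt_Suc)
    then show ?thesis using assms by (intro exI[of _ "e - a - i + 1"]) (auto simp: low_index_def)
  next
    case 2
    then have "(a, i, e - a - i + 1) \<in> set (blocks e A I l)" by (auto simp: blocks_def)
    then show ?thesis using assms by (intro exI[of _ "e - a - i + 1"]) (auto simp: low_index_def)
  next
    case 3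
    then show ?thesis using assms by (auto simp: blocks_def low_index_def)
  qed
qed

lemma zero_if_block_coefficients_zero:
  fixes f :: "'k::field mpol"
  assumes "keys f \<subseteq> low_mons b e A I l"
    and "\<And>a i j l'. (a, i, l') \<in> set (blocks e A I l) \<Longrightarrow> j < l' \<Longrightarrow> lookup f (xmon b a i j (e - a - i - j)) = 0"
  shows "f = 0"
proof (rule poly_mapping_eqI, rule ccontr)
  fix m assume m: "lookup f m \<noteq> lookup 0 m"
  then have "m \<in> low_mons b e A I l" using assms(1) by (auto simp: in_keys_iff)
  then obtain a i j where aij: "(a, i, j) \<in> low_index e A I l" "m = xmon b a i j (e - a - i - j)"
    by (auto simp: low_mons_def)
  with low_index_blocks[OF aij(1)] assms(2) m show False by auto
qed

section \<open>Certificates from points\<close>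

definition vanish_ok :: "nat \<Rightarrow> nat \<Rightarrow> (int \<times> int) list \<Rightarrow> int list list list \<Rightarrow> bool" where
  "vanish_ok b s pts Ls \<longleftrightarrow> list_all (\<lambda>(t, w, x). list_all (\<lambda>j. list_ex (\<lambda>c.
     c ! 0 * w + c ! 1 * x + c ! 2 * int t + c ! 3 = 0) (Ls ! (j - b))) [1..<Suc s])
     (zip [0..<length pts] pts)"

text \<open>Moments do not depend on e, so one set of tables serves all degrees;
  \<open>ns ! a\<close> is the number of exponents i that occur together with w^a.\<close>

definition tables :: "int \<Rightarrow> (int \<times> int) list \<Rightarrow> nat list \<Rightarrow> int list list list" where
  "tables p pts ns = map (\<lambda>(a, n). map (moment_table p pts a) [0..<n]) (zip [0..<length ns] ns)"

text \<open>The first block must be that of the pure powers of y, which the differences remove. No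
  other block may be longer, so that every shifted slice stays inside its table.\<close>

definition level_ok :: "int \<Rightarrow> int list list list \<Rightarrow> nat \<Rightarrow> nat list \<Rightarrow> nat \<times> nat \<times> nat \<times> nat \<Rightarrow> bool" where
  "level_ok p T D ns = (\<lambda>(e, A, I, l). A + I \<le> e \<and> l \<le> e - A - I + 1 \<and>
     (case blocks e A I l of [] \<Rightarrow> False | (a0, i0, l0) # bl \<Rightarrow> a0 = 0 \<and> i0 = 0 \<and> l0 \<le> D \<and>
        list_all (\<lambda>(a, i, l). l \<le> l0 \<and> a < length ns \<and> i < ns ! a) bl \<and>
        full_rank p (\<Sum>(a, i, l)\<leftarrow>bl. l) (hankel (D - l0) (map (\<lambda>(a, i, l). (T ! a ! i, l)) bl))))"

text \<open>Every form has a factor vanishing at each point, so the whole ideal vanishes there. An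
  element of the ideal supported on the low monomials is then a relation of the kind excluded by
  \<open>points_independent\<close>.\<close>

lemma points_witness:
  fixes pts :: "(int \<times> int) list"
  assumes ok: "forms_ok b s wt Ls" "b \<le> 1" "s = b + 2" "b = 0 \<longrightarrow> A = 0"
    and van: "vanish_ok b s pts Ls" "pts \<noteq> []"
    and level: "level_ok p (tables p pts ns) (length pts) ns (e, A, I, l)"
    and count: "(\<Sum>(a, i, l)\<leftarrow>blocks e A I l. l) = std_count b s Ls e"
  shows "lex_witness (b + 3) s (degs b Ls) e (low_mons b e A I l) (form b Ls :: nat \<Rightarrow> 'k::field_char_0 mpol)"
proof -
  let ?D = "length pts" and ?n = "b + 3"
  have AI: "A + I \<le> e" "l \<le> e - A - I + 1" using level by (auto simp: level_ok_def)
  from level obtain l0 bl where bl: "blocks e A I l = (0, 0, l0) # bl" "l0 \<le> ?D"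
    "\<forall>(a, i, l)\<in>set bl. l \<le> l0 \<and> a < length ns \<and> i < ns ! a"
    and rank: "full_rank p (\<Sum>(a, i, l)\<leftarrow>bl. l) (hankel (?D - l0) (map (\<lambda>(a, i, l). (tables p pts ns ! a ! i, l)) bl))"
    by (force simp: level_ok_def list_all_iff split: list.splits)
  have tab: "map (\<lambda>(a, i, l). (tables p pts ns ! a ! i, l)) bl = map (\<lambda>(a, i, l). (moment_table p pts a i, l)) bl"
    using bl(3) by (auto simp: tables_def)
  have "(\<Sum>(a, i, l)\<leftarrow>bl. l) = (\<Sum>b\<leftarrow>bl. snd (snd b))" by (simp add: split_def)
  then have rank': "full_rank p (\<Sum>b\<leftarrow>bl. snd (snd b)) (hankel (?D - l0) (map (\<lambda>(a, i, l). (moment_table p pts a i, l)) bl))"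
    using rank tab by (simp only:)
  show ?thesis
  proof (rule lex_witness_low_mons[OF ok(1,2) _ ok(4) AI count])
    fix f :: "'k mpol"
    assume f: "f \<in> gen_piece ?n {1..s} (degs b Ls) (form b Ls) e" "keys f \<subseteq> low_mons b e A I l"
    define c where "c a i j = lookup f (xmon b a i j (e - a - i - j))" for a i j
    have "(\<Sum>j<l0. c 0 0 j * of_nat t ^ j) +
      (\<Sum>(a, i, l)\<leftarrow>bl. \<Sum>j<l. c a i j * of_int (fst (pts ! t) ^ a * snd (pts ! t) ^ i * int t ^ j)) = 0"
      if t: "t < ?D" for t
    proof -
      \<comment> \<open>The last coordinate 1 dehomogenizes: the exponent of the last variable
        disappears from the relation.\<close>
      define v where "v i = (of_int ([fst (pts ! t), snd (pts ! t), int t, 1] ! (i - b)) :: 'k)" for i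
      have v: "v b = of_int (fst (pts ! t))" "v (b + 1) = of_int (snd (pts ! t))" "v (b + 2) = of_nat t" "v (b + 3) = 1"
        by (simp_all add: v_def)
      interpret poly_evaluation "\<lambda>x::'k. x" v by unfold_locales simp_all
      have form0: "peval (form b Ls j) = 0" if j: "j \<in> {1..s}" for j
      proof -
        have "(t, pts ! t) \<in> set (zip [0..<?D] pts)" using t by (auto simp: in_set_zip intro!: exI[of _ t])
        then obtain c where c: "c \<in> set (Ls ! (j - b))"
          "c ! 0 * fst (pts ! t) + c ! 1 * snd (pts ! t) + c ! 2 * int t + c ! 3 = 0"
          using van(1) j unfolding vanish_ok_def list_all_iff list_ex_iff
          by (fastforce simp del: upt_Suc)
        have "peval (lin b c) = (of_int (c ! 0 * fst (pts ! t) + c ! 1 * snd (pts ! t) + c ! 2 * int t + c ! 3) :: 'k)"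
          unfolding peval_lin_expand v by simp
        then have "peval (lin b c) = 0" by (simp only: c(2) of_int_0)
        then have "0 \<in> set (map peval (map (lin b) (Ls ! (j - b))))" using c(1) by force
        then show ?thesis unfolding form_def peval_prod_list by (simp add: prod_list_zero_iff)
      qed
      have ev0: "peval f = 0"
        by (rule gen_piece_peval[OF f(1), where Q = "\<lambda>x. x = 0"])
           (auto simp: form0 peval_add peval_pscale intro!: mpol.subspaceI)
      have ev1: "peval f = (\<Sum>m\<in>low_mons b e A I l. lookup f m * mon_eval m)"
        using f(2) by (intro peval_superset) (auto simp: low_mons_def finite_low_index)
      have ev2: "lookup f (xmon b a i j (e - a - i - j)) * mon_eval (xmon b a i j (e - a - i - j)) =
         c a i j * of_int (fst (pts ! t) ^ a * snd (pts ! t) ^ i * int t ^ j)" for a i j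
        unfolding mon_eval_xmon v by (simp add: c_def)
      have "(\<Sum>(a, i, l)\<leftarrow>blocks e A I l. \<Sum>j<l. c a i j * of_int (fst (pts ! t) ^ a * snd (pts ! t) ^ i * int t ^ j)) = 0"
        using ev0 unfolding ev1 sum_low_mons[OF AI] ev2 .
      then show ?thesis unfolding bl(1) by simp
    qed
    from points_independent[OF refl van(2) bl(2) rank' _ this]
    have "(\<forall>j<l0. c 0 0 j = 0) \<and> (\<forall>(a, i, l)\<in>set bl. \<forall>j<l. c a i j = 0)"
      using bl(3) by fastforce
    then have c0: "\<forall>(a, i, l)\<in>set (blocks e A I l). \<forall>j<l. c a i j = 0" unfolding bl(1) by auto
    show "f = 0"
      by (rule zero_if_block_coefficients_zero[OF f(2)]) (use c0 in \<open>force simp: c_def\<close>)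
  qed (use ok in auto)
qed

section \<open>Certificates from powers of linear forms\<close>

fun lin_prod_coeff :: "int list list \<Rightarrow> nat \<Rightarrow> nat \<Rightarrow> nat \<Rightarrow> int" where
  "lin_prod_coeff [] x y z = (if x = 0 \<and> y = 0 \<and> z = 0 then 1 else 0)"
| "lin_prod_coeff (c # cs) x y z =
     (if x = 0 \<or> c ! 1 = 0 then 0 else c ! 1 * lin_prod_coeff cs (x - 1) y z) +
     (if y = 0 \<or> c ! 2 = 0 then 0 else c ! 2 * lin_prod_coeff cs x (y - 1) z) +
     (if z = 0 \<or> c ! 3 = 0 then 0 else c ! 3 * lin_prod_coeff cs x y (z - 1))"

lemma lookup_var_mult:
  "lookup (single (single q 1) k * (P :: 'k::field mpol)) m =
     (if lookup m q = 0 then 0 else k * lookup P (m - single q 1))"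
proof (cases "lookup m q = 0")
  case True
  have "m \<notin> keys (single (single q 1) k * P)"
  proof
    assume "m \<in> keys (single (single q 1) k * P)"
    then obtain l where "m = single q 1 + l" using keys_single_mult by blast
    with True show False by (simp add: lookup_add)
  qed
  with True show ?thesis by (simp add: in_keys_iff)
next
  case False
  then have "single q 1 + (m - single q 1) = m"
    by (intro poly_mapping_eqI) (auto simp: lookup_add lookup_minus lookup_single when_def)
  with False lookup_single_mult[of "single q 1" k P "m - single q 1"] show ?thesis by simp
qed

lemma xmon_minus_single:
  "xmon 0 0 x y z - single 1 1 = xmon 0 0 (x - 1) y z" "xmon 0 0 x y z - single 2 1 = xmon 0 0 x (y - 1) z"
  "xmon 0 0 x y z - single 3 1 = xmon 0 0 x y (z - 1)"
  by (rule poly_mapping_eqI, auto simp: xmon_def lookup_add lookup_minus lookup_single when_def)+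

lemma lookup_xmon_base_zero:
  "lookup (xmon 0 0 x y z) 1 = x" "lookup (xmon 0 0 x y z) 2 = y" "lookup (xmon 0 0 x y z) 3 = z"
  by (simp_all add: xmon_def lookup_add lookup_single when_def)

lemma lookup_prod_lin:
  assumes "\<forall>c\<in>set cs. c ! 0 = 0"
  shows "lookup (prod_list (map (lin 0) cs) :: 'k::field mpol) (xmon 0 0 x y z) = of_int (lin_prod_coeff cs x y z)"
  using assms
proof (induction cs arbitrary: x y z)
  case Nil
  have "xmon 0 0 x y z = 0 \<longleftrightarrow> x = 0 \<and> y = 0 \<and> z = 0"
    using lookup_xmon_base_zero[of x y z] by (metis add_0 lookup_zero single_zero xmon_def)
  then show ?case by (simp add: lookup_one when_def)
next
  case (Cons c cs)
  let ?P = "prod_list (map (lin 0) cs) :: 'k mpol"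
  have "{..<4} = {0, 1, 2, 3::nat}" by auto
  then have lin: "(lin 0 c :: 'k mpol) =
      single (single 1 1) (of_int (c ! 1)) + single (single 2 1) (of_int (c ! 2)) + single (single 3 1) (of_int (c ! 3))"
    using Cons.prems by (simp add: lin_def add.assoc)
  have "lookup (prod_list (map (lin 0) (c # cs)) :: 'k mpol) (xmon 0 0 x y z) =
    lookup (single (single 1 1) (of_int (c ! 1)) * ?P) (xmon 0 0 x y z) +
    lookup (single (single 2 1) (of_int (c ! 2)) * ?P) (xmon 0 0 x y z) +
    lookup (single (single 3 1) (of_int (c ! 3)) * ?P) (xmon 0 0 x y z)"
    by (simp only: list.map prod_list.Cons lin distrib_right lookup_add)
  also have "\<dots> = of_int (lin_prod_coeff (c # cs) x y z)"
    unfolding lookup_var_mult xmon_minus_single lookup_xmon_base_zero using Cons.IH Cons.prems by simp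
  finally show ?case .
qed

lemma single_var_power: "single (single q 1) (1::'k::field) ^ k = single (single q k :: mon) 1"
  by (induction k) (simp_all add: mult_single flip: single_add)

text \<open>The coefficient vector of a substituted linear form is the product of c with the matrix
  S, which reduces the substitution to integer arithmetic.\<close>

lemma sum_mult_lin:
  "(\<Sum>q<4. of_int (c ! q) * (lin 0 (S ! q) :: 'k::field mpol)) =
     (\<Sum>r<4. single (single r 1) (of_int (\<Sum>q<4. c ! q * S ! q ! r)))"
proof -
  have single_sum: "(\<Sum>q<4. single m (of_int (f q))) = single m (of_int (\<Sum>q<4. f q) :: 'k)" for m :: mon and f :: "nat \<Rightarrow> int"
    by (rule poly_mapping_eqI) (simp add: lookup_sum lookup_single when_def)
  have "of_int z * single m a = single m (of_int z * a)" for z and m :: mon and a :: 'k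
    using mult_single[of 0 "of_int z" m a] by (simp flip: single_of_int)
  then have "(\<Sum>q<4. of_int (c ! q) * (lin 0 (S ! q) :: 'k mpol)) =
     (\<Sum>q<4. \<Sum>r<4. single (single r 1) (of_int (c ! q * S ! q ! r)))"
    by (simp add: lin_def sum_distrib_left)
  also have "\<dots> = (\<Sum>r<4. \<Sum>q<4. single (single r 1) (of_int (c ! q * S ! q ! r)))"
    by (rule sum.swap)
  also have "\<dots> = (\<Sum>r<4. single (single r 1) (of_int (\<Sum>q<4. c ! q * S ! q ! r)))"
    by (simp only: single_sum)
  finally show ?thesis .
qed

text \<open>The rows of \<open>S\<close> are the images of the variables under a linear substitution that turns the linear
  forms of \<open>Ls\<close> into variables, so that the ideal becomes \<open>(x\<^sub>1^d\<^sub>1, x\<^sub>2^d\<^sub>2, x\<^sub>3^d\<^sub>3)\<close>.\<close>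

definition subst_ok :: "int list list list \<Rightarrow> int list list \<Rightarrow> bool" where
  "subst_ok Ls S \<longleftrightarrow> list_all (\<lambda>c. c ! 0 = 0) [S ! 1, S ! 2, S ! 3] \<and>
     list_all (\<lambda>j. list_all (\<lambda>c. list_all (\<lambda>r. (\<Sum>q\<leftarrow>[0..<4]. c ! q * S ! q ! r) = (if r = j then 1 else 0)) [0..<4])
       (Ls ! j)) [1, 2, 3]"

text \<open>The coefficients of the monomial with exponents (x, y, z) in the images, under the
  substitution, of the low monomials.\<close>

definition artin_row :: "int list list \<Rightarrow> nat \<Rightarrow> (nat \<times> nat \<times> nat) list \<Rightarrow> nat \<times> nat \<times> nat \<Rightarrow> int list" where
  "artin_row S e bl = (\<lambda>(x, y, z). concat (map (\<lambda>(a, i, l). map (\<lambda>j.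
     lin_prod_coeff (replicate i (S ! 1) @ replicate j (S ! 2) @ replicate (e - a - i - j) (S ! 3)) x y z) [0..<l]) bl))"

text \<open>The rows are indexed by the monomials with all exponents below the degrees, a basis in
  degree e of the quotient by the pure powers.\<close>

definition artin_ok :: "int \<Rightarrow> int list list list \<Rightarrow> int list list \<Rightarrow> nat \<times> nat \<times> nat \<Rightarrow> bool" where
  "artin_ok p Ls S = (\<lambda>(e, I, l). I \<le> e \<and> l \<le> e - I + 1 \<and>
     full_rank p (\<Sum>(a, i, l)\<leftarrow>blocks e 0 I l. l)
       (map (map (\<lambda>t. t mod p)) (map (artin_row S e (blocks e 0 I l))
          (filter (\<lambda>(x, y, z). x + y + z = e)
             (List.product [0..<length (Ls ! 1)] (List.product [0..<length (Ls ! 2)] [0..<length (Ls ! 3)]))))))"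

text \<open>The substitution carries the ideal into that of the pure powers, whose elements have no
  monomial with all exponents below the degrees. The coefficients of an element supported on the low
  monomials are thus annihilated by every row.\<close>

lemma artin_witness:
  assumes ok: "forms_ok 0 3 wt Ls" and sub: "subst_ok Ls S" and rank: "artin_ok p Ls S (e, I, l)"
    and count: "(\<Sum>(a, i, l)\<leftarrow>blocks e 0 I l. l) = std_count 0 3 Ls e"
  shows "lex_witness 3 3 (degs 0 Ls) e (low_mons 0 e 0 I l) (form 0 Ls :: nat \<Rightarrow> 'k::field_char_0 mpol)"
proof -
  let ?bl = "blocks e 0 I l"
  have Il: "0 + I \<le> e" "l \<le> e - 0 - I + 1" using rank by (auto simp: artin_ok_def)
  have bl0: "a = 0" if "(a, i, l') \<in> set ?bl" for a i l'
    using that by (auto simp: blocks_def)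
  define v where "v i = (lin 0 (S ! i) :: 'k mpol)" for i
  interpret poly_evaluation "single 0 :: 'k \<Rightarrow> 'k mpol" v
    by unfold_locales (simp_all add: single_add mult_single)
  have S0: "(S ! 1) ! 0 = 0" "(S ! 2) ! 0 = 0" "(S ! 3) ! 0 = 0"
    using sub by (simp_all add: subst_ok_def)
  have lin: "peval (lin 0 c) = single (single j 1) 1" if j: "j \<in> {1..3}" and c: "c \<in> set (Ls ! j)" for j c
  proof -
    have "j \<in> set [1, 2, 3]" using j by auto
    moreover have "r \<in> set [0..<4]" if "r < 4" for r using that by simp
    ultimately have "(\<Sum>q\<leftarrow>[0..<4]. c ! q * S ! q ! r) = (if r = j then 1 else 0)" if "r < 4" for r
      using sub c that unfolding subst_ok_def list_all_iff by blast
    then have "(\<Sum>q<4. c ! q * S ! q ! r) = (if r = j then 1 else 0)" if "r < 4" for r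
      using that by (simp only: interv_sum_list_conv_sum_set_nat set_upt atLeast0LessThan)
    then have "peval (lin 0 c) = (\<Sum>r<4. single (single r 1) (of_int (if r = j then 1 else 0)))"
      by (simp add: peval_lin v_def sum_mult_lin)
    also have "\<dots> = (\<Sum>r\<in>{j}. single (single r 1) 1)"
      by (rule sum.mono_neutral_cong_right) (use j in auto)
    finally show ?thesis by simp
  qed
  have form: "peval (form 0 Ls j) = single (single j (degs 0 Ls j)) 1" if j: "j \<in> {1..3}" for j
  proof -
    have "map peval (map (lin 0) (Ls ! j)) = replicate (length (Ls ! j)) (single (single j 1) 1)"
      using lin[OF j] by (intro replicate_eqI) auto
    then show ?thesis
      unfolding form_def peval_prod_list degs_def minus_nat.diff_0 by (simp add: single_var_power[unfolded One_nat_def])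
  qed
  have "lex_witness (0 + 3) 3 (degs 0 Ls) e (low_mons 0 e 0 I l) (form 0 Ls :: nat \<Rightarrow> 'k mpol)"
  proof (rule lex_witness_low_mons[OF ok _ _ _ Il count])
    fix f :: "'k mpol"
    assume f: "f \<in> gen_piece (0 + 3) {1..3} (degs 0 Ls) (form 0 Ls) e" "keys f \<subseteq> low_mons 0 e 0 I l"
    define c where "c b j = lookup f (xmon 0 (fst b) (fst (snd b)) j (e - fst b - fst (snd b) - j))" for b :: "nat \<times> nat \<times> nat" and j
    define len where "len b = snd (snd b)" for b :: "nat \<times> nat \<times> nat"
    define C where "C = concat (map (\<lambda>b. map (c b) [0..<len b]) ?bl)"
    define alphas where "alphas = filter (\<lambda>(x, y, z). x + y + z = e)
      (List.product [0..<length (Ls ! 1)] (List.product [0..<length (Ls ! 2)] [0..<length (Ls ! 3)]))"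
    have "\<forall>x\<in>set C. x = 0"
    proof (rule full_rank_sound)
      show "full_rank p (\<Sum>(a, i, l)\<leftarrow>?bl. l) (map (map (\<lambda>t. t mod p)) (map (artin_row S e ?bl) alphas))"
        using rank by (simp add: artin_ok_def alphas_def)
      show "length C = (\<Sum>(a, i, l)\<leftarrow>?bl. l)"
        by (simp add: C_def length_concat comp_def len_def split_def)
    next
      fix r assume "r \<in> set (map (artin_row S e ?bl) alphas)"
      then obtain x y z where r: "r = artin_row S e ?bl (x, y, z)" "x < length (Ls ! 1)" "y < length (Ls ! 2)" "z < length (Ls ! 3)"
        by (auto simp: alphas_def)
      let ?\<alpha> = "xmon 0 0 x y z"
      define k where "k b j = lin_prod_coeff (replicate (fst (snd b)) (S ! 1) @ replicate j (S ! 2) @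
         replicate (e - fst b - fst (snd b) - j) (S ! 3)) x y z" for b :: "nat \<times> nat \<times> nat" and j
      have row: "r = concat (map (\<lambda>b. map (k b) [0..<len b]) ?bl)"
        unfolding r(1) artin_row_def k_def len_def by (simp add: split_def)
      have small: "lookup ?\<alpha> j < degs 0 Ls j" if j: "j \<in> {1..3}" for j
      proof -
        consider "j = 1" | "j = 2" | "j = 3" using j by force
        then show ?thesis using r by cases (auto simp: degs_def lookup_xmon_base_zero lookup_xmon_base_zero(1)[unfolded One_nat_def])
      qed
      have ev0: "lookup (peval f) ?\<alpha> = 0"
      proof (rule gen_piece_peval[OF f(1), where Q = "\<lambda>q. lookup q ?\<alpha> = 0"])
        show "mpol.subspace {p. lookup (peval p) ?\<alpha> = 0}"
          by (rule mpol.subspaceI) (auto simp: peval_add lookup_add peval_pscale simp flip: pscale_def)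
        fix m j assume j: "j \<in> {1..3::nat}"
        have "?\<alpha> \<notin> keys (single (single j (degs 0 Ls j)) 1 * mon_eval m)"
        proof
          assume "?\<alpha> \<in> keys (single (single j (degs 0 Ls j)) 1 * mon_eval m)"
          then obtain l where "?\<alpha> = single j (degs 0 Ls j) + l" using keys_single_mult by blast
          then have "degs 0 Ls j \<le> lookup ?\<alpha> j" by (simp add: lookup_add)
          with small[OF j] show False by simp
        qed
        then show "lookup (mon_eval m * peval (form 0 Ls j)) ?\<alpha> = 0"
          unfolding form[OF j] by (simp add: in_keys_iff mult.commute)
      qed
      have ev1: "peval f = (\<Sum>m\<in>low_mons 0 e 0 I l. single 0 (lookup f m) * mon_eval m)"
        using f(2) by (intro peval_superset) (auto simp: low_mons_def finite_low_index)
      have ev2: "lookup (single 0 (lookup f (xmon 0 a i j (e - a - i - j))) * mon_eval (xmon 0 a i j (e - a - i - j))) ?\<alpha> =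
          of_int (k (a, i, l') j) * c (a, i, l') j" if "a = 0" for a i j l'
      proof -
        have "mon_eval (xmon 0 a i j (e - a - i - j)) = prod_list (map (lin 0)
            (replicate i (S ! 1) @ replicate j (S ! 2) @ replicate (e - a - i - j) (S ! 3)))"
          unfolding mon_eval_xmon that v_def by (simp add: algebra_simps numeral_2_eq_2)
        also have "lookup \<dots> ?\<alpha> = of_int (k (a, i, l') j)"
          unfolding k_def by (subst lookup_prod_lin) (use S0 in auto)
        finally show ?thesis by (simp add: c_def flip: pscale_def)
      qed
      have "0 = (\<Sum>m\<in>low_mons 0 e 0 I l. lookup (single 0 (lookup f m) * mon_eval m) ?\<alpha>)"
        using ev0 unfolding ev1 lookup_sum by simp
      also have "\<dots> = (\<Sum>b\<leftarrow>?bl. \<Sum>j<len b. of_int (k b j) * c b j)"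
        unfolding sum_low_mons[OF Il]
      proof (intro arg_cong[of _ _ sum_list] map_cong refl)
        fix b assume b: "b \<in> set ?bl"
        obtain a i l' where x: "b = (a, i, l')" by (rule prod_cases3)
        show "(case b of (a, i, l) \<Rightarrow> \<Sum>j<l. lookup (single 0 (lookup f (xmon 0 a i j (e - a - i - j))) *
            mon_eval (xmon 0 a i j (e - a - i - j))) ?\<alpha>) = (\<Sum>j<len b. of_int (k b j) * c b j)"
          unfolding x prod.case len_def snd_conv using ev2[OF bl0[OF b[unfolded x]]] by (intro sum.cong refl)
      qed
      also have "\<dots> = dot r C" unfolding row C_def by (rule dot_concat[symmetric])
      finally show "length r = (\<Sum>(a, i, l)\<leftarrow>?bl. l) \<and> dot r C = 0"
        by (simp add: row length_concat comp_def len_def split_def)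
    qed
    then have C0: "c b j = 0" if "b \<in> set ?bl" "j < len b" for b j
      using that unfolding C_def by auto
    show "f = 0"
    proof (rule zero_if_block_coefficients_zero[OF f(2)])
      show "lookup f (xmon 0 a i j (e - a - i - j)) = 0" if "(a, i, l') \<in> set ?bl" "j < l'" for a i j l'
        using C0[of "(a, i, l')" j] that by (simp add: c_def len_def)
    qed
  qed simp_all
  then show ?thesis by simp
qed

section \<open>From finitely many checked degrees to all degrees\<close>

definition points_ok :: "int \<Rightarrow> nat \<Rightarrow> nat \<Rightarrow> (int \<times> int) list \<Rightarrow> int list list list \<Rightarrow> nat list \<Rightarrow>
    (nat \<times> nat \<times> nat \<times> nat) list \<Rightarrow> bool" where
  "points_ok p b s pts Ls ns ps \<longleftrightarrow> b \<le> 1 \<and> s = b + 2 \<and> forms_ok b s [1, 2, 3, 0] Ls \<and> vanish_ok b s pts Ls \<and>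
     pts \<noteq> [] \<and> map fst ps = [0..<length pts - 1] \<and>
     list_all (\<lambda>(e, A, I, l). (b = 0 \<longrightarrow> A = 0) \<and> (\<Sum>(a, i, l)\<leftarrow>blocks e A I l. l) = std_count b s Ls e) ps \<and>
     list_all (\<lambda>(a, i, j). a + i + j < length pts) (box b Ls) \<and> length (box b Ls) = length pts \<and>
     list_all (level_ok p (tables p pts ns) (length pts) ns) ps"

text \<open>Once e \<ge> D - 1, all D exponent triples of the box count, the low monomials are the D
  monomials x_(n-1)^j x_n^(e-j) with j < D, and the matrix to be tested has no columns.\<close>

lemma points_ok_witness:
  assumes ok: "points_ok p b s pts Ls ns ps"
  shows "\<exists>W F. lex_witness (b + 3) s (degs b Ls) e W (F :: nat \<Rightarrow> 'k::field_char_0 mpol)"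
proof -
  have b: "b \<le> 1" "s = b + 2" "forms_ok b s [1, 2, 3, 0] Ls" "vanish_ok b s pts Ls" "pts \<noteq> []"
    using ok by (auto simp: points_ok_def)
  show ?thesis
  proof (cases "e < length pts - 1")
    case True
    have "map fst ps = [0..<length pts - 1]" using ok unfolding points_ok_def by blast
    then have "set (map fst ps) = {0..<length pts - 1}" by (simp only: set_upt)
    with True have "e \<in> fst ` set ps" by simp
    then obtain A I l where ps: "(e, A, I, l) \<in> set ps" by force
    then have "(b = 0 \<longrightarrow> A = 0) \<and> (\<Sum>(a, i, l)\<leftarrow>blocks e A I l. l) = std_count b s Ls e"
      using ok unfolding points_ok_def list_all_iff by blast
    moreover have "level_ok p (tables p pts ns) (length pts) ns (e, A, I, l)"
      using ok ps unfolding points_ok_def list_all_iff by blast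
    ultimately show ?thesis using points_witness[OF b(3,1,2) _ b(4,5)] by blast
  next
    case False
    then have e: "length pts \<le> e + 1" by simp
    have "filter (\<lambda>(a, i, j). a + i + j \<le> e \<and> (s = b + 3 \<longrightarrow> e - a - i - j < length (Ls ! 3))) (box b Ls) = box b Ls"
      using ok e unfolding points_ok_def list_all_iff by (intro filter_True) fastforce
    moreover have "length (box b Ls) = length pts" using ok unfolding points_ok_def by blast
    ultimately have "std_count b s Ls e = length pts"
      unfolding std_count_def by (simp only:)
    moreover have "blocks e 0 0 (length pts) = [(0, 0, length pts)]" by (simp add: blocks_def)
    moreover from this have "level_ok p (tables p pts ns) (length pts) ns (e, 0, 0, length pts)"
      using e by (simp add: level_ok_def)
    ultimately show ?thesis using points_witness[OF b(3,1,2) _ b(4,5), of 0] by fastforce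
  qed
qed

definition artin_all_ok :: "int \<Rightarrow> int list list list \<Rightarrow> int list list \<Rightarrow> (nat \<times> nat \<times> nat) list \<Rightarrow> bool" where
  "artin_all_ok p Ls S ps \<longleftrightarrow> forms_ok 0 3 [0, 1, 2, 3] Ls \<and> subst_ok Ls S \<and>
     map fst ps = [0..<length (Ls ! 1) + length (Ls ! 2) + length (Ls ! 3) - 2] \<and> list_all (artin_ok p Ls S) ps \<and>
     list_all (\<lambda>(e, I, l). (\<Sum>(a, i, l)\<leftarrow>blocks e 0 I l. l) = std_count 0 3 Ls e) ps"

text \<open>Standard monomials have degree at most d_1 + d_2 + d_3 - 3. Beyond it the set of low
  monomials is empty, which is encoded by a single block of length 0.\<close>

lemma artin_ok_witness:
  assumes "artin_all_ok p Ls S ps"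
  shows "\<exists>W F. lex_witness 3 3 (degs 0 Ls) e W (F :: nat \<Rightarrow> 'k::field_char_0 mpol)"
proof -
  let ?k = "length (Ls ! 1) + length (Ls ! 2) + length (Ls ! 3) - 2"
  have a: "forms_ok 0 3 [0, 1, 2, 3] Ls" "subst_ok Ls S" "map fst ps = [0..<?k]" "list_all (artin_ok p Ls S) ps"
    "list_all (\<lambda>(e, I, l). (\<Sum>(a, i, l)\<leftarrow>blocks e 0 I l. l) = std_count 0 3 Ls e) ps"
    using assms unfolding artin_all_ok_def by blast+
  show ?thesis
  proof (cases "e < ?k")
    case True
    have "set (map fst ps) = {0..<?k}" unfolding a(3) by (rule set_upt)
    with True have "e \<in> fst ` set ps" by simp
    then obtain I l where ps: "(e, I, l) \<in> set ps" by force
    then have "(\<Sum>(a, i, l)\<leftarrow>blocks e 0 I l. l) = std_count 0 3 Ls e" "artin_ok p Ls S (e, I, l)"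
      using a(4,5) unfolding list_all_iff by blast+
    then show ?thesis using artin_witness[OF a(1,2)] by blast
  next
    case False
    have "filter (\<lambda>(a, i, j). a + i + j \<le> e \<and> (3 = 0 + (3::nat) \<longrightarrow> e - a - i - j < length (Ls ! 3))) (box 0 Ls) = []"
      unfolding filter_empty_conv box_def using False by auto
    then have "std_count 0 3 Ls e = 0" by (simp add: std_count_def)
    moreover have "blocks e 0 0 0 = [(0, 0, 0)]" by (simp add: blocks_def)
    moreover from this have "artin_ok p Ls S (e, 0, 0)" by (simp add: artin_ok_def)
    ultimately show ?thesis using artin_witness[OF a(1,2), of p e 0 0] by fastforce
  qed
qed

text \<open>Explicit data, found by computer search. The \<open>t\<close>-th entry \<open>(w, x)\<close> of a list of points stands for
  the point \<open>(w : x : t : 1)\<close>, or \<open>(x : t : 1)\<close> if \<open>n = 3\<close>; the points form the complete intersection of the products of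
  the listed linear forms. In the last list of each check, \<open>(e, A, I, l)\<close> describes the standard monomials of degree \<open>e\<close>.\<close>

definition "points_22 = ([(0, 0), (0, 1), (0, 0), (0, 1)]
    :: (int \<times> int) list)"

definition "forms_22 = ([[], [[0, 1, 0, 0], [0, 1, 0, - 1]], [[0, - 1, 1, 0], [0, - 1, 1, - 2]], []]
    :: int list list list)"

lemma points_ok_22: "points_ok 29 0 2 points_22 forms_22 [2]
    [(0, 0, 0, 1), (1, 0, 1, 1), (2, 0, 1, 1)]"
  by code_simp

lemmas witness_22 = points_ok_witness[OF points_ok_22, simplified]

definition "points_23 = ([(0, 0), (0, 1), (0, 0), (0, 1), (0, 0), (0, 1)]
    :: (int \<times> int) list)"

definition "forms_23 = ([[], [[0, 1, 0, 0], [0, 1, 0, - 1]], [[0, - 1, 1, 0], [0, - 1, 1, - 2], [0, - 1, 1, - 4]], []]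
    :: int list list list)"

lemma points_ok_23: "points_ok 29 0 2 points_23 forms_23 [2]
    [(0, 0, 0, 1), (1, 0, 1, 1), (2, 0, 1, 2), (3, 0, 1, 2), (4, 0, 1, 1)]"
  by code_simp

lemmas witness_23 = points_ok_witness[OF points_ok_23, simplified]

definition "points_33 = ([(0, 0), (0, 1), (0, 2), (0, 0), (0, 1), (0, 2), (0, 2), (0, 1), (0, 0)]
    :: (int \<times> int) list)"

text \<open>With y - x = 6 as third line, the points would be symmetric under (x, y) -> (2 - x, 8 -
  y). The even moments of x - 1 about y = 4 would vanish, and the matrix for e = 5, of size 3, would
  be singular. The line x + y = 8 breaks this symmetry.\<close>

definition "forms_33 = ([[], [[0, 1, 0, 0], [0, 1, 0, - 1], [0, 1, 0, - 2]], [[0, - 1, 1, 0], [0, - 1, 1, - 3], [0, 1, 1, - 8]], []]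
    :: int list list list)"

lemma points_ok_33: "points_ok 29 0 2 points_33 forms_33 [3]
    [(0, 0, 0, 1), (1, 0, 1, 1), (2, 0, 2, 1), (3, 0, 2, 1), (4, 0, 1, 4), (5, 0, 1, 3), (6, 0, 1, 2), (7, 0, 1,
    1)]"
  by code_simp

lemmas witness_33 = points_ok_witness[OF points_ok_33, simplified]

definition "points_222 = ([(0, 0), (1, 1), (0, 1), (1, 2), (0, 0), (1, 1), (0, 1), (1, 2)]
    :: (int \<times> int) list)"

definition "forms_222 = ([[[1, 0, 0, 0], [1, 0, 0, - 1]], [[- 1, 1, 0, 0], [- 1, 1, 0, - 1]], [[1, - 2, 1, 0], [1, - 2, 1, - 4]], []]
    :: int list list list)"

lemma points_ok_222: "points_ok 29 1 3 points_222 forms_222 [3, 1]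
    [(0, 0, 0, 1), (1, 1, 0, 1), (2, 1, 0, 1), (3, 0, 2, 1), (4, 0, 1, 3), (5, 0, 1, 2), (6, 0, 1, 1)]"
  by code_simp

lemmas witness_222 = points_ok_witness[OF points_ok_222, simplified]

definition "points_232 = ([(0, 0), (1, 1), (0, 1), (1, 2), (0, 2), (1, 3), (0, 0), (0, 1), (0, 2), (1, 1), (1, 2), (1, 3)]
    :: (int \<times> int) list)"

definition "forms_232 = ([[[1, 0, 0, 0], [1, 0, 0, - 1]], [[- 1, 1, 0, 0], [- 1, 1, 0, - 1], [- 1, 1, 0, - 2]], [[1, - 2, 1, 0], [- 2,
    - 1, 1, - 6]], []]
    :: int list list list)"

lemma points_ok_232: "points_ok 29 1 3 points_232 forms_232 [4, 1]
    [(0, 0, 0, 1), (1, 1, 0, 1), (2, 1, 0, 2), (3, 1, 0, 1), (4, 0, 2, 3), (5, 0, 2, 1), (6, 0, 1, 5), (7, 0, 1,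
    4), (8, 0, 1, 3), (9, 0, 1, 2), (10, 0, 1, 1)]"
  by code_simp

lemmas witness_232 = points_ok_witness[OF points_ok_232, simplified]

definition "points_233 = ([(0, 0), (1, 2), (0, 1), (1, 3), (0, 2), (1, 4), (0, 0), (1, 2), (0, 1), (1, 3), (0, 2), (1, 4), (0, 0), (0,
    1), (0, 2), (1, 2), (1, 3), (1, 4)]
    :: (int \<times> int) list)"

definition "forms_233 = ([[[1, 0, 0, 0], [1, 0, 0, - 1]], [[- 2, 1, 0, 0], [- 2, 1, 0, - 1], [- 2, 1, 0, - 2]], [[3, - 2, 1, 0], [3, -
    2, 1, - 6], [- 1, - 1, 1, - 12]], []]
    :: int list list list)"

lemma points_ok_233: "points_ok 29 1 3 points_233 forms_233 [5, 2]
    [(0, 0, 0, 1), (1, 1, 0, 1), (2, 1, 1, 1), (3, 1, 1, 1), (4, 1, 0, 2), (5, 0, 3, 3), (6, 0, 2, 5), (7, 0, 2,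
    3), (8, 0, 2, 1), (9, 0, 1, 8), (10, 0, 1, 7), (11, 0, 1, 6), (12, 0, 1, 5), (13, 0, 1, 4), (14, 0, 1, 3),
    (15, 0, 1, 2), (16, 0, 1, 1)]"
  by code_simp

lemmas witness_233 = points_ok_witness[OF points_ok_233, simplified]

definition "points_333 = ([(0, 0), (1, 2), (2, 4), (0, 1), (1, 3), (2, 5), (0, 2), (1, 4), (2, 6), (0, 0), (1, 2), (2, 4), (0, 1), (1,
    3), (2, 5), (0, 2), (1, 4), (2, 6), (2, 6), (2, 5), (2, 4), (1, 4), (1, 3), (1, 2), (0, 2), (0, 1), (0,
    0)]
    :: (int \<times> int) list)"

definition "forms_333 = ([[[1, 0, 0, 0], [1, 0, 0, - 1], [1, 0, 0, - 2]], [[- 2, 1, 0, 0], [- 2, 1, 0, - 1], [- 2, 1, 0, - 2]], [[5, -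
    3, 1, 0], [5, - 3, 1, - 9], [1, 1, 1, - 26]], []]
    :: int list list list)"

lemma points_ok_333: "points_ok 29 1 3 points_333 forms_333 [6, 3, 1]
    [(0, 0, 0, 1), (1, 1, 0, 1), (2, 2, 0, 1), (3, 2, 0, 1), (4, 1, 2, 1), (5, 1, 0, 5), (6, 0, 5, 2), (7, 0, 4,
    1), (8, 0, 3, 3), (9, 0, 2, 8), (10, 0, 2, 6), (11, 0, 2, 4), (12, 0, 2, 2), (13, 0, 1, 13), (14, 0, 1,
    12), (15, 0, 1, 11), (16, 0, 1, 10), (17, 0, 1, 9), (18, 0, 1, 8), (19, 0, 1, 7), (20, 0, 1, 6), (21, 0,
    1, 5), (22, 0, 1, 4), (23, 0, 1, 3), (24, 0, 1, 2), (25, 0, 1, 1)]"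
  by code_simp

lemmas witness_333 = points_ok_witness[OF points_ok_333, simplified]

text \<open>Row 0 is a placeholder for x_0. The other rows invert the change of coordinates to x_1,
  x_2 - x_1, x_3 - x_1 - x_2, whose powers are the forms used below.\<close>

definition "artin_subst = [[0, 0, 0, 0], [0, 1, 0, 0], [0, 1, 1, 0], [0, 2, 1, 1 :: int]]"

definition "artin_forms_222 = ([[], [[0, 1, 0, 0], [0, 1, 0, 0]], [[0, - 1, 1, 0], [0, - 1, 1, 0]], [[0, - 1, - 1, 1], [0, - 1, - 1, 1]]]
    :: int list list list)"

lemma artin_ok_222: "artin_all_ok 29 artin_forms_222 artin_subst
    [(0, 0, 1), (1, 1, 1), (2, 0, 3), (3, 0, 1)]"
  by code_simp

lemmas artin_witness_222 = artin_ok_witness[OF artin_ok_222]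

definition "artin_forms_232 = ([[], [[0, 1, 0, 0], [0, 1, 0, 0]], [[0, - 1, 1, 0], [0, - 1, 1, 0], [0, - 1, 1, 0]], [[0, - 1, - 1, 1], [0, -
    1, - 1, 1]]]
    :: int list list list)"

lemma artin_ok_232: "artin_all_ok 29 artin_forms_232 artin_subst
    [(0, 0, 1), (1, 1, 1), (2, 1, 1), (3, 0, 3), (4, 0, 1)]"
  by code_simp

lemmas artin_witness_232 = artin_ok_witness[OF artin_ok_232]

definition "artin_forms_233 = ([[], [[0, 1, 0, 0], [0, 1, 0, 0]], [[0, - 1, 1, 0], [0, - 1, 1, 0], [0, - 1, 1, 0]], [[0, - 1, - 1, 1], [0, -
    1, - 1, 1], [0, - 1, - 1, 1]]]
    :: int list list list)"

lemma artin_ok_233: "artin_all_ok 29 artin_forms_233 artin_subst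
    [(0, 0, 1), (1, 1, 1), (2, 1, 2), (3, 1, 1), (4, 0, 3), (5, 0, 1)]"
  by code_simp

lemmas artin_witness_233 = artin_ok_witness[OF artin_ok_233]

definition "artin_forms_333 = ([[], [[0, 1, 0, 0], [0, 1, 0, 0], [0, 1, 0, 0]], [[0, - 1, 1, 0], [0, - 1, 1, 0], [0, - 1, 1, 0]], [[0, - 1, -
    1, 1], [0, - 1, - 1, 1], [0, - 1, - 1, 1]]]
    :: int list list list)"

lemma artin_ok_333: "artin_all_ok 29 artin_forms_333 artin_subst
    [(0, 0, 1), (1, 1, 1), (2, 2, 1), (3, 1, 3), (4, 1, 1), (5, 0, 3), (6, 0, 1)]"
  by code_simp

lemmas artin_witness_333 = artin_ok_witness[OF artin_ok_333]

text \<open>No data as above were found for the degrees in the order \<open>(2, 2, 3)\<close>; this order is avoided by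
  permuting the forms.\<close>

lemma permuted_degrees_3:
  fixes d :: "nat \<Rightarrow> nat"
  assumes "\<forall>i\<in>{1..3}. 2 \<le> d i \<and> d i \<le> 3"
  obtains \<pi> :: "nat \<Rightarrow> nat" where "bij_betw \<pi> {1..3} {1..3}"
    "(d (\<pi> 1), d (\<pi> 2), d (\<pi> 3)) \<in> {(2, 2, 2), (2, 3, 2), (2, 3, 3), (3, 3, 3)}"
proof -
  have set3: "{1..3} = {1, 2, 3::nat}" "{Suc 0..3} = {Suc 0, 2, 3}" by auto
  have bij: "bij_betw id {1, 2, 3::nat} {1, 2, 3}" "bij_betw (id(1 := 2, 2 := 1)) {1, 2, 3::nat} {1, 2, 3}"
    "bij_betw (id(2 := 3, 3 := 2)) {1, 2, 3::nat} {1, 2, 3}" "bij_betw (id(1 := 3, 3 := 1)) {1, 2, 3::nat} {1, 2, 3}"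
    by (auto simp: bij_betw_def inj_on_def)
  have "d 1 = 2 \<or> d 1 = 3" "d 2 = 2 \<or> d 2 = 3" "d 3 = 2 \<or> d 3 = 3"
    using assms by (force simp: set3)+
  then consider "(d 1, d 2, d 3) \<in> {(2, 2, 2), (2, 3, 2), (2, 3, 3), (3, 3, 3)}"
    | "(d 1, d 2, d 3) \<in> {(3, 2, 2), (3, 2, 3)}" | "(d 1, d 2, d 3) = (2, 2, 3)" | "(d 1, d 2, d 3) = (3, 3, 2)"
    by auto
  then show thesis
  proof cases
    case 1
    then show ?thesis using that[of id] bij(1) by (simp add: set3)
  next
    case 2
    then show ?thesis using that[of "id(1 := 2, 2 := 1)"] bij(2) by (auto simp: set3)
  next
    case 3
    then show ?thesis using that[of "id(2 := 3, 3 := 2)"] bij(3) by (auto simp: set3)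
  next
    case 4
    then show ?thesis using that[of "id(1 := 3, 3 := 1)"] bij(4) by (auto simp: set3)
  qed
qed

lemma permuted_degrees_2:
  fixes d :: "nat \<Rightarrow> nat"
  assumes "\<forall>i\<in>{1..2}. 2 \<le> d i \<and> d i \<le> 3"
  obtains \<pi> :: "nat \<Rightarrow> nat" where "bij_betw \<pi> {1..2} {1..2}" "(d (\<pi> 1), d (\<pi> 2)) \<in> {(2, 2), (2, 3), (3, 3)}"
proof -
  have set2: "{1..2} = {1, 2::nat}" "{Suc 0..2} = {Suc 0, 2}" by auto
  have bij: "bij_betw id {1, 2::nat} {1, 2}" "bij_betw (id(1 := 2, 2 := 1)) {1, 2::nat} {1, 2}"
    by (auto simp: bij_betw_def inj_on_def)
  have "d 1 = 2 \<or> d 1 = 3" "d 2 = 2 \<or> d 2 = 3"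
    using assms by (force simp: set2)+
  then consider "(d 1, d 2) \<in> {(2, 2), (2, 3), (3, 3)}" | "(d 1, d 2) = (3, 2)" by auto
  then show thesis
  proof cases
    case 1
    then show ?thesis using that[of id] bij(1) by (simp add: set2)
  next
    case 2
    then show ?thesis using that[of "id(1 := 2, 2 := 1)"] bij(2) by (auto simp: set2)
  qed
qed

theorem corollary3p6:
  fixes n s :: nat and d :: "nat \<Rightarrow> nat"
    and a :: "nat \<times> (nat \<Rightarrow>\<^sub>0 nat) \<Rightarrow> 'k::field_char_0"
  assumes "0 < n" and "0 < s" and "\<forall>i\<in>{1..s}. 0 < d i"
    and "(n = 3 \<and> s = 2 \<and> (\<forall>i\<in>{1..s}. 2 \<le> d i \<and> d i \<le> 3)) \<or>
         (n = 3 \<and> s = 3 \<and> (\<forall>i\<in>{1..s}. 2 \<le> d i \<and> d i \<le> 3)) \<or>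
         (n = 4 \<and> s = 3 \<and> (\<forall>i\<in>{1..s}. 2 \<le> d i \<and> d i \<le> 3))"
    and "a \<in> V_set n s d"
  shows "lexsegment n (init_ideal (ideal_of n s d a))"
proof -
  have set2: "{Suc 0..2} = {Suc 0, 2}" and set3: "{Suc 0..3} = {Suc 0, 2, 3}" by auto
  consider (a) "n = 3" "s = 2" "\<forall>i\<in>{1..2}. 2 \<le> d i \<and> d i \<le> 3"
    | (b) "n = 3" "s = 3" "\<forall>i\<in>{1..3}. 2 \<le> d i \<and> d i \<le> 3"
    | (c) "n = 4" "s = 3" "\<forall>i\<in>{1..3}. 2 \<le> d i \<and> d i \<le> 3"
    using assms(4) by blast
  then show ?thesis
  proof cases
    case a
    note V = assms(5)[unfolded a(1,2)]
    obtain \<pi> :: "nat \<Rightarrow> nat" where \<pi>: "bij_betw \<pi> {1..2} {1..2}" "(d (\<pi> 1), d (\<pi> 2)) \<in> {(2, 2), (2, 3), (3, 3)}"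
      using permuted_degrees_2[OF a(3)] .
    from \<pi>(2) show ?thesis
    proof (elim insertE emptyE)
      assume d: "(d (\<pi> 1), d (\<pi> 2)) = (2, 2)"
      show ?thesis unfolding a(1,2)
        by (rule lexsegment_if_witnesses[OF V _ \<pi>(1) _ witness_22]) (use d in \<open>auto simp: set2 degs_def forms_22_def\<close>)
    next
      assume d: "(d (\<pi> 1), d (\<pi> 2)) = (2, 3)"
      show ?thesis unfolding a(1,2)
        by (rule lexsegment_if_witnesses[OF V _ \<pi>(1) _ witness_23]) (use d in \<open>auto simp: set2 degs_def forms_23_def\<close>)
    next
      assume d: "(d (\<pi> 1), d (\<pi> 2)) = (3, 3)"
      show ?thesis unfolding a(1,2)
        by (rule lexsegment_if_witnesses[OF V _ \<pi>(1) _ witness_33]) (use d in \<open>auto simp: set2 degs_def forms_33_def\<close>)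
    qed
  next
    case b
    note V = assms(5)[unfolded b(1,2)]
    obtain \<pi> :: "nat \<Rightarrow> nat" where \<pi>: "bij_betw \<pi> {1..3} {1..3}"
      "(d (\<pi> 1), d (\<pi> 2), d (\<pi> 3)) \<in> {(2, 2, 2), (2, 3, 2), (2, 3, 3), (3, 3, 3)}"
      using permuted_degrees_3[OF b(3)] .
    from \<pi>(2) show ?thesis
    proof (elim insertE emptyE)
      assume d: "(d (\<pi> 1), d (\<pi> 2), d (\<pi> 3)) = (2, 2, 2)"
      show ?thesis unfolding b(1,2)
        by (rule lexsegment_if_witnesses[OF V _ \<pi>(1) _ artin_witness_222]) (use d in \<open>auto simp: set3 degs_def artin_forms_222_def\<close>)
    next
      assume d: "(d (\<pi> 1), d (\<pi> 2), d (\<pi> 3)) = (2, 3, 2)"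
      show ?thesis unfolding b(1,2)
        by (rule lexsegment_if_witnesses[OF V _ \<pi>(1) _ artin_witness_232]) (use d in \<open>auto simp: set3 degs_def artin_forms_232_def\<close>)
    next
      assume d: "(d (\<pi> 1), d (\<pi> 2), d (\<pi> 3)) = (2, 3, 3)"
      show ?thesis unfolding b(1,2)
        by (rule lexsegment_if_witnesses[OF V _ \<pi>(1) _ artin_witness_233]) (use d in \<open>auto simp: set3 degs_def artin_forms_233_def\<close>)
    next
      assume d: "(d (\<pi> 1), d (\<pi> 2), d (\<pi> 3)) = (3, 3, 3)"
      show ?thesis unfolding b(1,2)
        by (rule lexsegment_if_witnesses[OF V _ \<pi>(1) _ artin_witness_333]) (use d in \<open>auto simp: set3 degs_def artin_forms_333_def\<close>)
    qed
  next
    case c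
    note V = assms(5)[unfolded c(1,2)]
    obtain \<pi> :: "nat \<Rightarrow> nat" where \<pi>: "bij_betw \<pi> {1..3} {1..3}"
      "(d (\<pi> 1), d (\<pi> 2), d (\<pi> 3)) \<in> {(2, 2, 2), (2, 3, 2), (2, 3, 3), (3, 3, 3)}"
      using permuted_degrees_3[OF c(3)] .
    from \<pi>(2) show ?thesis
    proof (elim insertE emptyE)
      assume d: "(d (\<pi> 1), d (\<pi> 2), d (\<pi> 3)) = (2, 2, 2)"
      show ?thesis unfolding c(1,2)
        by (rule lexsegment_if_witnesses[OF V _ \<pi>(1) _ witness_222]) (use d in \<open>auto simp: set3 degs_def forms_222_def\<close>)
    next
      assume d: "(d (\<pi> 1), d (\<pi> 2), d (\<pi> 3)) = (2, 3, 2)"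
      show ?thesis unfolding c(1,2)
        by (rule lexsegment_if_witnesses[OF V _ \<pi>(1) _ witness_232]) (use d in \<open>auto simp: set3 degs_def forms_232_def\<close>)
    next
      assume d: "(d (\<pi> 1), d (\<pi> 2), d (\<pi> 3)) = (2, 3, 3)"
      show ?thesis unfolding c(1,2)
        by (rule lexsegment_if_witnesses[OF V _ \<pi>(1) _ witness_233]) (use d in \<open>auto simp: set3 degs_def forms_233_def\<close>)
    next
      assume d: "(d (\<pi> 1), d (\<pi> 2), d (\<pi> 3)) = (3, 3, 3)"
      show ?thesis unfolding c(1,2)
        by (rule lexsegment_if_witnesses[OF V _ \<pi>(1) _ witness_333]) (use d in \<open>auto simp: set3 degs_def forms_333_def\<close>)
    qed
  qed
qed

end
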